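(* Let $\gamma\in(0,1)$. Suppose that $(X,m,T)$ is a weakly rationally ergodic measure preserving transformation of a standard $\sigma$-finite measure space, with $\gamma$-regularly varying return sequence $a(n)=a_n(T)$, which satisfies the integrated tied-down renewal mixing property. Then so does its natural extension $(\widetilde X,\widetilde m,\widetilde T)$; that is, $(\widetilde X,\widetilde m,\widetilde T)$ is weakly rationally ergodic with $\gamma$-regularly varying return sequence and satisfies the integrated tied-down renewal mixing property.
   Context: For a measure preserving transformation (MPT) $(X,m,T)$ of a $\sigma$-finite measure space: $\mathcal F_+:=\{A\in\mathcal B(X):0<m(A)<\infty\}$; $L^1_+$ is the set of non-negative functions in $L^1(m)$; $m(f):=\int_Xf\,dm$; $S_n(f):=\sum_{k=0}^{n-1}f\circ T^k$; $C_B(\mathbb R_+)$ is the space of bounded continuous functions on $\mathbb R_+=[0,\infty)$. Weak rational ergodicity. A conservative ergodic MPT $(X,m,T)$ is weakly rationally ergodic if there is $F\in\mathcal F_+$ such that $$\frac1{a_n(F)}\sum_{k=0}^{n-1}m(B\cap T^{-k}C)\to m(B)m(C)\quad\text{for all measurable }B,C\subset F,\qquad(\star)$$ where $a_n(F):=\frac1{m(F)^2}\sum_{k=0}^{n-1}m(F\cap T^{-k}F)$. $R(T)$ denotes the collection of all sets $F$ satisfying $(\star)$ (a hereditary ring); there is a sequence $a_n(T)$ (the return sequence) with $a_n(A)/a_n(T)\to1$ for all $A\in R(T)$. Rings. A ring of measurable sets of finite measure is hereditary if it contains every measurable subset of each of its members, and dense if every set of finite measure can be approximated arbitrarily well, in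 the sense of the measure of the symmetric difference, by members of the ring. Random variables. $Y_\gamma$ is the Mittag-Leffler random variable of order $\gamma$ normalized so that $\mathbb E(Y_\gamma)=1$, and $W_\gamma$ is the $\mathbb R_+$-valued random variable with $\mathbb E(g(W_\gamma))=\mathbb E(Y_\gamma g(Y_\gamma))$ for $g\in C_B(\mathbb R_+)$. Integrated tied-down renewal mixing property. With $a(n)=a_n(T)$ and $u(n)\sim\frac{\gamma a(n)}n$, for some dense hereditary ring $\mathcal R$ of sets of finite measure: $$\frac1{a(N)}\sum_{n=1}^N\left|\int_{B\cap T^{-n}C}g\left(\tfrac{S_n(f)}{a(n)}\right)dm-m(B)m(C)\,\mathbb E\big(g(m(f)W_\gamma)\big)u(n)\right|\xrightarrow[N\to\infty]{}0$$ for all $B,C\in\mathcal R\cap R(T)$, $g\in C_B(\mathbb R_+)$ and $f\in L^1_+$. (For $\widetilde T$: the same with $(\widetilde X,\widetilde m,\widetilde T)$, $R(\widetilde T)$, $a_n(\widetilde T)$ and a dense hereditary ring of subsets of $\widetilde X$.) Natural extension. $\widetilde T(x_1,x_2,\dots):=(Tx_1,x_1,x_2,\dots)$ on $\widetilde X=\{(x_1,x_2,\dots)\in X^{\mathbb N}:Tx_{n+1}=x_n\ \forall n\}$, with measure $\widetilde m$ determined by $\widetilde m([A_1,\dots,A_n])=m\left(\bigcap_{k=1}^nT^{-(n-k)}A_k\right)$, where $[A_1,\dots,A_n]=\{(x_1,x_2,\dots):x_k\in A_k\ \forall1\le k\le n\}$, $A_k\in\mathcal B(X)$. It is an invertible MPT,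 the minimal invertible extension of $(X,m,T)$ via $(x_1,x_2,\dots)\mapsto x_1$ (unique up to isomorphism). *)

theory Defs
  imports "HOL-Probability.Probability"
begin

section \<open>Measure preserving transformations\<close>

text \<open>A standard measurable space: the \<sigma>-algebra is the Borel \<sigma>-algebra of some Polish
  topology on the space.\<close>

definition standard_space :: "'a measure \<Rightarrow> bool" where
  "standard_space M \<longleftrightarrow>
     (\<exists>X. topspace X = space M \<and> completely_metrizable_space X \<and> second_countable X \<and>
          sets M = sigma_sets (space M) {U. openin X U})"

definition mpt :: "'a measure \<Rightarrow> ('a \<Rightarrow> 'a) \<Rightarrow> bool" where
  "mpt M T \<longleftrightarrow> sigma_finite_measure M \<and> T \<in> M \<rightarrow>\<^sub>M M \<and>
     (\<forall>A\<in>sets M. emeasure M (T -` A \<inter> space M) = emeasure M A)"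

definition conservative :: "'a measure \<Rightarrow> ('a \<Rightarrow> 'a) \<Rightarrow> bool" where
  "conservative M T \<longleftrightarrow>
     (\<forall>V\<in>sets M. disjoint_family (\<lambda>n. (T ^^ n) -` V \<inter> space M) \<longrightarrow> emeasure M V = 0)"

definition ergodic :: "'a measure \<Rightarrow> ('a \<Rightarrow> 'a) \<Rightarrow> bool" where
  "ergodic M T \<longleftrightarrow>
     (\<forall>A\<in>sets M. T -` A \<inter> space M = A \<longrightarrow> emeasure M A = 0 \<or> emeasure M (space M - A) = 0)"

section \<open>Weak rational ergodicity and return sequences\<close>

definition set_return_seq :: "'a measure \<Rightarrow> ('a \<Rightarrow> 'a) \<Rightarrow> 'a set \<Rightarrow> nat \<Rightarrow> real" where
  "set_return_seq M T F n = 1 / (measure M F)\<^sup>2 * (\<Sum>k<n. measure M (F \<inter> (T ^^ k) -` F))"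

text \<open>The ring \<open>R(T)\<close>. Null sets belong to it, because \<open>x / 0 = 0\<close> makes the defining
  convergence trivial for them; this is what a hereditary ring requires.\<close>

definition rat_erg_sets :: "'a measure \<Rightarrow> ('a \<Rightarrow> 'a) \<Rightarrow> 'a set set" where
  "rat_erg_sets M T =
     {F \<in> sets M. emeasure M F < \<infinity> \<and>
        (\<forall>B\<in>sets M. \<forall>C\<in>sets M. B \<subseteq> F \<longrightarrow> C \<subseteq> F \<longrightarrow>
           (\<lambda>n. 1 / set_return_seq M T F n * (\<Sum>k<n. measure M (B \<inter> (T ^^ k) -` C)))
             \<longlonglongrightarrow> measure M B * measure M C)}"

definition weakly_rationally_ergodic :: "'a measure \<Rightarrow> ('a \<Rightarrow> 'a) \<Rightarrow> bool" where
  "weakly_rationally_ergodic M T \<longleftrightarrow>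
     mpt M T \<and> conservative M T \<and> ergodic M T \<and> (\<exists>F\<in>rat_erg_sets M T. 0 < emeasure M F)"

text \<open>The return sequence \<open>a\<^sub>n(T)\<close> is determined only up to asymptotic equivalence, hence a predicate.
  The value at \<open>0\<close> plays no role.\<close>

definition return_sequence :: "'a measure \<Rightarrow> ('a \<Rightarrow> 'a) \<Rightarrow> (nat \<Rightarrow> real) \<Rightarrow> bool" where
  "return_sequence M T a \<longleftrightarrow> (\<forall>n\<ge>1. 0 < a n) \<and>
     (\<forall>A\<in>rat_erg_sets M T. 0 < emeasure M A \<longrightarrow> (\<lambda>n. set_return_seq M T A n / a n) \<longlonglongrightarrow> 1)"

definition regularly_varying :: "real \<Rightarrow> (nat \<Rightarrow> real) \<Rightarrow> bool" where
  "regularly_varying \<gamma> a \<longleftrightarrow> (\<forall>\<^sub>F n in sequentially. 0 < a n) \<and>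
     (\<forall>c>0. (\<lambda>n. a (nat \<lfloor>c * real n\<rfloor>) / a n) \<longlonglongrightarrow> c powr \<gamma>)"

section \<open>The limit laws\<close>

definition C_B :: "(real \<Rightarrow> real) set" where
  "C_B = {g. continuous_on {0..} g \<and> bounded (g ` {0..})}"

text \<open>Random variables with values in \<open>[0,\<infinity>)\<close> enter only through their laws, which are probability
  measures on the Borel sets of \<open>[0,\<infinity>)\<close>.\<close>

definition nonneg_law :: "real measure \<Rightarrow> bool" where
  "nonneg_law Y \<longleftrightarrow> prob_space Y \<and> sets Y = sets (restrict_space borel {0..})"

text \<open>The law of \<open>Y\<^sub>\<gamma>\<close>, given by its moment generating function. The factor \<open>\<Gamma>(1+\<gamma>)\<^sup>k\<close> is the
  normalization to mean \<open>1\<close>.\<close>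

definition mittag_leffler_law :: "real \<Rightarrow> real measure \<Rightarrow> bool" where
  "mittag_leffler_law \<gamma> Y \<longleftrightarrow> nonneg_law Y \<and>
     (\<forall>z::real. has_bochner_integral Y (\<lambda>y. exp (z * y))
        (\<Sum>k. Gamma (1 + \<gamma>) ^ k * z ^ k / Gamma (1 + real k * \<gamma>)))"

text \<open>The law of \<open>W\<^sub>\<gamma>\<close>, when \<open>Y\<close> is the law of \<open>Y\<^sub>\<gamma>\<close>.\<close>

definition size_biased_law :: "real measure \<Rightarrow> real measure \<Rightarrow> bool" where
  "size_biased_law Y W \<longleftrightarrow> nonneg_law W \<and>
     (\<forall>g\<in>C_B. (\<integral>w. g w \<partial>W) = (\<integral>y. y * g y \<partial>Y))"

section \<open>Integrated tied-down renewal mixing\<close>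

definition dense_hereditary_ring :: "'a measure \<Rightarrow> 'a set set \<Rightarrow> bool" where
  "dense_hereditary_ring M R \<longleftrightarrow>
     ring_of_sets (space M) R \<and>
     (\<forall>A\<in>R. A \<in> sets M \<and> emeasure M A < \<infinity>) \<and>
     (\<forall>A\<in>R. \<forall>B\<in>sets M. B \<subseteq> A \<longrightarrow> B \<in> R) \<and>
     (\<forall>A\<in>sets M. emeasure M A < \<infinity> \<longrightarrow> (\<forall>\<epsilon>>0. \<exists>B\<in>R. measure M (sym_diff A B) < \<epsilon>))"

definition birkhoff_sum :: "('a \<Rightarrow> 'a) \<Rightarrow> ('a \<Rightarrow> real) \<Rightarrow> nat \<Rightarrow> 'a \<Rightarrow> real" where
  "birkhoff_sum T f n x = (\<Sum>k<n. f ((T ^^ k) x))"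

definition L1_nonneg :: "'a measure \<Rightarrow> ('a \<Rightarrow> real) set" where
  "L1_nonneg M = {f. integrable M f \<and> (\<forall>x\<in>space M. 0 \<le> f x)}"

text \<open>\<open>W\<close> stands for the law of \<open>W\<^sub>\<gamma>\<close>. The condition does not depend on the versions \<open>a\<close> and \<open>u\<close> of
  the sequences \<open>a\<^sub>n(T)\<close> and \<open>\<gamma> a\<^sub>n(T) / n\<close>, which are given up to asymptotic equivalence.\<close>

definition integrated_tied_down_renewal_mixing ::
    "real \<Rightarrow> real measure \<Rightarrow> 'a measure \<Rightarrow> ('a \<Rightarrow> 'a) \<Rightarrow> bool" where
  "integrated_tied_down_renewal_mixing \<gamma> W M T \<longleftrightarrow>
     (\<forall>a u. return_sequence M T a \<longrightarrow> u \<sim>[sequentially] (\<lambda>n. \<gamma> * a n / real n) \<longrightarrow>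
       (\<exists>R. dense_hereditary_ring M R \<and>
         (\<forall>B \<in> R \<inter> rat_erg_sets M T. \<forall>C \<in> R \<inter> rat_erg_sets M T. \<forall>g\<in>C_B. \<forall>f\<in>L1_nonneg M.
           (\<lambda>N. 1 / a N * (\<Sum>n=1..N.
               \<bar>(LINT x:(B \<inter> (T ^^ n) -` C)|M. g (birkhoff_sum T f n x / a n))
                 - measure M B * measure M C * (\<integral>w. g ((\<integral>x. f x \<partial>M) * w) \<partial>W) * u n\<bar>))
             \<longlonglongrightarrow> 0)))"

section \<open>The natural extension\<close>

text \<open>Sequences are indexed from \<open>0\<close>, so \<open>x k\<close> is the coordinate \<open>x\<^bsub>k+1\<^esub>\<close>.\<close>

definition nat_ext_space :: "'a measure \<Rightarrow> ('a \<Rightarrow> 'a) \<Rightarrow> (nat \<Rightarrow> 'a) set" where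
  "nat_ext_space M T = {x. (\<forall>k. x k \<in> space M) \<and> (\<forall>k. T (x (Suc k)) = x k)}"

definition nat_ext_map :: "('a \<Rightarrow> 'a) \<Rightarrow> (nat \<Rightarrow> 'a) \<Rightarrow> (nat \<Rightarrow> 'a)" where
  "nat_ext_map T x = case_nat (T (x 0)) x"

text \<open>\<open>M'\<close> is the measure space of the natural extension: the trace of the product
  \<sigma>-algebra together with the measure prescribed on the cylinders \<open>[A\<^sub>1, \<dots>, A\<^sub>n]\<close>.
  The prescription determines the measure uniquely when \<open>M\<close> is \<sigma>-finite.\<close>

definition natural_extension_measure ::
    "'a measure \<Rightarrow> ('a \<Rightarrow> 'a) \<Rightarrow> (nat \<Rightarrow> 'a) measure \<Rightarrow> bool" where
  "natural_extension_measure M T M' \<longleftrightarrow>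
     sets M' = sets (restrict_space (Pi\<^sub>M UNIV (\<lambda>_. M)) (nat_ext_space M T)) \<and>
     (\<forall>n\<ge>1. \<forall>A. (\<forall>k<n. A k \<in> sets M) \<longrightarrow>
        emeasure M' {x \<in> nat_ext_space M T. \<forall>k<n. x k \<in> A k} =
        emeasure M (\<Inter>k<n. (T ^^ (n - Suc k)) -` A k \<inter> space M))"

end

theory Submission
  imports Defs "HOL-Real_Asymp.Real_Asymp"
begin

text \<open>
  Fix a set \<open>G\<close> of positive measure in \<open>R(T)\<close> and in the given ring, and let \<open>G'\<close> be the set of points
  of the natural extension whose coordinate 0 lies in \<open>G\<close>. For sets \<open>C\<close> and functions \<open>f\<close> depending on
  the coordinate 0 and \<open>B \<subseteq> G'\<close> arbitrary, the limit law for \<open>B \<inter> T'\<^sup>-\<^sup>n C\<close> follows from the one downstairs by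
  conditioning \<open>B\<close> on the coordinate 0. To pass to arbitrary \<open>C \<subseteq> G'\<close>, cut \<open>C\<close> according to the last
  visit to \<open>G'\<close> before a given time in the past: after a shift the pieces depend on the coordinate 0 only,
  and the remainder is negligible because the averages of \<open>m(G' \<inter> T'\<^sup>-\<^sup>n E)\<close> are uniformly small in
  \<open>m(E)\<close>. The latter comes from time reversal and the tightness of the laws of the occupation times of \<open>G\<close>.
  General \<open>f\<close> are reached by approximation in \<open>L\<^sup>1\<close> and Hopf's maximal inequality. The case \<open>g = 1\<close>
  gives \<open>G' \<in> R(T')\<close>, hence ergodicity; by invertibility of \<open>T'\<close> all sets in \<open>R(T')\<close> have the same
  return sequence, and the dense ring upstairs consists of the sets that are covered by finitely many
  preimages of \<open>G'\<close>.
\<close>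

section \<open>Weighted averages and limit laws\<close>

text \<open>The law downstairs is used for subsets of \<open>G\<close> only. If a right set
  \<open>C\<close> depends on the coordinates up to k, its preimage under T'^k depends on the
  coordinate 0, but it lies over a preimage of \<open>G\<close> instead of over \<open>G\<close>,
  where no law is given. Cutting at the last visit makes the shifted pieces subsets of
  \<open>lift G\<close>, at the price of a countable partition with unbounded shifts; the laws are
  limits in n for a fixed set, so the remainder needs a bound that is uniform over sets. Left and
  right sets are not symmetric: on the left, everything but the indicator of \<open>B\<close> is a
  function of the coordinate 0, and conditioning is exact. Four approximations (of normalizations,
  left sets, right sets and functions) follow one pattern, which is why \<open>avg_law\<close> has
  abstract weights and abstract normalized sums. Functions stay bounded up to the last of them,
  since a shift of time by one step changes an ergodic sum by single values of the function, and
  these disappear after division by a(n) only when they are bounded.\<close>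

locale renewal_averages =
  fixes a u :: "nat \<Rightarrow> real" and W :: "real measure"
  assumes a_pos: "\<And>n. 1 \<le> n \<Longrightarrow> 0 < a n"
    and a_top: "filterlim a at_top sequentially"
    and a_ratio: "(\<lambda>n. a (Suc n) / a n) \<longlonglongrightarrow> 1"
    and u_ratio: "(\<lambda>n. u (Suc n)) \<sim>[sequentially] u"
    and u_bound: "\<exists>K. \<forall>\<^sub>F N in sequentially. (\<Sum>n=1..N. \<bar>u n\<bar>) \<le> K * a N"
    and W_prob: "prob_space W"
    and W_borel: "(\<lambda>y. y) \<in> borel_measurable W"
begin

text \<open>A form without limsup of the seminorm limsup (1/a(N)) sum |c n|. Since \<open>a\<close>
  tends to infinity, finitely many terms of \<open>c\<close> matter only up to an arbitrarily small
  increase of \<open>e\<close>. Sums start at 1, so \<open>c 0\<close> never counts and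
  \<open>a 0\<close> is unconstrained.\<close>

definition avg_le :: "real \<Rightarrow> (nat \<Rightarrow> real) \<Rightarrow> bool" where
  "avg_le e c \<longleftrightarrow> (\<forall>\<^sub>F N in sequentially. (\<Sum>n=1..N. \<bar>c n\<bar>) \<le> e * a N)"

definition avg_null :: "(nat \<Rightarrow> real) \<Rightarrow> bool" where
  "avg_null c \<longleftrightarrow> (\<forall>e>0. avg_le e c)"

lemma a_pos_eventually: "\<forall>\<^sub>F N in sequentially. 0 < a N"
  using a_pos eventually_ge_at_top[of 1] by (rule eventually_mono[rotated])

lemma avg_le_mono:
  assumes "avg_le e c" "e \<le> e'" "\<And>n. 1 \<le> n \<Longrightarrow> \<bar>d n\<bar> \<le> \<bar>c n\<bar>"
  shows "avg_le e' d"
  unfolding avg_le_def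
proof (use assms(1)[unfolded avg_le_def] a_pos_eventually in eventually_elim)
  fix N assume *: "(\<Sum>n=1..N. \<bar>c n\<bar>) \<le> e * a N" "0 < a N"
  have "(\<Sum>n=1..N. \<bar>d n\<bar>) \<le> (\<Sum>n=1..N. \<bar>c n\<bar>)" by (rule sum_mono) (use assms(3) in auto)
  also note *(1)
  also have "e * a N \<le> e' * a N" using assms(2) *(2) by simp
  finally show "(\<Sum>n=1..N. \<bar>d n\<bar>) \<le> e' * a N" .
qed

lemma avg_le_add:
  assumes "avg_le e c" "avg_le e' d" "\<And>n. 1 \<le> n \<Longrightarrow> \<bar>b n\<bar> \<le> \<bar>c n\<bar> + \<bar>d n\<bar>"
  shows "avg_le (e + e') b"
  unfolding avg_le_def
proof (use assms(1,2)[unfolded avg_le_def] in eventually_elim)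
  fix N assume *: "(\<Sum>n=1..N. \<bar>c n\<bar>) \<le> e * a N" "(\<Sum>n=1..N. \<bar>d n\<bar>) \<le> e' * a N"
  have "(\<Sum>n=1..N. \<bar>b n\<bar>) \<le> (\<Sum>n=1..N. \<bar>c n\<bar> + \<bar>d n\<bar>)" by (rule sum_mono) (use assms(3) in auto)
  also have "\<dots> \<le> (e + e') * a N" using * by (simp add: sum.distrib algebra_simps)
  finally show "(\<Sum>n=1..N. \<bar>b n\<bar>) \<le> (e + e') * a N" .
qed

lemma avg_le_cmult:
  assumes "avg_le e c"
  shows "avg_le (\<bar>k\<bar> * e) (\<lambda>n. k * c n)"
  unfolding avg_le_def
proof (use assms[unfolded avg_le_def] in eventually_elim)
  fix N assume "(\<Sum>n=1..N. \<bar>c n\<bar>) \<le> e * a N"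
  then have "\<bar>k\<bar> * (\<Sum>n=1..N. \<bar>c n\<bar>) \<le> \<bar>k\<bar> * (e * a N)" by (simp add: mult_left_mono)
  then show "(\<Sum>n=1..N. \<bar>k * c n\<bar>) \<le> \<bar>k\<bar> * e * a N"
    by (simp add: abs_mult sum_distrib_left mult.assoc)
qed

lemma avg_null_le: "avg_null c \<Longrightarrow> 0 < e \<Longrightarrow> avg_le e c"
  by (simp add: avg_null_def)

lemma avg_null_mono:
  assumes "avg_null c" "\<And>n. 1 \<le> n \<Longrightarrow> \<bar>d n\<bar> \<le> \<bar>c n\<bar>"
  shows "avg_null d"
  using assms avg_le_mono[OF _ order_refl] unfolding avg_null_def by blast

lemma avg_null_add:
  assumes "avg_null c" "avg_null d" "\<And>n. 1 \<le> n \<Longrightarrow> \<bar>b n\<bar> \<le> \<bar>c n\<bar> + \<bar>d n\<bar>"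
  shows "avg_null b"
  unfolding avg_null_def
proof (intro allI impI)
  fix e :: real assume "0 < e"
  then have "avg_le (e/2) c" "avg_le (e/2) d" using assms by (auto simp: avg_null_def)
  from avg_le_add[OF this assms(3)] show "avg_le e b" by simp
qed

lemma avg_null_cmult:
  assumes "avg_null c"
  shows "avg_null (\<lambda>n. k * c n)"
  unfolding avg_null_def
proof (intro allI impI)
  fix e :: real assume "0 < e"
  then have "avg_le (e / (\<bar>k\<bar> + 1)) c" using assms by (auto simp: avg_null_def)
  from avg_le_cmult[OF this, of k] have "avg_le (\<bar>k\<bar> * (e / (\<bar>k\<bar> + 1))) (\<lambda>n. k * c n)" .
  moreover have "\<bar>k\<bar> * (e / (\<bar>k\<bar> + 1)) \<le> e"
    using \<open>0 < e\<close> by (simp add: field_simps add_pos_nonneg)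
  ultimately show "avg_le e (\<lambda>n. k * c n)" by (rule avg_le_mono) auto
qed

lemma avg_null_zero: "avg_null (\<lambda>n. 0)"
  unfolding avg_null_def avg_le_def
proof (intro allI impI)
  fix e :: real assume "0 < e"
  show "\<forall>\<^sub>F N in sequentially. (\<Sum>n = 1..N. \<bar>0\<bar>) \<le> e * a N"
    using a_pos_eventually by eventually_elim (use \<open>0 < e\<close> in auto)
qed

lemma avg_null_sum:
  assumes "finite I" "\<And>i. i \<in> I \<Longrightarrow> avg_null (c i)"
  shows "avg_null (\<lambda>n. \<Sum>i\<in>I. c i n)"
  using assms
proof (induction rule: finite_induct)
  case empty then show ?case using avg_null_zero by simp
next
  case (insert i I)
  have "avg_null (c i)" "avg_null (\<lambda>n. \<Sum>i\<in>I. c i n)" using insert by auto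
  then show ?case by (rule avg_null_add) (use insert in auto)
qed

lemma avg_null_iff: "avg_null c \<longleftrightarrow> (\<lambda>N. 1 / a N * (\<Sum>n=1..N. \<bar>c n\<bar>)) \<longlonglongrightarrow> 0"
proof
  assume c: "avg_null c"
  show "(\<lambda>N. 1 / a N * (\<Sum>n=1..N. \<bar>c n\<bar>)) \<longlonglongrightarrow> 0"
  proof (rule tendstoI)
    fix e :: real assume "0 < e"
    then have "avg_le (e/2) c" using c by (simp add: avg_null_def)
    then show "\<forall>\<^sub>F N in sequentially. dist (1 / a N * (\<Sum>n=1..N. \<bar>c n\<bar>)) 0 < e"
      unfolding avg_le_def using a_pos_eventually
    proof eventually_elim
      case (elim N)
      have "0 \<le> (\<Sum>n=1..N. \<bar>c n\<bar>)" by (simp add: sum_nonneg)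
      moreover have "e/2 * a N < e * a N" using elim \<open>0 < e\<close> by simp
      then have "(\<Sum>n=1..N. \<bar>c n\<bar>) < e * a N" using elim by linarith
      ultimately show ?case using elim \<open>0 < e\<close> by (simp add: dist_real_def abs_mult divide_less_eq)
    qed
  qed
next
  assume c: "(\<lambda>N. 1 / a N * (\<Sum>n=1..N. \<bar>c n\<bar>)) \<longlonglongrightarrow> 0"
  show "avg_null c" unfolding avg_null_def avg_le_def
  proof (intro allI impI)
    fix e :: real assume "0 < e"
    from order_tendstoD(2)[OF c this] a_pos_eventually
    show "\<forall>\<^sub>F N in sequentially. (\<Sum>n=1..N. \<bar>c n\<bar>) \<le> e * a N"
      by eventually_elim (simp add: field_simps)
  qed
qed

text \<open>Beyond some \<open>n0\<close> the factor \<open>r\<close> is below any prescribed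
  \<open>d\<close>, so that part costs at most \<open>d\<close> times the average of
  \<open>v\<close>; the first \<open>n0\<close> terms contribute a constant, which is absorbed
  because \<open>a\<close> tends to infinity.\<close>

lemma avg_null_small_factor:
  assumes v: "avg_le K v" and r: "r \<longlonglongrightarrow> 0"
    and le: "\<forall>\<^sub>F n in sequentially. \<bar>c n\<bar> \<le> r n * \<bar>v n\<bar>"
  shows "avg_null c"
  unfolding avg_null_def
proof (intro allI impI)
  fix e :: real assume e: "0 < e"
  define k where "k = \<bar>K\<bar> + 1"
  have k: "0 < k" "K \<le> k" by (auto simp: k_def)
  define d where "d = e / (2 * k)"
  have d: "0 < d" using e k by (simp add: d_def)
  have "\<forall>\<^sub>F n in sequentially. \<bar>c n\<bar> \<le> d * \<bar>v n\<bar>"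
    using le order_tendstoD(2)[OF r d]
    by eventually_elim (meson abs_ge_zero dual_order.trans less_le mult_right_mono)
  then obtain n0 where n0: "\<And>n. n0 \<le> n \<Longrightarrow> \<bar>c n\<bar> \<le> d * \<bar>v n\<bar>"
    unfolding eventually_sequentially by blast
  define A where "A = (\<Sum>n=1..n0. \<bar>c n\<bar>)"
  have bound: "(\<Sum>n=1..N. \<bar>c n\<bar>) \<le> A + d * (\<Sum>n=1..N. \<bar>v n\<bar>)" for N
  proof -
    have "(\<Sum>n=1..N. \<bar>c n\<bar>) \<le> (\<Sum>n=1..N. (if n \<le> n0 then \<bar>c n\<bar> else 0) + d * \<bar>v n\<bar>)"
      by (rule sum_mono) (use n0 d in auto)
    also have "\<dots> = (\<Sum>n=1..N. if n \<le> n0 then \<bar>c n\<bar> else 0) + d * (\<Sum>n=1..N. \<bar>v n\<bar>)"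
      by (simp add: sum.distrib sum_distrib_left)
    also have "(\<Sum>n=1..N. if n \<le> n0 then \<bar>c n\<bar> else 0) = (\<Sum>n\<in>{1..N} \<inter> {..n0}. \<bar>c n\<bar>)"
      by (subst sum.inter_restrict) auto
    also have "\<dots> \<le> A" unfolding A_def by (rule sum_mono2) auto
    finally show ?thesis by simp
  qed
  have "\<forall>\<^sub>F N in sequentially. A / (e/2) \<le> a N"
    using a_top unfolding filterlim_at_top by blast
  then show "avg_le e c"
    unfolding avg_le_def using v[unfolded avg_le_def] a_pos_eventually
  proof eventually_elim
    case (elim N)
    have "d * (\<Sum>n=1..N. \<bar>v n\<bar>) \<le> d * (K * a N)" using elim d by simp
    also have "\<dots> = d * K * a N" by simp
    also have "\<dots> \<le> e/2 * a N"
    proof (rule mult_right_mono)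
      have "d * K \<le> d * k" using d k by (intro mult_left_mono) auto
      also have "\<dots> = e/2" unfolding d_def using k by simp
      finally show "d * K \<le> e/2" .
    qed (use elim in simp)
    finally show ?case using bound[of N] elim e by (simp add: field_simps)
  qed
qed

lemma sum_Suc_shift: "(\<Sum>n=1..Suc N. c n) = c 1 + (\<Sum>n=1..N. c (Suc n))" for c :: "nat \<Rightarrow> real"
  by (induction N) auto

text \<open>The two sums differ by one boundary term, and replacing a(N + 1) by a(N) costs a factor
  tending to 1.\<close>

lemma avg_null_Suc: "avg_null (\<lambda>n. c (Suc n)) \<longleftrightarrow> avg_null c"
proof
  assume c: "avg_null (\<lambda>n. c (Suc n))"
  show "avg_null c" unfolding avg_null_def
  proof (intro allI impI)
    fix e :: real assume e: "0 < e"
    have "avg_le (e/2) (\<lambda>n. c (Suc n))" using c e by (simp add: avg_null_def)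
    moreover have "\<forall>\<^sub>F N in sequentially. \<bar>c 1\<bar> / (e/2) \<le> a N"
      using a_top unfolding filterlim_at_top by blast
    ultimately show "avg_le e c" unfolding avg_le_def
    proof eventually_elim
      case (elim N)
      have "(\<Sum>n=1..N. \<bar>c n\<bar>) \<le> (\<Sum>n=1..Suc N. \<bar>c n\<bar>)" by simp
      then show ?case using elim e unfolding sum_Suc_shift by (simp add: field_simps)
    qed
  qed
next
  assume c: "avg_null c"
  show "avg_null (\<lambda>n. c (Suc n))" unfolding avg_null_def
  proof (intro allI impI)
    fix e :: real assume e: "0 < e"
    have "avg_le (e/2) c" using c e by (simp add: avg_null_def)
    then have "\<forall>\<^sub>F N in sequentially. (\<Sum>n=1..Suc N. \<bar>c n\<bar>) \<le> e/2 * a (Suc N)"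
      unfolding avg_le_def by (subst eventually_sequentially_Suc)
    moreover have "\<forall>\<^sub>F N in sequentially. a (Suc N) / a N < 2"
      by (rule order_tendstoD(2)[OF a_ratio]) simp
    ultimately show "avg_le e (\<lambda>n. c (Suc n))" unfolding avg_le_def using a_pos_eventually
    proof eventually_elim
      case (elim N)
      have "e/2 * a (Suc N) \<le> e/2 * (2 * a N)" using elim e by (intro mult_left_mono) (simp_all add: field_simps)
      then show ?case using elim unfolding sum_Suc_shift by simp
    qed
  qed
qed

lemma u_avg: obtains K where "0 < K" "avg_le K u"
proof -
  obtain K where "avg_le K u" using u_bound unfolding avg_le_def by blast
  then have "avg_le (max K 1) u" by (rule avg_le_mono) auto
  then show thesis using that[of "max K 1"] by simp
qed

lemma avg_null_asymp_equiv:
  assumes v: "v \<sim>[sequentially] u"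
  shows "avg_null (\<lambda>n. v n - u n)"
proof -
  obtain K where K: "0 < K" "avg_le K u" by (rule u_avg)
  \<comment> \<open>The value 1 at 0/0 is the convention of \<open>asymp_equiv\<close>. The
    factorization v - u = (q - 1) u holds wherever u is nonzero, and eventually everywhere because
    the zeros of both sequences eventually agree.\<close>
  define q where "q = (\<lambda>n. if v n = 0 \<and> u n = 0 then 1 else v n / u n)"
  have q: "q \<longlonglongrightarrow> 1" using v unfolding asymp_equiv_def q_def .
  show ?thesis
  proof (rule avg_null_small_factor[OF K(2)])
    show "(\<lambda>n. \<bar>q n - 1\<bar>) \<longlonglongrightarrow> 0" using q by (auto intro!: tendsto_eq_intros)
    show "\<forall>\<^sub>F n in sequentially. \<bar>v n - u n\<bar> \<le> \<bar>q n - 1\<bar> * \<bar>u n\<bar>"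
      using asymp_equiv_eventually_zeros[OF v]
    proof eventually_elim
      case (elim n)
      show ?case
      proof (cases "u n = 0")
        case False
        then have "v n - u n = (q n - 1) * u n" by (simp add: q_def field_simps)
        then show ?thesis by (simp add: abs_mult)
      qed (use elim in simp)
    qed
  qed
qed


lemma avg_le_plus: "avg_le e c \<Longrightarrow> avg_le e' d \<Longrightarrow> avg_le (e + e') (\<lambda>n. c n + d n)"
  by (rule avg_le_add) auto

lemma avg_le_abs: "avg_le e (\<lambda>n. \<bar>c n\<bar>) \<longleftrightarrow> avg_le e c"
  by (simp add: avg_le_def)

text \<open>A continuous stand-in for the indicator of large |t|: it vanishes for |t| \<le> L and
  equals 1 for |t| \<ge> L + 1. Laws can be tested only against continuous functions.\<close>

definition ramp :: "real \<Rightarrow> real \<Rightarrow> real" where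
  "ramp L t = max 0 (min 1 (\<bar>t\<bar> - L))"

lemma ramp_bounds: "0 \<le> ramp L t" "ramp L t \<le> 1"
  by (auto simp: ramp_def)

lemma continuous_ramp [continuous_intros]: "continuous_on A (ramp L)"
  unfolding ramp_def by (intro continuous_intros)

lemma bounded_ramp: "bounded (range (ramp L))"
  unfolding bounded_iff by (rule exI[of _ 1]) (auto simp: ramp_def)

section \<open>Integrals against the rescaled limit law\<close>

definition W_mean :: "(real \<Rightarrow> real) \<Rightarrow> real \<Rightarrow> real" where
  "W_mean g w = (\<integral>y. g (w * y) \<partial>W)"

lemma W_mean_integrable:
  fixes g :: "real \<Rightarrow> real"
  assumes "continuous_on UNIV g" "bounded (range g)"
  shows "integrable W (\<lambda>y. g (w * y))"
proof -
  interpret prob_space W by (rule W_prob)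
  obtain K where K: "\<And>y. \<bar>g y\<bar> \<le> K" using assms(2) by (auto simp: bounded_iff)
  have [measurable]: "g \<in> borel_measurable borel" using assms(1) by (rule borel_measurable_continuous_onI)
  note [measurable] = W_borel
  show ?thesis by (rule integrable_const_bound[of _ K]) (use K in auto)
qed

lemma W_mean_bound:
  assumes "continuous_on UNIV g" "\<And>y. \<bar>g y\<bar> \<le> K"
  shows "\<bar>W_mean g w\<bar> \<le> K"
proof -
  interpret prob_space W by (rule W_prob)
  have b: "bounded (range g)" using assms(2) by (auto simp: bounded_iff)
  have "\<bar>W_mean g w\<bar> \<le> (\<integral>y. \<bar>g (w * y)\<bar> \<partial>W)" unfolding W_mean_def by (rule integral_abs_bound)
  also have "\<dots> \<le> (\<integral>y. K \<partial>W)"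
    by (rule integral_mono) (use W_mean_integrable[OF assms(1) b] assms(2) in auto)
  finally show ?thesis by (simp add: prob_space)
qed

text \<open>Continuity in the scaling is required because the integral of an approximating function
  only comes close to that of the given function, so the limit law is rescaled slightly.\<close>

lemma W_mean_cont:
  assumes "continuous_on UNIV g" "bounded (range g)"
  shows "isCont (W_mean g) w"
proof (rule continuous_at_sequentiallyI)
  interpret prob_space W by (rule W_prob)
  obtain K where K: "\<And>y. \<bar>g y\<bar> \<le> K" using assms(2) by (auto simp: bounded_iff)
  have [measurable]: "g \<in> borel_measurable borel" using assms(1) by (rule borel_measurable_continuous_onI)
  note [measurable] = W_borel
  fix s assume s: "s \<longlonglongrightarrow> w"
  show "(\<lambda>n. W_mean g (s n)) \<longlonglongrightarrow> W_mean g w" unfolding W_mean_def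
  proof (rule integral_dominated_convergence[where w="\<lambda>_. K"])
    show "AE y in W. (\<lambda>n. g (s n * y)) \<longlonglongrightarrow> g (w * y)"
    proof (rule AE_I2)
      fix y
      have "isCont g (w * y)" using assms(1) by (simp add: continuous_on_eq_continuous_at)
      then show "(\<lambda>n. g (s n * y)) \<longlonglongrightarrow> g (w * y)"
        by (rule isCont_tendsto_compose) (intro tendsto_mult s tendsto_const)
    qed
  qed (use K in auto)
qed

text \<open>Tightness of the single law \<open>W\<close>, uniform over a bounded range of scalings:
  \<open>ramp L\<close> increases with |t|, so the largest scaling is the worst one.\<close>

lemma W_tail:
  assumes "0 < e"
  obtains L where "0 \<le> L" "\<And>w. \<bar>w\<bar> \<le> w0 \<Longrightarrow> W_mean (ramp L) w \<le> e"
proof -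
  interpret prob_space W by (rule W_prob)
  note [measurable] = W_borel
  have [measurable]: "ramp L \<in> borel_measurable borel" for L
    by (rule borel_measurable_continuous_onI) (rule continuous_ramp)
  have "(\<lambda>n. \<integral>y. ramp (real n) (w0 * y) \<partial>W) \<longlonglongrightarrow> (\<integral>y. 0 \<partial>W)"
  proof (rule integral_dominated_convergence[where w="\<lambda>_. 1"])
    show "AE y in W. (\<lambda>n. ramp (real n) (w0 * y)) \<longlonglongrightarrow> 0"
    proof (rule AE_I2)
      fix y
      have "\<forall>\<^sub>F n in sequentially. \<bar>w0 * y\<bar> \<le> real n" by real_asymp
      then have "\<forall>\<^sub>F n in sequentially. ramp (real n) (w0 * y) = 0"
        by eventually_elim (simp add: ramp_def)
      then show "(\<lambda>n. ramp (real n) (w0 * y)) \<longlonglongrightarrow> 0" by (rule tendsto_eventually)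
    qed
  qed (auto simp: ramp_def)
  then have "\<forall>\<^sub>F n in sequentially. W_mean (ramp (real n)) w0 < e"
    unfolding W_mean_def using assms by (auto dest: order_tendstoD(2))
  then obtain n where n: "W_mean (ramp (real n)) w0 < e"
    by (auto simp: eventually_sequentially)
  have "W_mean (ramp (real n)) w \<le> e" if "\<bar>w\<bar> \<le> w0" for w
  proof -
    have "W_mean (ramp (real n)) w \<le> W_mean (ramp (real n)) w0" unfolding W_mean_def
    proof (rule integral_mono)
      fix y
      have "\<bar>w * y\<bar> \<le> \<bar>w0 * y\<bar>" using that by (simp add: abs_mult mult_right_mono)
      then show "ramp (real n) (w * y) \<le> ramp (real n) (w0 * y)" unfolding ramp_def by linarith
    qed (use W_mean_integrable continuous_ramp bounded_ramp in auto)
    then show ?thesis using n by simp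
  qed
  then show thesis using that[of "real n"] by simp
qed

text \<open>The weights \<open>D n\<close> generalize the indicator functions of \<open>B \<inter> T\<^sup>-\<^sup>n C\<close>, and \<open>\<phi> n\<close> the
  normalized ergodic sums.\<close>

definition avg_law ::
    "'b measure \<Rightarrow> (nat \<Rightarrow> 'b \<Rightarrow> real) \<Rightarrow> (nat \<Rightarrow> 'b \<Rightarrow> real) \<Rightarrow> real \<Rightarrow> real \<Rightarrow> bool" where
  "avg_law M D \<phi> c w \<longleftrightarrow> (\<forall>g. continuous_on UNIV g \<longrightarrow> bounded (range g) \<longrightarrow>
     avg_null (\<lambda>n. (\<integral>x. D n x * g (\<phi> n x) \<partial>M) - c * W_mean g w * u n))"

lemma avg_lawD:
  "avg_law M D \<phi> c w \<Longrightarrow> continuous_on UNIV g \<Longrightarrow> bounded (range g) \<Longrightarrow>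
    avg_null (\<lambda>n. (\<integral>x. D n x * g (\<phi> n x) \<partial>M) - c * W_mean g w * u n)"
  by (simp add: avg_law_def)

lemma avg_law_mass:
  assumes "avg_law M D \<phi> c w"
  shows "avg_null (\<lambda>n. (\<integral>x. D n x \<partial>M) - c * u n)"
proof -
  interpret prob_space W by (rule W_prob)
  show ?thesis using avg_lawD[OF assms, of "\<lambda>_. 1"] by (simp add: W_mean_def prob_space)
qed

lemma avg_law_cong:
  assumes "avg_law M D \<phi> c w"
    and "\<And>n g. 1 \<le> n \<Longrightarrow> continuous_on UNIV g \<Longrightarrow> bounded (range g) \<Longrightarrow>
      (\<integral>x. D' n x * g (\<phi>' n x) \<partial>M') = (\<integral>x. D n x * g (\<phi> n x) \<partial>M)"
  shows "avg_law M' D' \<phi>' c w"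
  unfolding avg_law_def
proof (intro allI impI)
  fix g :: "real \<Rightarrow> real" assume g: "continuous_on UNIV g" "bounded (range g)"
  show "avg_null (\<lambda>n. (\<integral>x. D' n x * g (\<phi>' n x) \<partial>M') - c * W_mean g w * u n)"
    by (rule avg_null_mono[OF avg_lawD[OF assms(1) g]]) (simp add: assms(2)[OF _ g])
qed

text \<open>\<open>avg_null_Suc\<close> moves the errors by one index, and u(n + 1) ~ u(n) repairs
  the comparison term.\<close>

lemma avg_law_Suc:
  "avg_law M (\<lambda>n. D (Suc n)) (\<lambda>n. \<phi> (Suc n)) c w \<longleftrightarrow> avg_law M D \<phi> c w"
proof -
  have "avg_null (\<lambda>n. (\<integral>x. D (Suc n) x * g (\<phi> (Suc n) x) \<partial>M) - c * W_mean g w * u n) \<longleftrightarrow>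
        avg_null (\<lambda>n. (\<integral>x. D n x * g (\<phi> n x) \<partial>M) - c * W_mean g w * u n)" for g
  proof -
    have d: "avg_null (\<lambda>n. c * W_mean g w * (u (Suc n) - u n))"
      by (rule avg_null_cmult[OF avg_null_asymp_equiv[OF u_ratio]])
    show ?thesis
      unfolding avg_null_Suc[of "\<lambda>n. (\<integral>x. D n x * g (\<phi> n x) \<partial>M) - c * W_mean g w * u n", symmetric]
    proof
      assume "avg_null (\<lambda>n. (\<integral>x. D (Suc n) x * g (\<phi> (Suc n) x) \<partial>M) - c * W_mean g w * u n)"
      then show "avg_null (\<lambda>n. (\<integral>x. D (Suc n) x * g (\<phi> (Suc n) x) \<partial>M) - c * W_mean g w * u (Suc n))"
        using d by (rule avg_null_add) (simp add: algebra_simps)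
    next
      assume "avg_null (\<lambda>n. (\<integral>x. D (Suc n) x * g (\<phi> (Suc n) x) \<partial>M) - c * W_mean g w * u (Suc n))"
      then show "avg_null (\<lambda>n. (\<integral>x. D (Suc n) x * g (\<phi> (Suc n) x) \<partial>M) - c * W_mean g w * u n)"
        using d by (rule avg_null_add) (simp add: algebra_simps)
    qed
  qed
  then show ?thesis by (auto simp: avg_law_def)
qed

lemma integrable_weight:
  assumes "integrable M D" "\<phi> \<in> borel_measurable M" "g \<in> borel_measurable borel" "bounded (range g)"
  shows "integrable M (\<lambda>x. D x * g (\<phi> x :: real) :: real)"
proof -
  obtain K where K: "\<And>y. \<bar>g y\<bar> \<le> K" using assms(4) by (auto simp: bounded_iff)
  have [measurable]: "D \<in> borel_measurable M" using assms(1) by simp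
  note [measurable] = assms(2,3)
  show ?thesis
  proof (rule Bochner_Integration.integrable_bound[where f="\<lambda>x. K * D x"])
    show "AE x in M. norm (D x * g (\<phi> x)) \<le> norm (K * D x)"
    proof (rule AE_I2)
      fix x
      have "\<bar>g (\<phi> x)\<bar> \<le> \<bar>K\<bar>" using K[of "\<phi> x"] by linarith
      from mult_left_mono[OF this abs_ge_zero[of "D x"]]
      show "norm (D x * g (\<phi> x)) \<le> norm (K * D x)" by (simp add: abs_mult mult.commute)
    qed
  qed (use assms(1) in auto)
qed

lemma avg_law_sum:
  assumes "finite I" and law: "\<And>i. i \<in> I \<Longrightarrow> avg_law M (D i) \<phi> (c i) w"
    and D: "\<And>i n. i \<in> I \<Longrightarrow> integrable M (D i n)" and \<phi>: "\<And>n. \<phi> n \<in> borel_measurable M"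
  shows "avg_law M (\<lambda>n x. \<Sum>i\<in>I. D i n x) \<phi> (\<Sum>i\<in>I. c i) w"
  unfolding avg_law_def
proof (intro allI impI)
  fix g :: "real \<Rightarrow> real" assume g: "continuous_on UNIV g" "bounded (range g)"
  have gm: "g \<in> borel_measurable borel" using g(1) by (rule borel_measurable_continuous_onI)
  have "avg_null (\<lambda>n. \<Sum>i\<in>I. (\<integral>x. D i n x * g (\<phi> n x) \<partial>M) - c i * W_mean g w * u n)"
    by (rule avg_null_sum[OF assms(1)]) (rule avg_lawD[OF law g])
  moreover have "(\<Sum>i\<in>I. (\<integral>x. D i n x * g (\<phi> n x) \<partial>M) - c i * W_mean g w * u n) =
      (\<integral>x. (\<Sum>i\<in>I. D i n x) * g (\<phi> n x) \<partial>M) - (\<Sum>i\<in>I. c i) * W_mean g w * u n" for n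
    unfolding sum_subtractf sum_distrib_right
    by (subst Bochner_Integration.integral_sum) (auto intro: integrable_weight D \<phi> gm g)
  ultimately show "avg_null (\<lambda>n. (\<integral>x. (\<Sum>i\<in>I. D i n x) * g (\<phi> n x) \<partial>M) - (\<Sum>i\<in>I. c i) * W_mean g w * u n)"
    by simp
qed

lemma avg_law_scale:
  assumes "avg_law M D \<phi> c w"
  shows "avg_law M (\<lambda>n x. k * D n x) \<phi> (k * c) w"
  unfolding avg_law_def
proof (intro allI impI)
  fix g :: "real \<Rightarrow> real" assume g: "continuous_on UNIV g" "bounded (range g)"
  show "avg_null (\<lambda>n. (\<integral>x. k * D n x * g (\<phi> n x) \<partial>M) - k * c * W_mean g w * u n)"
    using avg_null_cmult[OF avg_lawD[OF assms g], of k] by (simp add: algebra_simps)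
qed

lemma avg_le_of_null:
  assumes "avg_null (\<lambda>n. x n - k * u n)" "avg_le K u" "0 \<le> K" "0 < e" "\<bar>k\<bar> \<le> k'" "k' * K \<le> e'"
  shows "avg_le (e + e') x"
proof (rule avg_le_add)
  show "avg_le e (\<lambda>n. x n - k * u n)" using assms(1,4) by (rule avg_null_le)
  show "avg_le e' (\<lambda>n. k * u n)"
  proof (rule avg_le_mono[OF avg_le_cmult[OF assms(2), of k]])
    show "\<bar>k\<bar> * K \<le> e'" using assms(3,5,6) by (meson mult_right_mono order_trans)
  qed auto
qed auto

text \<open>Testing with \<open>ramp L\<close> turns tightness of the limit law into tightness of
  the weighted laws in the averaged sense. The ramp dominates the indicator only from L + 1
  on.\<close>

lemma avg_law_tail:
  assumes law: "avg_law M D \<phi> c w" and D: "\<And>n. integrable M (D n)"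
    and D0: "\<And>n x. x \<in> space M \<Longrightarrow> 0 \<le> D n x" and \<phi>: "\<And>n. \<phi> n \<in> borel_measurable M" and e: "0 < e"
  obtains L where "0 < L" "avg_le e (\<lambda>n. \<integral>x. D n x * indicator {x. L \<le> \<bar>\<phi> n x\<bar>} x \<partial>M)"
proof -
  obtain K where K: "0 < K" "avg_le K u" by (rule u_avg)
  \<comment> \<open>Makes |c| t K at most e/2, where \<open>K\<close> bounds the averages of
    \<open>u\<close>; adding 1 to |c| avoids a division by 0.\<close>
  define t where "t = e / (2 * K * (\<bar>c\<bar> + 1))"
  have t: "0 < t" using e K by (simp add: t_def add_nonneg_pos)
  obtain L where L: "0 \<le> L" "\<And>w'. \<bar>w'\<bar> \<le> \<bar>w\<bar> \<Longrightarrow> W_mean (ramp L) w' \<le> t" using W_tail[OF t] by metis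
  have m: "ramp L \<in> borel_measurable borel" by (rule borel_measurable_continuous_onI[OF continuous_ramp])
  have W0: "0 \<le> W_mean (ramp L) w" unfolding W_mean_def by (simp add: ramp_bounds integral_nonneg_AE)
  have "avg_le (e/2 + e/2) (\<lambda>n. \<integral>x. D n x * ramp L (\<phi> n x) \<partial>M)"
  proof (rule avg_le_of_null[OF avg_lawD[OF law continuous_ramp bounded_ramp] K(2)])
    show "\<bar>c * W_mean (ramp L) w\<bar> \<le> \<bar>c\<bar> * t" using L(2)[of w] W0 by (simp add: abs_mult mult_left_mono)
    have "\<bar>c\<bar> * t * K \<le> (\<bar>c\<bar> + 1) * t * K" using K t by (intro mult_right_mono) auto
    also have "\<dots> = e/2" unfolding t_def using K by (simp add: add_nonneg_pos less_imp_neq[symmetric])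
    finally show "\<bar>c\<bar> * t * K \<le> e/2" .
  qed (use K e in auto)
  then have "avg_le e (\<lambda>n. \<integral>x. D n x * indicator {x. L + 1 \<le> \<bar>\<phi> n x\<bar>} x \<partial>M)"
  proof (rule avg_le_mono)
    fix n
    have "0 \<le> (\<integral>x. D n x * indicator {x. L + 1 \<le> \<bar>\<phi> n x\<bar>} x \<partial>M)"
      by (rule integral_nonneg_AE) (use D0 in \<open>auto intro!: AE_I2\<close>)
    moreover have "(\<integral>x. D n x * indicator {x. L + 1 \<le> \<bar>\<phi> n x\<bar>} x \<partial>M) \<le> (\<integral>x. D n x * ramp L (\<phi> n x) \<partial>M)"
    proof (rule integral_mono)
      have "integrable M (\<lambda>x. D n x * indicator {y. L + 1 \<le> \<bar>y\<bar>} (\<phi> n x))"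
        by (rule integrable_weight[OF D \<phi>]) (auto simp: bounded_iff indicator_def intro!: exI[of _ 1])
      then show "integrable M (\<lambda>x. D n x * indicator {x. L + 1 \<le> \<bar>\<phi> n x\<bar>} x)"
        by (rule back_subst[of "integrable M"]) (auto simp: indicator_def)
      show "integrable M (\<lambda>x. D n x * ramp L (\<phi> n x))"
        by (rule integrable_weight[OF D \<phi> m bounded_ramp])
      fix x assume "x \<in> space M"
      then show "D n x * indicator {x. L + 1 \<le> \<bar>\<phi> n x\<bar>} x \<le> D n x * ramp L (\<phi> n x)"
        by (intro mult_left_mono D0) (auto simp: ramp_def indicator_def)
    qed
    ultimately show "\<bar>\<integral>x. D n x * indicator {x. L + 1 \<le> \<bar>\<phi> n x\<bar>} x \<partial>M\<bar> \<le> \<bar>\<integral>x. D n x * ramp L (\<phi> n x) \<partial>M\<bar>"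
      by simp
  qed simp
  then show thesis using that[of "L+1"] L(1) by simp
qed

text \<open>Three-epsilon argument behind all later extensions. Write D g(\<phi>) - D' g(\<phi>') as
  g(\<phi>) (D - D') + D' (g(\<phi>) - g(\<phi>')). The second part is small where \<phi>' is
  bounded and close to \<phi>, by uniform continuity on a compact interval; the other points are
  covered by tightness of the approximating law and by the last closeness condition.\<close>

lemma avg_law_approx:
  assumes D: "\<And>n. integrable M (D n)" and \<phi>: "\<And>n. \<phi> n \<in> borel_measurable M"
    and approx: "\<And>e. 0 < e \<Longrightarrow> \<exists>D' \<phi>' c' w'.
      (\<forall>n. integrable M (D' n)) \<and> (\<forall>n. \<forall>x\<in>space M. 0 \<le> D' n x) \<and> (\<forall>n. \<phi>' n \<in> borel_measurable M) \<and>
      avg_law M D' \<phi>' c' w' \<and> \<bar>c' - c\<bar> \<le> e \<and> \<bar>w' - w\<bar> \<le> e \<and>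
      avg_le e (\<lambda>n. \<integral>x. \<bar>D n x - D' n x\<bar> \<partial>M) \<and>
      avg_le e (\<lambda>n. \<integral>x. D' n x * indicator {x. e < \<bar>\<phi> n x - \<phi>' n x\<bar>} x \<partial>M)"
  shows "avg_law M D \<phi> c w"
  unfolding avg_law_def avg_null_def
proof (intro allI impI)
  fix g :: "real \<Rightarrow> real" and \<eta> :: real
  assume g: "continuous_on UNIV g" "bounded (range g)" and \<eta>: "0 < \<eta>"
  have gm[measurable]: "g \<in> borel_measurable borel" using g(1) by (rule borel_measurable_continuous_onI)
  obtain G0 where G0: "\<And>y. \<bar>g y\<bar> \<le> G0" using g(2) by (auto simp: bounded_iff)
  define G where "G = \<bar>G0\<bar> + 1"
  have G: "0 < G" "\<And>y. \<bar>g y\<bar> \<le> G" unfolding G_def using G0 by (auto intro: order_trans[OF G0])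
  obtain K where K: "0 < K" "avg_le K u" by (rule u_avg)
  define C where "C = \<bar>c\<bar> + 1"
  have C: "0 < C" "\<bar>c\<bar> \<le> C" by (auto simp: C_def)
  \<comment> \<open>The six contributions estimated below add up to 9 q.\<close>
  define q where "q = \<eta> / 10"
  have q: "0 < q" using \<eta> by (simp add: q_def)
  define e2 where "e2 = q / (C * K)"
  define e3 where "e3 = q / (2 * G * C * K)"
  have e2: "0 < e2" "C * e2 * K = q" and e3: "0 < e3" "2 * G * (C * e3 * K) = q"
    using q C K G by (auto simp: e2_def e3_def)
  \<comment> \<open>\<open>L\<close> has to be fixed before the approximant is chosen, because the
    accuracy \<open>e\<close> depends on the modulus of continuity of \<open>g\<close> on an
    interval determined by \<open>L\<close>. Every admissible scaling satisfies |w'| \<le> |w| +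
    1.\<close>
  obtain L where L: "0 \<le> L" "\<And>w'. \<bar>w'\<bar> \<le> \<bar>w\<bar> + 1 \<Longrightarrow> W_mean (ramp L) w' \<le> e3"
    using W_tail[OF e3(1)] by metis
  \<comment> \<open>If |\<phi>'| \<le> L + 1 and |\<phi> - \<phi>'| \<le> e \<le> 1, both values lie
    in this interval.\<close>
  have "uniformly_continuous_on {-(L+2)..L+2} g"
    by (rule compact_uniformly_continuous) (use g(1) continuous_on_subset in auto)
  then obtain d where d: "0 < d" "\<And>y y'. y \<in> {-(L+2)..L+2} \<Longrightarrow> y' \<in> {-(L+2)..L+2} \<Longrightarrow>
      \<bar>y' - y\<bar> < d \<Longrightarrow> \<bar>g y' - g y\<bar> < e2"
    unfolding uniformly_continuous_on_def dist_real_def using e2(1) by metis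
  have "isCont (W_mean g) w" by (rule W_mean_cont[OF g])
  then obtain d3 where d3: "0 < d3" "\<And>w'. \<bar>w' - w\<bar> < d3 \<Longrightarrow> \<bar>W_mean g w' - W_mean g w\<bar> < e2"
    unfolding continuous_at_eps_delta dist_real_def using e2(1) by metis
  \<comment> \<open>The entries serve in turn the interval and the bounds on |c'| and |w'|; the
    uniform continuity of \<open>g\<close>; the continuity of \<open>W_mean g\<close>; the terms
    \<open>s4\<close> and \<open>s5\<close>; and the error of c' in \<open>s6\<close>.\<close>
  define e where "e = Min {1, d/2, d3/2, q / (2 * G), q / (G * K)}"
  have e: "0 < e" unfolding e_def using d d3 q G K by auto
  have "\<forall>t\<in>{1, d/2, d3/2, q / (2 * G), q / (G * K)}. e \<le> t"
    unfolding e_def by (intro ballI Min_le) auto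
  then have "e \<le> 1" "e \<le> d/2" "e \<le> d3/2" "e \<le> q / (2 * G)" "e \<le> q / (G * K)"
    by simp_all
  then have e_le: "e \<le> 1" "e < d" "e < d3" "2 * G * e \<le> q" "G * e \<le> q" "e * G * K \<le> q"
    using d d3 G K q by (auto simp: field_simps)
  obtain D' \<phi>' c' w' where D': "\<And>n. integrable M (D' n)" "\<And>n x. x \<in> space M \<Longrightarrow> 0 \<le> D' n x"
      and \<phi>': "\<And>n. \<phi>' n \<in> borel_measurable M" and law: "avg_law M D' \<phi>' c' w'"
      and c': "\<bar>c' - c\<bar> \<le> e" and w': "\<bar>w' - w\<bar> \<le> e"
      and close: "avg_le e (\<lambda>n. \<integral>x. \<bar>D n x - D' n x\<bar> \<partial>M)"
        "avg_le e (\<lambda>n. \<integral>x. D' n x * indicator {x. e < \<bar>\<phi> n x - \<phi>' n x\<bar>} x \<partial>M)"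
    using approx[OF e] by blast
  note [measurable] = \<phi> \<phi>'
  have [measurable]: "D n \<in> borel_measurable M" "D' n \<in> borel_measurable M" for n using D D'(1) by auto
  have c'C: "\<bar>c'\<bar> \<le> C" using c' e_le(1) by (simp add: C_def)
  have rm[measurable]: "ramp L \<in> borel_measurable borel" by (rule borel_measurable_continuous_onI[OF continuous_ramp])
  have W0: "0 \<le> W_mean (ramp L) w'" unfolding W_mean_def by (simp add: ramp_bounds integral_nonneg_AE)
  define s1 where "s1 = (\<lambda>n. (\<integral>x. D' n x * g (\<phi>' n x) \<partial>M) - c' * W_mean g w' * u n)"
  define s2 where "s2 = (\<lambda>n. \<integral>x. D' n x \<partial>M)"
  define s3 where "s3 = (\<lambda>n. \<integral>x. D' n x * ramp L (\<phi>' n x) \<partial>M)"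
  define s4 where "s4 = (\<lambda>n. \<integral>x. \<bar>D n x - D' n x\<bar> \<partial>M)"
  define s5 where "s5 = (\<lambda>n. \<integral>x. D' n x * indicator {x. e < \<bar>\<phi> n x - \<phi>' n x\<bar>} x \<partial>M)"
  have s1: "avg_le q s1" unfolding s1_def using avg_lawD[OF law g] q by (rule avg_null_le)
  have s2: "avg_le (2 * q) (\<lambda>n. e2 * s2 n)"
  proof -
    have "avg_le (q / e2 + q / e2) s2"
      unfolding s2_def by (rule avg_le_of_null[OF avg_law_mass[OF law] K(2) _ _ c'C])
        (use e2 K q in \<open>auto simp: field_simps\<close>)
    from avg_le_cmult[OF this, of e2] show ?thesis using e2 q by (simp add: field_simps)
  qed
  have s3: "avg_le (2 * q) (\<lambda>n. 2 * G * s3 n)"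
  proof -
    have "avg_le (q / (2 * G) + q / (2 * G)) s3"
      unfolding s3_def
    proof (rule avg_le_of_null[OF avg_lawD[OF law continuous_ramp bounded_ramp] K(2)])
      have "W_mean (ramp L) w' \<le> e3" by (rule L(2)) (use w' e_le in linarith)
      then show "\<bar>c' * W_mean (ramp L) w'\<bar> \<le> C * e3"
        using c'C W0 C by (auto simp: abs_mult intro!: mult_mono)
    qed (use e3 K q G in \<open>auto simp: field_simps\<close>)
    from avg_le_cmult[OF this, of "2*G"] show ?thesis using G by (simp add: field_simps)
  qed
  have s4: "avg_le q (\<lambda>n. G * s4 n)"
    by (rule avg_le_mono[OF avg_le_cmult[OF close(1)[folded s4_def], of G]]) (use G e_le in auto)
  have s5: "avg_le q (\<lambda>n. 2 * G * s5 n)"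
    by (rule avg_le_mono[OF avg_le_cmult[OF close(2)[folded s5_def], of "2*G"]]) (use G e_le in auto)
  have s6: "avg_le (2 * q) (\<lambda>n. (c' * W_mean g w' - c * W_mean g w) * u n)"
  proof (rule avg_le_mono[OF avg_le_cmult[OF K(2)]])
    have "\<bar>c' * W_mean g w' - c * W_mean g w\<bar> = \<bar>(c' - c) * W_mean g w' + c * (W_mean g w' - W_mean g w)\<bar>"
      by (simp add: algebra_simps)
    also have "\<dots> \<le> \<bar>c' - c\<bar> * \<bar>W_mean g w'\<bar> + \<bar>c\<bar> * \<bar>W_mean g w' - W_mean g w\<bar>"
      by (metis abs_mult abs_triangle_ineq)
    also have "\<dots> \<le> e * G + C * e2"
      by (intro add_mono mult_mono c' C W_mean_bound[OF g(1)] G less_imp_le[OF d3(2)])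
        (use e C e_le w' in auto)
    finally have "\<bar>c' * W_mean g w' - c * W_mean g w\<bar> * K \<le> (e * G + C * e2) * K" using K by simp
    then show "\<bar>c' * W_mean g w' - c * W_mean g w\<bar> * K \<le> 2 * q" using e_le e2 by (simp add: algebra_simps)
  qed auto
  have total: "\<bar>(\<integral>x. D n x * g (\<phi> n x) \<partial>M) - c * W_mean g w * u n\<bar> \<le>
      \<bar>s1 n\<bar> + \<bar>e2 * s2 n\<bar> + \<bar>2 * G * s3 n\<bar> + \<bar>G * s4 n\<bar> + \<bar>2 * G * s5 n\<bar> +
      \<bar>(c' * W_mean g w' - c * W_mean g w) * u n\<bar>" for n
  proof -
    have i1: "integrable M (\<lambda>x. D n x * g (\<phi> n x))" by (rule integrable_weight[OF D \<phi> gm g(2)])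
    have i2: "integrable M (\<lambda>x. D' n x * g (\<phi>' n x))" by (rule integrable_weight[OF D'(1) \<phi>' gm g(2)])
    have i3: "integrable M (\<lambda>x. D' n x * ramp L (\<phi>' n x))"
      by (rule integrable_weight[OF D'(1) \<phi>' rm bounded_ramp])
    have i4: "integrable M (\<lambda>x. \<bar>D n x - D' n x\<bar>)" using D D' by auto
    have "integrable M (\<lambda>x. D' n x * indicator {y. e < \<bar>y\<bar>} (\<phi> n x - \<phi>' n x))"
      by (rule integrable_weight[OF D'(1)]) (auto simp: bounded_iff indicator_def intro!: exI[of _ 1])
    then have i5: "integrable M (\<lambda>x. D' n x * indicator {x. e < \<bar>\<phi> n x - \<phi>' n x\<bar>} x)"
      by (rule back_subst[of "integrable M"]) (auto simp: indicator_def)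
    have pt: "\<bar>D n x * g (\<phi> n x) - D' n x * g (\<phi>' n x)\<bar> \<le>
        G * \<bar>D n x - D' n x\<bar> + (e2 * D' n x + (2 * G * (D' n x * ramp L (\<phi>' n x)) +
        2 * G * (D' n x * indicator {x. e < \<bar>\<phi> n x - \<phi>' n x\<bar>} x)))" if x: "x \<in> space M" for x
    proof -
      have *: "\<bar>g (\<phi> n x) - g (\<phi>' n x)\<bar> \<le> e2 + 2 * G * ramp L (\<phi>' n x) + 2 * G * indicator {x. e < \<bar>\<phi> n x - \<phi>' n x\<bar>} x"
      proof -
        have b: "\<bar>g (\<phi> n x) - g (\<phi>' n x)\<bar> \<le> 2 * G" using G(2)[of "\<phi> n x"] G(2)[of "\<phi>' n x"] by linarith
        consider "e < \<bar>\<phi> n x - \<phi>' n x\<bar>" | "L + 1 \<le> \<bar>\<phi>' n x\<bar>" | "\<bar>\<phi> n x - \<phi>' n x\<bar> \<le> e" "\<bar>\<phi>' n x\<bar> \<le> L + 1"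
          by linarith
        then show ?thesis
        proof cases
          case 1
          have "0 \<le> 2 * G * ramp L (\<phi>' n x)" using G ramp_bounds by simp
          then show ?thesis using 1 b e2 by simp
        next
          case 2
          then have "ramp L (\<phi>' n x) = 1" by (simp add: ramp_def)
          then show ?thesis using b e2 G by (simp add: indicator_def)
        next
          case 3
          have "\<bar>g (\<phi> n x) - g (\<phi>' n x)\<bar> < e2" by (rule d(2)) (use 3 e_le in auto)
          moreover have "0 \<le> 2 * G * ramp L (\<phi>' n x)" using G ramp_bounds by simp
          ultimately show ?thesis using G by (simp add: indicator_def)
        qed
      qed
      have "D n x * g (\<phi> n x) - D' n x * g (\<phi>' n x) =
          g (\<phi> n x) * (D n x - D' n x) + D' n x * (g (\<phi> n x) - g (\<phi>' n x))"
        by (simp add: algebra_simps)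
      then have "\<bar>D n x * g (\<phi> n x) - D' n x * g (\<phi>' n x)\<bar> \<le>
          \<bar>g (\<phi> n x)\<bar> * \<bar>D n x - D' n x\<bar> + \<bar>D' n x\<bar> * \<bar>g (\<phi> n x) - g (\<phi>' n x)\<bar>"
        by (metis abs_mult abs_triangle_ineq)
      also have "\<dots> \<le> G * \<bar>D n x - D' n x\<bar> + D' n x * (e2 + 2 * G * ramp L (\<phi>' n x) +
          2 * G * indicator {x. e < \<bar>\<phi> n x - \<phi>' n x\<bar>} x)"
        using D'(2)[OF x] * G by (intro add_mono mult_mono) auto
      finally show ?thesis by (simp add: algebra_simps)
    qed
    have "\<bar>(\<integral>x. D n x * g (\<phi> n x) \<partial>M) - (\<integral>x. D' n x * g (\<phi>' n x) \<partial>M)\<bar> =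
        \<bar>\<integral>x. D n x * g (\<phi> n x) - D' n x * g (\<phi>' n x) \<partial>M\<bar>"
      using i1 i2 by simp
    also have "\<dots> \<le> (\<integral>x. \<bar>D n x * g (\<phi> n x) - D' n x * g (\<phi>' n x)\<bar> \<partial>M)" by (rule integral_abs_bound)
    also have "\<dots> \<le> (\<integral>x. G * \<bar>D n x - D' n x\<bar> + (e2 * D' n x + (2 * G * (D' n x * ramp L (\<phi>' n x)) +
        2 * G * (D' n x * indicator {x. e < \<bar>\<phi> n x - \<phi>' n x\<bar>} x))) \<partial>M)"
      by (rule integral_mono) (use i1 i2 i3 i4 i5 D'(1) pt in auto)
    also have "\<dots> = G * s4 n + (e2 * s2 n + (2 * G * s3 n + 2 * G * s5 n))"
      unfolding s2_def s3_def s4_def s5_def using i3 i4 i5 D'(1) by simp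
    finally show ?thesis unfolding s1_def left_diff_distrib by linarith
  qed
  have "avg_le (q + 2 * q + 2 * q + q + q + 2 * q)
     (\<lambda>n. \<bar>s1 n\<bar> + \<bar>e2 * s2 n\<bar> + \<bar>2 * G * s3 n\<bar> + \<bar>G * s4 n\<bar> + \<bar>2 * G * s5 n\<bar> +
      \<bar>(c' * W_mean g w' - c * W_mean g w) * u n\<bar>)"
    by (intro avg_le_plus) (simp_all only: avg_le_abs s1 s2 s3 s4 s5 s6)
  then show "avg_le \<eta> (\<lambda>n. (\<integral>x. D n x * g (\<phi> n x) \<partial>M) - c * W_mean g w * u n)"
    by (rule avg_le_mono) (use total \<eta> in \<open>auto simp: q_def\<close>)
qed

end

section \<open>Conservative measure preserving transformations\<close>

context
  fixes M :: "'a measure" and T :: "'a \<Rightarrow> 'a"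
  assumes mpt: "mpt M T"
begin

lemma mpt_measurable: "T \<in> M \<rightarrow>\<^sub>M M"
  using mpt by (simp add: mpt_def)

lemma mpt_funpow_measurable: "T ^^ n \<in> M \<rightarrow>\<^sub>M M"
proof (induction n)
  case (Suc n)
  then show ?case using measurable_comp[OF Suc mpt_measurable] by (simp only: funpow.simps)
qed simp

lemma mpt_funpow_space: "x \<in> space M \<Longrightarrow> (T ^^ n) x \<in> space M"
  using mpt_funpow_measurable measurable_space by metis

lemma mpt_distr: "distr M M T = M"
  using mpt mpt_measurable by (intro measure_eqI) (auto simp: emeasure_distr mpt_def)

lemma mpt_distr_funpow: "distr M M (T ^^ n) = M"
proof (induction n)
  case 0
  then show ?case by (simp add: id_def distr_id)
next
  case (Suc n)
  have "distr M M (T ^^ Suc n) = distr (distr M M (T ^^ n)) M T"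
    by (simp only: distr_distr[OF mpt_measurable mpt_funpow_measurable] funpow.simps)
  then show ?case by (simp only: Suc mpt_distr)
qed

lemma mpt_emeasure_vimage: "A \<in> sets M \<Longrightarrow> emeasure M ((T ^^ n) -` A \<inter> space M) = emeasure M A"
  by (metis emeasure_distr mpt_distr_funpow mpt_funpow_measurable)

lemma mpt_measure_vimage: "A \<in> sets M \<Longrightarrow> measure M ((T ^^ n) -` A \<inter> space M) = measure M A"
  by (simp add: measure_def mpt_emeasure_vimage)

lemma mpt_integral:
  "f \<in> borel_measurable M \<Longrightarrow> (\<integral>x. f ((T ^^ n) x) \<partial>M) = (\<integral>x. f x \<partial>M :: real)"
  by (metis integral_distr mpt_distr_funpow mpt_funpow_measurable)

lemma mpt_integrable:
  "integrable M (f :: 'a \<Rightarrow> real) \<Longrightarrow> integrable M (\<lambda>x. f ((T ^^ n) x))"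
  by (metis integrable_distr mpt_distr_funpow mpt_funpow_measurable)


text \<open>Pulling the k-th set back by T^(N-k) keeps its measure and moves all of them into T^-N
  F. The pulled back sets lie in different preimages of the wandering set, hence are
  disjoint.\<close>

lemma sum_measure_wandering_le:
  assumes V: "V \<in> sets M" and disj: "disjoint_family (\<lambda>n. (T ^^ n) -` V \<inter> space M)"
    and F: "F \<in> sets M" "emeasure M F < \<infinity>"
  shows "(\<Sum>k<N. measure M (V \<inter> (T ^^ k) -` F)) \<le> measure M F"
proof -
  note [measurable] = mpt_funpow_measurable V F(1)
  define E where "E k = (T ^^ (N - k)) -` (V \<inter> (T ^^ k) -` F) \<inter> space M" for k
  have Vs: "V \<subseteq> space M" by (rule sets.sets_into_space[OF V])
  have VF: "V \<inter> (T ^^ k) -` F \<in> sets M" for k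
  proof -
    have "V \<inter> (T ^^ k) -` F = V \<inter> ((T ^^ k) -` F \<inter> space M)" using Vs by auto
    then show ?thesis using measurable_sets[OF mpt_funpow_measurable F(1)] V by auto
  qed
  have [measurable]: "E k \<in> sets M" for k
    unfolding E_def using VF by (rule measurable_sets[OF mpt_funpow_measurable])
  have FN: "(T ^^ N) -` F \<inter> space M \<in> fmeasurable M"
    using F mpt_emeasure_vimage[OF F(1)] by (intro fmeasurableI) auto
  have sub: "E k \<subseteq> (T ^^ N) -` F \<inter> space M" if "k < N" for k
  proof -
    have "(T ^^ k) ((T ^^ (N - k)) x) = (T ^^ N) x" for x
      using that funpow_add[of k "N - k" T] by (simp add: fun_eq_iff)
    then show ?thesis by (auto simp: E_def)
  qed
  have fm: "E k \<in> fmeasurable M" if "k < N" for k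
    using fmeasurableI2[OF FN sub[OF that]] by simp
  have "(\<Sum>k<N. measure M (V \<inter> (T ^^ k) -` F)) = (\<Sum>k<N. measure M (E k))"
    unfolding E_def by (simp only: mpt_measure_vimage[OF VF])
  also have "\<dots> = measure M (\<Union>k<N. E k)"
  proof (rule measure_UNION'[symmetric])
    show "pairwise (\<lambda>i j. disjnt (E i) (E j)) {..<N}"
    proof (rule pairwiseI)
      fix i j assume "i \<in> {..<N}" "j \<in> {..<N}" "i \<noteq> j"
      then have "N - i \<noteq> N - j" by auto
      then have "((T ^^ (N - i)) -` V \<inter> space M) \<inter> ((T ^^ (N - j)) -` V \<inter> space M) = {}"
        using disj unfolding disjoint_family_on_def by blast
      then show "disjnt (E i) (E j)" unfolding E_def disjnt_def by blast
    qed
  qed (use fm in auto)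
  also have "\<dots> \<le> measure M ((T ^^ N) -` F \<inter> space M)"
    by (rule measure_mono_fmeasurable) (use sub FN in auto)
  also have "\<dots> = measure M F" by (rule mpt_measure_vimage[OF F(1)])
  finally show ?thesis .
qed

text \<open>For a wandering set V the measures of V \<inter> T^-k F are summable, so by
  Borel-Cantelli almost every point of V visits \<open>F\<close> only finitely often. This leaves
  room for null sets only.\<close>

lemma conservative_if_finite_sweep_out:
  assumes F: "F \<in> sets M" "emeasure M F < \<infinity>"
    and io: "AE x in M. \<exists>\<^sub>\<infinity>n. (T ^^ n) x \<in> F"
  shows "conservative M T"
  unfolding conservative_def
proof (intro ballI impI)
  fix V assume V: "V \<in> sets M" and disj: "disjoint_family (\<lambda>n. (T ^^ n) -` V \<inter> space M)"
  have Vs: "V \<subseteq> space M" by (rule sets.sets_into_space[OF V])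
  define A where "A k = V \<inter> (T ^^ k) -` F" for k
  have A_eq: "A k = V \<inter> ((T ^^ k) -` F \<inter> space M)" for k using Vs by (auto simp: A_def)
  have [measurable]: "A k \<in> sets M" for k
    unfolding A_eq using measurable_sets[OF mpt_funpow_measurable F(1)] V by auto
  have fin: "emeasure M (A k) < \<infinity>" for k
  proof -
    have "emeasure M (A k) \<le> emeasure M ((T ^^ k) -` F \<inter> space M)"
      unfolding A_eq using measurable_sets[OF mpt_funpow_measurable F(1)] by (intro emeasure_mono) auto
    then show ?thesis using F mpt_emeasure_vimage[OF F(1)] by (simp add: order.strict_trans1)
  qed
  have "summable (\<lambda>k. measure M (A k))"
    by (rule bounded_imp_summable[where B="measure M F"])
      (use sum_measure_wandering_le[OF V disj F, of "Suc _", folded A_def] in \<open>auto simp: lessThan_Suc_atMost\<close>)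
  then have "AE x in M. eventually (\<lambda>k. x \<in> space M - A k) sequentially"
    using fin by (intro borel_cantelli_AE1) auto
  then have "AE x in M. x \<notin> V" using io
  proof eventually_elim
    case (elim x)
    show ?case
    proof
      assume "x \<in> V"
      have "\<forall>\<^sub>F k in sequentially. (T ^^ k) x \<notin> F"
        using elim(1) by eventually_elim (use \<open>x \<in> V\<close> in \<open>auto simp: A_def\<close>)
      then show False using elim(2) by (simp add: INFM_iff_infinite cofinite_eq_sequentially frequently_def)
    qed
  qed
  then show "emeasure M V = 0" using V AE_iff_measurable[of V M "\<lambda>x. x \<notin> V"] Vs by auto
qed

text \<open>Halmos recurrence: the points of \<open>F\<close> that never return form a wandering
  set, and a point with finitely many visits is in that set at the time of its last visit.\<close>

lemma conservative_recurrence: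
  assumes cons: "conservative M T" and F: "F \<in> sets M"
  shows "AE x in M. x \<in> F \<longrightarrow> (\<exists>\<^sub>\<infinity>n. (T ^^ n) x \<in> F)"
proof -
  note [measurable] = mpt_funpow_measurable F
  define V where "V = {x \<in> space M. x \<in> F \<and> (\<forall>n. (T ^^ Suc n) x \<notin> F)}"
  have V: "V \<in> sets M" unfolding V_def by (measurable; fact)
  have "disjoint_family (\<lambda>n. (T ^^ n) -` V \<inter> space M)"
    unfolding disjoint_family_on_def
  proof (intro ballI impI)
    have *: "((T ^^ i) -` V \<inter> space M) \<inter> ((T ^^ j) -` V \<inter> space M) = {}" if "i < j" for i j
    proof -
      obtain d where j: "j = Suc d + i" using less_imp_Suc_add[OF \<open>i < j\<close>] by (auto simp: add.commute)
      have "(T ^^ j) x = (T ^^ Suc d) ((T ^^ i) x)" for x by (simp only: j funpow_add comp_apply)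
      then show ?thesis by (auto simp: V_def simp del: funpow.simps)
    qed
    fix i j :: nat assume "i \<noteq> j"
    then show "((T ^^ i) -` V \<inter> space M) \<inter> ((T ^^ j) -` V \<inter> space M) = {}"
      using *[of i j] *[of j i] by (cases "i < j") auto
  qed
  then have "emeasure M V = 0" using cons V by (auto simp: conservative_def)
  then have "(T ^^ n) -` V \<inter> space M \<in> null_sets M" for n
    using mpt_emeasure_vimage[OF V] measurable_sets[OF mpt_funpow_measurable V] by auto
  then have "(\<Union>n. (T ^^ n) -` V \<inter> space M) \<in> null_sets M" by (intro null_sets_UN)
  then show ?thesis
  proof (rule AE_I')
    show "{x \<in> space M. \<not> (x \<in> F \<longrightarrow> (\<exists>\<^sub>\<infinity>n. (T ^^ n) x \<in> F))} \<subseteq> (\<Union>n. (T ^^ n) -` V \<inter> space M)"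
    proof
      fix x assume x: "x \<in> {x \<in> space M. \<not> (x \<in> F \<longrightarrow> (\<exists>\<^sub>\<infinity>n. (T ^^ n) x \<in> F))}"
      define I where "I = {n. (T ^^ n) x \<in> F}"
      have I: "finite I" "I \<noteq> {}"
        using x by (auto simp: I_def INFM_iff_infinite intro!: exI[of _ 0])
      define m where "m = Max I"
      have "m \<in> I" unfolding m_def using I by (rule Max_in)
      moreover have "(T ^^ Suc n) ((T ^^ m) x) \<notin> F" for n
      proof
        assume "(T ^^ Suc n) ((T ^^ m) x) \<in> F"
        then have "Suc n + m \<in> I" by (simp add: I_def funpow_add)
        then have "Suc n + m \<le> m" unfolding m_def using I(1) by (intro Max_ge) auto
        then show False by simp
      qed
      ultimately have "(T ^^ m) x \<in> V" using mpt_funpow_space x by (auto simp: V_def I_def)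
      then show "x \<in> (\<Union>n. (T ^^ n) -` V \<inter> space M)" using x by auto
    qed
  qed
qed

text \<open>The set of points with infinitely many visits is strictly invariant, hence null or
  conull, and recurrence puts almost all of \<open>F\<close> into it.\<close>

lemma conservative_ergodic_sweep_out:
  assumes cons: "conservative M T" and erg: "ergodic M T" and F: "F \<in> sets M" "emeasure M F > 0"
  shows "AE x in M. \<exists>\<^sub>\<infinity>n. (T ^^ n) x \<in> F"
proof -
  note [measurable] = mpt_funpow_measurable F(1)
  define L where "L = {x \<in> space M. \<exists>\<^sub>\<infinity>n. (T ^^ n) x \<in> F}"
  have L: "L \<in> sets M" unfolding L_def INFM_nat by (measurable; fact)
  have Suc_io: "(\<exists>\<^sub>\<infinity>n. P (Suc n)) \<longleftrightarrow> (\<exists>\<^sub>\<infinity>n. P n)" for P :: "nat \<Rightarrow> bool"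
    by (simp add: frequently_def cofinite_eq_sequentially eventually_sequentially_Suc[of "\<lambda>n. \<not> P n"])
  have "(\<exists>\<^sub>\<infinity>n. (T ^^ n) (T x) \<in> F) \<longleftrightarrow> (\<exists>\<^sub>\<infinity>n. (T ^^ n) x \<in> F)" for x
    using Suc_io[of "\<lambda>n. (T ^^ n) x \<in> F"] by (simp add: funpow_swap1)
  then have "T -` L \<inter> space M = L"
    using measurable_space[OF mpt_measurable] by (auto simp: L_def)
  then have "emeasure M L = 0 \<or> emeasure M (space M - L) = 0" using erg L by (auto simp: ergodic_def)
  moreover have "emeasure M L \<noteq> 0"
  proof
    assume "emeasure M L = 0"
    then have "AE x in M. x \<notin> L" using L by (intro AE_not_in) auto
    with conservative_recurrence[OF cons F(1)] AE_space have "AE x in M. x \<notin> F"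
      by eventually_elim (unfold L_def, blast)
    then have "emeasure M F = 0" using F(1) AE_iff_measurable[of F M "\<lambda>x. x \<notin> F"] sets.sets_into_space[OF F(1)] by auto
    then show False using F(2) by simp
  qed
  ultimately have "AE x in M. x \<notin> space M - L" using L by (intro AE_not_in) auto
  then show ?thesis using AE_space by eventually_elim (auto simp: L_def)
qed

end

section \<open>The natural extension\<close>

locale natural_extension =
  fixes M :: "'a measure" and T :: "'a \<Rightarrow> 'a" and M' :: "(nat \<Rightarrow> 'a) measure"
  assumes base_mpt: "mpt M T" and ext: "natural_extension_measure M T M'"
begin

abbreviation "T' \<equiv> nat_ext_map T"

text \<open>The inverse of the extension map on \<open>space M'\<close>. Its conservativity supplies
  the visits to \<open>G\<close> in the past.\<close>

definition past :: "(nat \<Rightarrow> 'a) \<Rightarrow> (nat \<Rightarrow> 'a)" where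
  "past x = (\<lambda>k. x (Suc k))"

lemma sets_ext: "sets M' = sets (restrict_space (Pi\<^sub>M UNIV (\<lambda>_. M)) (nat_ext_space M T))"
  using ext by (simp add: natural_extension_measure_def)

lemma space_ext: "space M' = nat_ext_space M T"
proof -
  have "space M' = space (restrict_space (Pi\<^sub>M UNIV (\<lambda>_. M)) (nat_ext_space M T))"
    by (rule sets_eq_imp_space_eq[OF sets_ext])
  also have "\<dots> = nat_ext_space M T"
    by (auto simp: space_restrict_space space_PiM nat_ext_space_def)
  finally show ?thesis .
qed

lemma coord_space: "x \<in> space M' \<Longrightarrow> x k \<in> space M"
  by (simp add: space_ext nat_ext_space_def)

lemma coord_Suc: "x \<in> space M' \<Longrightarrow> T (x (Suc k)) = x k"
  by (simp add: space_ext nat_ext_space_def)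

lemma coord_funpow: "x \<in> space M' \<Longrightarrow> (T ^^ j) (x (k + j)) = x k"
proof (induction j arbitrary: k)
  case (Suc j)
  have "(T ^^ Suc j) (x (k + Suc j)) = T ((T ^^ j) (x (Suc k + j)))" by simp
  also have "\<dots> = T (x (Suc k))" using Suc.IH[OF Suc.prems, of "Suc k"] by simp
  also have "\<dots> = x k" by (rule coord_Suc[OF Suc.prems])
  finally show ?case .
qed simp

lemma measurable_coord: "(\<lambda>x. x k) \<in> M' \<rightarrow>\<^sub>M M"
  unfolding measurable_cong_sets[OF sets_ext refl]
  by (rule measurable_restrict_space1) (rule measurable_component_singleton, simp)

lemma measurable_extI:
  assumes "\<And>k. (\<lambda>x. f x k) \<in> N \<rightarrow>\<^sub>M M" "\<And>x k. x \<in> space N \<Longrightarrow> T (f x (Suc k)) = f x k"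
  shows "f \<in> N \<rightarrow>\<^sub>M M'"
proof -
  have "f \<in> N \<rightarrow>\<^sub>M restrict_space (Pi\<^sub>M UNIV (\<lambda>_. M)) (nat_ext_space M T)"
  proof (rule measurable_restrict_space2)
    have "(\<lambda>x k. f x k) \<in> N \<rightarrow>\<^sub>M Pi\<^sub>M UNIV (\<lambda>_. M)"
      using assms(1) by (intro measurable_PiM_single') (auto dest: measurable_space)
    then show "f \<in> N \<rightarrow>\<^sub>M Pi\<^sub>M UNIV (\<lambda>_. M)" by simp
    show "f \<in> space N \<rightarrow> nat_ext_space M T"
      using assms by (auto simp: nat_ext_space_def dest: measurable_space)
  qed
  then show ?thesis using measurable_cong_sets[OF refl sets_ext] by blast
qed

lemma ext_coord: "x \<in> space M' \<Longrightarrow> T' x k = T (x k)"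
  by (cases k) (simp_all add: nat_ext_map_def coord_Suc)

lemma ext_measurable: "T' \<in> M' \<rightarrow>\<^sub>M M'"
proof (rule measurable_extI)
  fix k
  have "(\<lambda>x. T (x k)) \<in> M' \<rightarrow>\<^sub>M M"
    using measurable_compose[OF measurable_coord mpt_measurable[OF base_mpt]] .
  then show "(\<lambda>x. T' x k) \<in> M' \<rightarrow>\<^sub>M M" by (subst measurable_cong[OF ext_coord])
qed (simp add: ext_coord coord_Suc)

lemma past_measurable: "past \<in> M' \<rightarrow>\<^sub>M M'"
  by (rule measurable_extI) (auto simp: past_def measurable_coord coord_Suc)

lemma ext_past: "x \<in> space M' \<Longrightarrow> T' (past x) = x"
  by (auto simp: nat_ext_map_def past_def coord_Suc fun_eq_iff split: nat.split)

lemma past_ext: "past (T' x) = x"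
  by (auto simp: nat_ext_map_def past_def)

lemma ext_funpow_coord: "x \<in> space M' \<Longrightarrow> ((T' ^^ n) x) k = (T ^^ n) (x k)"
proof (induction n)
  case (Suc n)
  have "(T' ^^ n) x \<in> space M'" using Suc(2) ext_measurable
    by (induction n) (auto dest: measurable_space)
  then show ?case using Suc by (simp add: ext_coord)
qed simp

lemma emeasure_coord_vimage:
  assumes A: "A \<in> sets M"
  shows "emeasure M' {x \<in> space M'. x k \<in> A} = emeasure M A"
proof -
  \<comment> \<open>A cylinder of length k + 1 constrained only in its last entry, which enters the
    prescription with exponent 0.\<close>
  define A' where "A' j = (if j = k then A else space M)" for j
  have "emeasure M' {x \<in> nat_ext_space M T. \<forall>j<Suc k. x j \<in> A' j} =
      emeasure M (\<Inter>j<Suc k. (T ^^ (Suc k - Suc j)) -` A' j \<inter> space M)"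
    using ext A unfolding natural_extension_measure_def by (auto simp: A'_def)
  also have "(\<Inter>j<Suc k. (T ^^ (Suc k - Suc j)) -` A' j \<inter> space M) = A"
  proof
    show "(\<Inter>j<Suc k. (T ^^ (Suc k - Suc j)) -` A' j \<inter> space M) \<subseteq> A"
      by (rule INF_lower2[of k]) (auto simp: A'_def)
    show "A \<subseteq> (\<Inter>j<Suc k. (T ^^ (Suc k - Suc j)) -` A' j \<inter> space M)"
      using sets.sets_into_space[OF A] mpt_funpow_space[OF base_mpt] by (auto simp: A'_def split: if_splits)
  qed
  also have "{x \<in> nat_ext_space M T. \<forall>j<Suc k. x j \<in> A' j} = {x \<in> space M'. x k \<in> A}"
    by (auto simp: A'_def space_ext[symmetric] coord_space)
  finally show ?thesis .
qed

lemma distr_coord: "distr M' M (\<lambda>x. x k) = M"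
proof (rule measure_eqI)
  fix A assume "A \<in> sets (distr M' M (\<lambda>x. x k))"
  then have A: "A \<in> sets M" by simp
  have "emeasure (distr M' M (\<lambda>x. x k)) A = emeasure M' ((\<lambda>x. x k) -` A \<inter> space M')"
    by (rule emeasure_distr[OF measurable_coord A])
  also have "(\<lambda>x. x k) -` A \<inter> space M' = {x \<in> space M'. x k \<in> A}" by auto
  finally show "emeasure (distr M' M (\<lambda>x. x k)) A = emeasure M A"
    using emeasure_coord_vimage[OF A] by simp
qed simp

section \<open>Sets depending on one coordinate as a generator\<close>

lemma coord_set_shift:
  "{x \<in> space M'. x k \<in> A} = {x \<in> space M'. x (k + j) \<in> (T ^^ j) -` A \<inter> space M}"
  by (auto simp: coord_funpow coord_space)

definition coord_sets :: "(nat \<Rightarrow> 'a) set set" where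
  "coord_sets = {{x \<in> space M'. x k \<in> A} | k A. A \<in> sets M}"

text \<open>Conditions at the coordinates k and l can both be read at the coordinate k + l, the
  older point, which determines the others through \<open>T\<close>. One-coordinate sets thus
  replace the cylinders as a \<pi>-system.\<close>

lemma Int_stable_coord_sets: "Int_stable coord_sets"
proof (rule Int_stableI)
  fix a b assume "a \<in> coord_sets" "b \<in> coord_sets"
  then obtain k A l B where a: "a = {x \<in> space M'. x k \<in> A}" "A \<in> sets M"
    and b: "b = {x \<in> space M'. x l \<in> B}" "B \<in> sets M" by (auto simp: coord_sets_def)
  define A' where "A' = (T ^^ l) -` A \<inter> space M"
  define B' where "B' = (T ^^ k) -` B \<inter> space M"
  have "a = {x \<in> space M'. x (k + l) \<in> A'}" "b = {x \<in> space M'. x (k + l) \<in> B'}"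
    unfolding a b A'_def B'_def using coord_set_shift[of k A l] coord_set_shift[of l B k]
    by (simp_all add: add.commute)
  then have "a \<inter> b = {x \<in> space M'. x (k + l) \<in> A' \<inter> B'}" by auto
  moreover have "A' \<inter> B' \<in> sets M" unfolding A'_def B'_def
    using measurable_sets[OF mpt_funpow_measurable[OF base_mpt]] a b by auto
  ultimately show "a \<inter> b \<in> coord_sets" unfolding coord_sets_def by blast
qed

lemma sets_ext_generated: "sets M' = sigma_sets (space M') coord_sets"
proof
  let ?P = "\<Pi>\<^sub>E i\<in>(UNIV::nat set). space M"
  let ?G = "{{f \<in> ?P. f i \<in> A} | i A. i \<in> UNIV \<and> A \<in> sets M}"
  have sub: "space M' \<subseteq> ?P" using coord_space by auto
  have "sets M' = {id -` A \<inter> space M' | A. A \<in> sigma_sets ?P ?G}"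
    unfolding sets_ext sets_restrict_space sets_PiM_single space_ext[symmetric] by auto
  also have "\<dots> = sigma_sets (space M') {id -` A \<inter> space M' | A. A \<in> ?G}"
    by (rule sigma_sets_vimage_commute, rule Pi_I) (use sub in \<open>simp only: id_apply subset_iff\<close>)
  also have "\<dots> \<subseteq> sigma_sets (space M') coord_sets"
  proof (rule sigma_sets_mono, rule subsetI)
    fix E assume "E \<in> {id -` A \<inter> space M' | A. A \<in> ?G}"
    then obtain i A where "A \<in> sets M" "E = {f \<in> ?P. f i \<in> A} \<inter> space M'" by auto
    then have "E = {x \<in> space M'. x i \<in> A}" using sub by auto
    then show "E \<in> sigma_sets (space M') coord_sets"
      using \<open>A \<in> sets M\<close> by (intro sigma_sets.Basic) (auto simp: coord_sets_def)
  qed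
  finally show "sets M' \<subseteq> sigma_sets (space M') coord_sets" .
  show "sigma_sets (space M') coord_sets \<subseteq> sets M'"
  proof (rule sets.sigma_sets_subset, rule subsetI)
    fix E assume "E \<in> coord_sets"
    then obtain k A where "A \<in> sets M" "E = (\<lambda>x. x k) -` A \<inter> space M'" by (auto simp: coord_sets_def)
    then show "E \<in> sets M'" using measurable_sets[OF measurable_coord] by auto
  qed
qed

lemma coord_vimage_sets: "A \<in> sets M \<Longrightarrow> {x \<in> space M'. x k \<in> A} \<in> sets M'"
  unfolding sets_ext_generated by (rule sigma_sets.Basic) (auto simp: coord_sets_def)

text \<open>One-coordinate marginals determine the measure, since these sets form a generating
  \<pi>-system and the lifted exhaustion of \<open>M\<close> provides \<sigma>-finiteness.
  Invariance under a map is thereby reduced to its marginals.\<close>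

lemma ext_measure_eqI:
  assumes "sets N = sets M'" "\<And>k A. A \<in> sets M \<Longrightarrow> emeasure N {x \<in> space M'. x k \<in> A} = emeasure M A"
  shows "M' = N"
proof -
  interpret sigma_finite_measure M using base_mpt by (simp add: mpt_def)
  obtain F :: "nat \<Rightarrow> 'a set" where F: "range F \<subseteq> sets M" "(\<Union>i. F i) = space M" "\<And>i. emeasure M (F i) \<noteq> \<infinity>"
    using sigma_finite by blast
  show ?thesis
  proof (rule measure_eqI_generator_eq[where A="\<lambda>i. {x \<in> space M'. x 0 \<in> F i}", OF Int_stable_coord_sets])
    show "coord_sets \<subseteq> Pow (space M')" by (auto simp: coord_sets_def)
    show "emeasure M' E = emeasure N E" if "E \<in> coord_sets" for E
      using that assms(2) emeasure_coord_vimage by (auto simp: coord_sets_def)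
    show "range (\<lambda>i. {x \<in> space M'. x 0 \<in> F i}) \<subseteq> coord_sets" using F(1) by (auto simp: coord_sets_def)
    show "(\<Union>i. {x \<in> space M'. x 0 \<in> F i}) = space M'" using F(2) coord_space by blast
    show "emeasure M' {x \<in> space M'. x 0 \<in> F i} \<noteq> \<infinity>" for i
      using F emeasure_coord_vimage[of "F i" 0] by auto
  qed (use sets_ext_generated assms(1) in auto)
qed

lemma ext_sigma_finite: "sigma_finite_measure M'"
proof
  interpret sigma_finite_measure M using base_mpt by (simp add: mpt_def)
  obtain F :: "nat \<Rightarrow> 'a set" where F: "range F \<subseteq> sets M" "(\<Union>i. F i) = space M" "\<And>i. emeasure M (F i) \<noteq> \<infinity>"
    using sigma_finite by blast
  let ?A = "range (\<lambda>i. {x \<in> space M'. x 0 \<in> F i})"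
  have "\<Union>?A = space M'" using F(2) coord_space by blast
  moreover have "emeasure M' {x \<in> space M'. x 0 \<in> F i} \<noteq> \<infinity>" for i
    using F emeasure_coord_vimage[of "F i" 0] by auto
  ultimately show "\<exists>A. countable A \<and> A \<subseteq> sets M' \<and> \<Union>A = space M' \<and> (\<forall>a\<in>A. emeasure M' a \<noteq> \<infinity>)"
    using F(1) coord_vimage_sets by (intro exI[of _ ?A]) auto
qed

section \<open>Invariance of the measure and transfer of conservativity\<close>

lemma mpt_of_distr:
  assumes "f \<in> M' \<rightarrow>\<^sub>M M'" "M' = distr M' M' f"
  shows "mpt M' f"
  unfolding mpt_def using assms(1) ext_sigma_finite assms(2)
  by (metis emeasure_distr)

lemma ext_mpt: "mpt M' T'"
proof (rule mpt_of_distr[OF ext_measurable ext_measure_eqI])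
  fix k A assume A: "A \<in> sets M"
  have "emeasure (distr M' M' T') {x \<in> space M'. x k \<in> A} = emeasure M' (T' -` {x \<in> space M'. x k \<in> A} \<inter> space M')"
    by (rule emeasure_distr[OF ext_measurable coord_vimage_sets[OF A]])
  also have "T' -` {x \<in> space M'. x k \<in> A} \<inter> space M' = {x \<in> space M'. x k \<in> T -` A \<inter> space M}"
  proof (rule set_eqI)
    fix x
    show "x \<in> T' -` {x \<in> space M'. x k \<in> A} \<inter> space M' \<longleftrightarrow> x \<in> {x \<in> space M'. x k \<in> T -` A \<inter> space M}"
    proof (cases "x \<in> space M'")
      case True
      then have "T' x \<in> space M'" by (rule measurable_space[OF ext_measurable])
      then show ?thesis using True ext_coord[OF True] coord_space[OF True] by simp
    qed simp
  qed
  also have "emeasure M' \<dots> = emeasure M (T -` A \<inter> space M)"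
    by (rule emeasure_coord_vimage) (use measurable_sets[OF mpt_measurable[OF base_mpt] A] in auto)
  also have "\<dots> = emeasure M A" using base_mpt A by (simp add: mpt_def)
  finally show "emeasure (distr M' M' T') {x \<in> space M'. x k \<in> A} = emeasure M A" .
qed simp

lemma past_mpt: "mpt M' past"
proof (rule mpt_of_distr[OF past_measurable ext_measure_eqI])
  fix k A assume A: "A \<in> sets M"
  have "emeasure (distr M' M' past) {x \<in> space M'. x k \<in> A} = emeasure M' (past -` {x \<in> space M'. x k \<in> A} \<inter> space M')"
    by (rule emeasure_distr[OF past_measurable coord_vimage_sets[OF A]])
  also have "past -` {x \<in> space M'. x k \<in> A} \<inter> space M' = {x \<in> space M'. x (Suc k) \<in> A}"
    using measurable_space[OF past_measurable] by (auto simp: past_def)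
  also have "emeasure M' \<dots> = emeasure M A" by (rule emeasure_coord_vimage[OF A])
  finally show "emeasure (distr M' M' past) {x \<in> space M'. x k \<in> A} = emeasure M A" .
qed simp

lemma past_funpow_ext: "(past ^^ n) ((T' ^^ n) x) = x"
proof (induction n arbitrary: x)
  case (Suc n)
  have "(past ^^ Suc n) ((T' ^^ Suc n) x) = (past ^^ n) (past (T' ((T' ^^ n) x)))"
    by (simp only: funpow_Suc_right[of n past] funpow.simps(2)[of n T'] comp_apply)
  then show ?case by (simp only: past_ext Suc)
qed simp

lemma ext_funpow_past: "x \<in> space M' \<Longrightarrow> (T' ^^ n) ((past ^^ n) x) = x"
proof (induction n arbitrary: x)
  case (Suc n)
  have x: "(past ^^ n) x \<in> space M'" using mpt_funpow_space[OF past_mpt Suc(2)] .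
  have "(T' ^^ Suc n) ((past ^^ Suc n) x) = (T' ^^ n) (T' (past ((past ^^ n) x)))"
    by (simp only: funpow_Suc_right[of n T'] funpow.simps(2)[of n past] comp_apply)
  then show ?case using Suc by (simp only: ext_past[OF x])
qed simp

lemma ext_sweep_out:
  assumes "conservative M T" "ergodic M T" "F \<in> sets M" "emeasure M F > 0"
  shows "AE x in M'. \<exists>\<^sub>\<infinity>n. ((T' ^^ n) x) 0 \<in> F"
proof -
  have "AE x in distr M' M (\<lambda>x. x 0). \<exists>\<^sub>\<infinity>n. (T ^^ n) x \<in> F"
    unfolding distr_coord using conservative_ergodic_sweep_out[OF base_mpt assms] .
  then have "AE x in M'. \<exists>\<^sub>\<infinity>n. (T ^^ n) (x 0) \<in> F" by (rule AE_distrD[OF measurable_coord])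
  then show ?thesis using AE_space by eventually_elim (simp add: ext_funpow_coord)
qed

lemma ext_conservative:
  assumes "conservative M T" "ergodic M T" "F \<in> sets M" "emeasure M F > 0" "emeasure M F < \<infinity>"
  shows "conservative M' T'"
proof (rule conservative_if_finite_sweep_out[OF ext_mpt])
  show "{x \<in> space M'. x 0 \<in> F} \<in> sets M'" by (rule coord_vimage_sets[OF assms(3)])
  show "emeasure M' {x \<in> space M'. x 0 \<in> F} < \<infinity>" using emeasure_coord_vimage[OF assms(3)] assms by simp
  show "AE x in M'. \<exists>\<^sub>\<infinity>n. (T' ^^ n) x \<in> {x \<in> space M'. x 0 \<in> F}"
    using ext_sweep_out[OF assms(1-4)] AE_space
    by eventually_elim (simp add: mpt_funpow_space[OF ext_mpt])
qed

lemma past_conservative: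
  assumes "conservative M' T'"
  shows "conservative M' past"
  unfolding conservative_def
proof (intro ballI impI)
  fix V assume V: "V \<in> sets M'" and disj: "disjoint_family (\<lambda>n. (past ^^ n) -` V \<inter> space M')"
  have "disjoint_family (\<lambda>n. (T' ^^ n) -` V \<inter> space M')"
    unfolding disjoint_family_on_def
  proof (intro ballI impI equals0I)
    fix i j x assume ij: "i \<noteq> j" and x: "x \<in> ((T' ^^ i) -` V \<inter> space M') \<inter> ((T' ^^ j) -` V \<inter> space M')"
    \<comment> \<open>Moving x forward by i + j steps exchanges the two conditions, so overlapping
      preimages under the forward map give overlapping preimages under its inverse.\<close>
    define y where "y = (T' ^^ (i + j)) x"
    have "(past ^^ i) y = (T' ^^ j) x" "(past ^^ j) y = (T' ^^ i) x"
      unfolding y_def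
      by (simp only: funpow_add comp_apply past_funpow_ext)
        (simp only: add.commute[of i j] funpow_add comp_apply past_funpow_ext)
    moreover have "y \<in> space M'" unfolding y_def using x mpt_funpow_space[OF ext_mpt] by auto
    ultimately have "y \<in> ((past ^^ i) -` V \<inter> space M') \<inter> ((past ^^ j) -` V \<inter> space M')" using x by auto
    then show False using disj ij unfolding disjoint_family_on_def by blast
  qed
  then show "emeasure M' V = 0" using assms V by (auto simp: conservative_def)
qed

end

section \<open>The maximal ergodic inequality\<close>

lemma birkhoff_measurable:
  assumes "mpt M T" "f \<in> borel_measurable M"
  shows "birkhoff_sum T f n \<in> borel_measurable M"
  unfolding birkhoff_sum_def
  by (intro borel_measurable_sum measurable_compose[OF mpt_funpow_measurable[OF assms(1)] assms(2)])

lemma birkhoff_Suc_left: "birkhoff_sum T f (Suc n) x = f x + birkhoff_sum T f n (T x)"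
  unfolding birkhoff_sum_def sum.lessThan_Suc_shift by (simp add: funpow_swap1)

lemma birkhoff_Suc_right: "birkhoff_sum T f (Suc n) x = birkhoff_sum T f n x + f ((T ^^ n) x)"
  by (simp add: birkhoff_sum_def)

text \<open>The maximum of 0 and the first n ergodic sums, in the recursive form in which it can be
  compared with its composition with \<open>T\<close>.\<close>

fun birkhoff_max :: "('a \<Rightarrow> 'a) \<Rightarrow> ('a \<Rightarrow> real) \<Rightarrow> nat \<Rightarrow> 'a \<Rightarrow> real" where
  "birkhoff_max T f 0 x = 0"
| "birkhoff_max T f (Suc n) x = max 0 (f x + birkhoff_max T f n (T x))"

lemma birkhoff_max_nonneg: "0 \<le> birkhoff_max T f n x"
  by (cases n) auto

lemma birkhoff_max_mono_Suc: "birkhoff_max T f n x \<le> birkhoff_max T f (Suc n) x"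
proof (induction n arbitrary: x)
  case (Suc n)
  then show ?case using Suc[of "T x"] by (simp add: max.coboundedI2)
qed simp

lemma birkhoff_sum_le_max: "k \<le> n \<Longrightarrow> birkhoff_sum T f k x \<le> birkhoff_max T f n x"
proof (induction n arbitrary: k x)
  case (Suc n)
  show ?case
  proof (cases k)
    case (Suc k')
    then have "birkhoff_sum T f k' (T x) \<le> birkhoff_max T f n (T x)" using Suc.IH Suc.prems by simp
    then show ?thesis unfolding Suc birkhoff_Suc_left by simp
  qed (simp add: birkhoff_sum_def)
qed (simp add: birkhoff_sum_def)

lemma birkhoff_max_integrable:
  assumes "mpt M T" "integrable M f"
  shows "integrable M (birkhoff_max T f n)"
proof (induction n)
  case (Suc n)
  have "integrable M (\<lambda>x. birkhoff_max T f n (T x))"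
    using mpt_integrable[OF assms(1) Suc, of 1] by simp
  then have "integrable M (\<lambda>x. max 0 (f x + birkhoff_max T f n (T x)))"
    using assms(2) by (intro integrable_max) auto
  then show ?case by simp
qed simp

text \<open>Garsia's argument: where the maximal function \<open>m\<close> is positive, \<open>m \<le> f + m \<circ> T\<close>.\<close>

lemma maximal_ergodic:
  assumes mpt: "mpt M T" and f: "integrable M f"
  shows "0 \<le> (\<integral>x. f x * indicator {x. 0 < birkhoff_max T f n x} x \<partial>M)"
proof (cases n)
  case (Suc k)
  let ?m = "birkhoff_max T f n"
  have m: "integrable M ?m" "integrable M (\<lambda>x. ?m (T x))"
    using birkhoff_max_integrable[OF assms, of n] mpt_integrable[OF mpt birkhoff_max_integrable[OF assms, of n], of 1]
    by auto
  note [measurable] = borel_measurable_integrable[OF m(1)] borel_measurable_integrable[OF f]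
  have "(\<integral>x. ?m (T x) \<partial>M) = (\<integral>x. ?m x \<partial>M)"
    using mpt_integral[OF mpt borel_measurable_integrable[OF m(1)], of 1] by simp
  then have "0 = (\<integral>x. ?m x - ?m (T x) \<partial>M)" using m by simp
  also have "\<dots> \<le> (\<integral>x. f x * indicator {x. 0 < ?m x} x \<partial>M)"
  proof (rule integral_mono)
    have "integrable M (\<lambda>x. f x * indicator {y. 0 < y} (?m x))"
      by (rule Bochner_Integration.integrable_bound[OF f]) (auto simp: indicator_def)
    then show "integrable M (\<lambda>x. f x * indicator {x. 0 < ?m x} x)"
      by (rule back_subst[of "integrable M"]) (auto simp: indicator_def)
    fix x
    show "?m x - ?m (T x) \<le> f x * indicator {x. 0 < ?m x} x"
      using birkhoff_max_mono_Suc[of T f k "T x"] birkhoff_max_nonneg[of T f "Suc k" "T x"]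
      unfolding Suc by (auto simp: indicator_def max_def split: if_splits)
  qed (use m in auto)
  finally show ?thesis .
qed simp

text \<open>The maximal inequality is applied to f - l 1_U: over the set where some partial sum is
  positive, the integral of \<open>f\<close> dominates \<open>l\<close> times the measure of the
  part in \<open>U\<close>, and these parts exhaust \<open>E\<close>. In infinite measure, ratios of
  ergodic sums take the place of averages.\<close>

lemma hopf_maximal:
  assumes mpt: "mpt M T" and f: "integrable M f" "\<And>x. x \<in> space M \<Longrightarrow> 0 \<le> f x"
    and U: "U \<in> fmeasurable M" and l: "0 < l"
    and E: "E \<in> sets M" "E \<subseteq> U"
      "\<And>x. x \<in> E \<Longrightarrow> \<exists>n. l * birkhoff_sum T (indicator U) n x < birkhoff_sum T f n x"
  shows "l * measure M E \<le> (\<integral>x. f x \<partial>M)"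
proof -
  have fmE: "E \<in> fmeasurable M" using U E fmeasurableI2 by blast
  define h where "h x = f x - l * indicator U x" for x
  have iU: "integrable M (\<lambda>x. indicator U x :: real)" using U by (simp add: fmeasurable_def)
  have h: "integrable M h" unfolding h_def using f iU by auto
  define P where "P n = E \<inter> {x. 0 < birkhoff_max T h n x}" for n
  have [measurable]: "birkhoff_max T h n \<in> borel_measurable M" for n
    using birkhoff_max_integrable[OF mpt h] by auto
  note [measurable] = E(1) borel_measurable_integrable[OF f(1)] borel_measurable_integrable[OF h]
  have P_eq: "P n = {x \<in> space M. x \<in> E \<and> 0 < birkhoff_max T h n x}" for n
    unfolding P_def using sets.sets_into_space[OF E(1)] by auto
  have P: "P n \<in> sets M" for n unfolding P_eq by measurable
  have P_fm: "P n \<in> fmeasurable M" for n by (rule fmeasurableI2[OF fmE _ P]) (auto simp: P_def)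
  have le: "l * measure M (P n) \<le> (\<integral>x. f x \<partial>M)" for n
  proof -
    let ?Q = "{x. 0 < birkhoff_max T h n x}"
    have ind: "integrable M (\<lambda>x. k x * indicator ?Q x)" if "integrable M k" for k :: "'a \<Rightarrow> real"
    proof -
      have [measurable]: "k \<in> borel_measurable M" using that by simp
      have "integrable M (\<lambda>x. k x * indicator {y. 0 < y} (birkhoff_max T h n x))"
        by (rule Bochner_Integration.integrable_bound[OF that]) (auto simp: indicator_def)
      then show ?thesis by (rule back_subst[of "integrable M"]) (auto simp: indicator_def)
    qed
    have "0 \<le> (\<integral>x. h x * indicator ?Q x \<partial>M)" by (rule maximal_ergodic[OF mpt h])
    also have "\<dots> = (\<integral>x. f x * indicator ?Q x - l * (indicator U x * indicator ?Q x) \<partial>M)"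
      by (simp add: h_def algebra_simps)
    also have "\<dots> = (\<integral>x. f x * indicator ?Q x \<partial>M) - l * (\<integral>x. indicator U x * indicator ?Q x \<partial>M)"
      using ind[OF f(1)] ind[OF iU] by simp
    finally have 1: "l * (\<integral>x. indicator U x * indicator ?Q x \<partial>M) \<le> (\<integral>x. f x * indicator ?Q x \<partial>M)" by simp
    have "measure M (P n) = (\<integral>x. indicator (P n) x \<partial>M)"
      using P[of n] sets.sets_into_space[OF P[of n]] by (simp add: Int_absorb2)
    also have "\<dots> \<le> (\<integral>x. indicator U x * indicator ?Q x \<partial>M)"
    proof (rule integral_mono)
      show "integrable M (\<lambda>x. indicator (P n) x :: real)" using P_fm[of n] by (simp add: fmeasurable_def)
      show "integrable M (\<lambda>x. indicator U x * indicator ?Q x :: real)" by (rule ind[OF iU])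
      show "indicator (P n) x \<le> (indicator U x * indicator ?Q x :: real)" for x
        using E(2) by (auto simp: P_def indicator_def)
    qed
    finally have "l * measure M (P n) \<le> l * (\<integral>x. indicator U x * indicator ?Q x \<partial>M)" using l by simp
    also note 1
    also have "(\<integral>x. f x * indicator ?Q x \<partial>M) \<le> (\<integral>x. f x \<partial>M)"
      by (rule integral_mono) (use ind[OF f(1)] f in \<open>auto simp: indicator_def\<close>)
    finally show ?thesis .
  qed
  have "(\<Union>n. P n) = E"
  proof
    show "E \<subseteq> (\<Union>n. P n)"
    proof
      fix x assume x: "x \<in> E"
      then obtain n where "l * birkhoff_sum T (indicator U) n x < birkhoff_sum T f n x" using E(3) by blast
      moreover have "birkhoff_sum T h n x = birkhoff_sum T f n x - l * birkhoff_sum T (indicator U) n x"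
        by (simp add: birkhoff_sum_def h_def sum_subtractf sum_distrib_left)
      ultimately have "0 < birkhoff_max T h n x" using birkhoff_sum_le_max[of n n T h x] by simp
      then show "x \<in> (\<Union>n. P n)" using x by (auto simp: P_def)
    qed
  qed (auto simp: P_def)
  moreover have "(\<lambda>n. measure M (P n)) \<longlonglongrightarrow> measure M (\<Union>n. P n)"
  proof (rule Lim_measure_incseq)
    show "range P \<subseteq> sets M" using P by auto
    show "incseq P"
      by (rule incseq_SucI) (use birkhoff_max_mono_Suc[of T h] in \<open>auto simp: P_def intro: less_le_trans\<close>)
    show "emeasure M (\<Union>n. P n) \<noteq> \<infinity>" using \<open>(\<Union>n. P n) = E\<close> fmE by (auto simp: fmeasurable_def)
  qed
  ultimately have "(\<lambda>n. l * measure M (P n)) \<longlonglongrightarrow> l * measure M E" by (auto intro: tendsto_intros)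
  then show ?thesis by (rule LIMSEQ_le_const2) (use le in auto)
qed

section \<open>Perturbation of laws\<close>

context renewal_averages
begin

text \<open>The finitely many exceptional indices form a null sequence, which costs an arbitrarily
  small e'.\<close>

lemma avg_le_eventually:
  assumes "avg_le e c" "\<forall>\<^sub>F n in sequentially. \<bar>d n\<bar> \<le> \<bar>c n\<bar>" "0 < e'"
  shows "avg_le (e + e') d"
proof (rule avg_le_add[OF assms(1)])
  let ?b = "\<lambda>n. if \<bar>d n\<bar> \<le> \<bar>c n\<bar> then 0 else d n"
  have "avg_null ?b"
    by (rule avg_null_small_factor[OF assms(1) tendsto_const[of 0]])
      (use assms(2) in \<open>auto elim: eventually_mono\<close>)
  then show "avg_le e' ?b" using assms(3) by (rule avg_null_le)
qed auto

lemma integrable_weight_indicator: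
  assumes D: "integrable M D" and "\<phi> \<in> borel_measurable M" "A \<in> sets borel"
  shows "integrable M (\<lambda>x. D x * indicator A (\<phi> x :: real) :: real)"
  by (rule integrable_weight[OF assms(1,2)]) (use assms(3) in \<open>auto simp: bounded_iff indicator_def intro!: exI[of _ 1]\<close>)

text \<open>Where |\<phi>| < L the perturbation is at most r(n) (1 + L), eventually below any bound;
  the complement is controlled by tightness. The factor 1 + |\<phi>| admits both an additive change
  of the sums and a change of the normalization.\<close>

lemma avg_law_perturb:
  assumes law: "avg_law M D \<phi> c w" and D: "\<And>n. integrable M (D n)"
    and D0: "\<And>n x. x \<in> space M \<Longrightarrow> 0 \<le> D n x" and \<phi>: "\<And>n. \<phi> n \<in> borel_measurable M"
    and \<phi>': "\<And>n. \<phi>' n \<in> borel_measurable M" and r: "r \<longlonglongrightarrow> 0"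
    and le: "\<And>n x. 1 \<le> n \<Longrightarrow> x \<in> space M \<Longrightarrow> \<bar>\<phi>' n x - \<phi> n x\<bar> \<le> r n * (1 + \<bar>\<phi> n x\<bar>)"
  shows "avg_law M D \<phi>' c w"
proof (rule avg_law_approx[OF D \<phi>'])
  fix e :: real assume e: "0 < e"
  obtain L where L: "0 < L" "avg_le (e/2) (\<lambda>n. \<integral>x. D n x * indicator {x. L \<le> \<bar>\<phi> n x\<bar>} x \<partial>M)"
    using avg_law_tail[OF law D D0 \<phi>, of "e/2"] e by auto
  have "avg_le (e/2 + e/2) (\<lambda>n. \<integral>x. D n x * indicator {x. e < \<bar>\<phi>' n x - \<phi> n x\<bar>} x \<partial>M)"
  proof (rule avg_le_eventually[OF L(2)])
    have "0 < e / (1 + L)" using e L by simp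
    then have "\<forall>\<^sub>F n in sequentially. r n < e / (1 + L)" by (rule order_tendstoD(2)[OF r])
    then show "\<forall>\<^sub>F n in sequentially.
        \<bar>\<integral>x. D n x * indicator {x. e < \<bar>\<phi>' n x - \<phi> n x\<bar>} x \<partial>M\<bar> \<le> \<bar>\<integral>x. D n x * indicator {x. L \<le> \<bar>\<phi> n x\<bar>} x \<partial>M\<bar>"
      using eventually_ge_at_top[of 1]
    proof eventually_elim
      case (elim n)
      have "0 \<le> (\<integral>x. D n x * indicator {x. e < \<bar>\<phi>' n x - \<phi> n x\<bar>} x \<partial>M)"
        by (rule integral_nonneg_AE) (use D0 in \<open>auto intro!: AE_I2\<close>)
      moreover have "(\<integral>x. D n x * indicator {x. e < \<bar>\<phi>' n x - \<phi> n x\<bar>} x \<partial>M) \<le> (\<integral>x. D n x * indicator {x. L \<le> \<bar>\<phi> n x\<bar>} x \<partial>M)"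
      proof (rule integral_mono)
        show "integrable M (\<lambda>x. D n x * indicator {x. e < \<bar>\<phi>' n x - \<phi> n x\<bar>} x)"
          using integrable_weight_indicator[OF D borel_measurable_diff[OF \<phi>' \<phi>], of "{y. e < \<bar>y\<bar>}" n n n]
          by (rule back_subst[of "integrable M"]) (auto simp: indicator_def)
        show "integrable M (\<lambda>x. D n x * indicator {x. L \<le> \<bar>\<phi> n x\<bar>} x)"
          using integrable_weight_indicator[OF D \<phi>, of "{y. L \<le> \<bar>y\<bar>}" n n]
          by (rule back_subst[of "integrable M"]) (auto simp: indicator_def)
        fix x assume x: "x \<in> space M"
        have "L \<le> \<bar>\<phi> n x\<bar>" if "e < \<bar>\<phi>' n x - \<phi> n x\<bar>"
        proof (rule ccontr)
          assume n: "\<not> L \<le> \<bar>\<phi> n x\<bar>"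
          have "r n * (1 + \<bar>\<phi> n x\<bar>) \<le> e / (1 + L) * (1 + \<bar>\<phi> n x\<bar>)" using elim by (intro mult_right_mono) auto
          also have "\<dots> \<le> e / (1 + L) * (1 + L)" using n e L by (intro mult_left_mono) auto
          also have "\<dots> = e" using L by simp
          finally show False using le[OF elim(2) x] that by simp
        qed
        then show "D n x * indicator {x. e < \<bar>\<phi>' n x - \<phi> n x\<bar>} x \<le> D n x * indicator {x. L \<le> \<bar>\<phi> n x\<bar>} x"
          using D0[OF x] by (auto simp: indicator_def)
      qed
      ultimately show ?case by simp
    qed
  qed (use e in simp)
  moreover have "avg_le e (\<lambda>n. 0)" using avg_null_zero e by (rule avg_null_le)
  ultimately show "\<exists>D' \<phi>'' c' w'.
      (\<forall>n. integrable M (D' n)) \<and> (\<forall>n. \<forall>x\<in>space M. 0 \<le> D' n x) \<and> (\<forall>n. \<phi>'' n \<in> borel_measurable M) \<and>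
      avg_law M D' \<phi>'' c' w' \<and> \<bar>c' - c\<bar> \<le> e \<and> \<bar>w' - w\<bar> \<le> e \<and>
      avg_le e (\<lambda>n. \<integral>x. \<bar>D n x - D' n x\<bar> \<partial>M) \<and>
      avg_le e (\<lambda>n. \<integral>x. D' n x * indicator {x. e < \<bar>\<phi>' n x - \<phi>'' n x\<bar>} x \<partial>M)"
    using law D D0 \<phi> e by (intro exI[of _ D] exI[of _ \<phi>] exI[of _ c] exI[of _ w]) auto
qed

lemma avg_law_add:
  assumes "avg_law M D \<phi> c w" "avg_law M D' \<phi> c' w"
    and "\<And>n. integrable M (D n)" "\<And>n. integrable M (D' n)" "\<And>n. \<phi> n \<in> borel_measurable M"
  shows "avg_law M (\<lambda>n x. D n x + D' n x) \<phi> (c + c') w"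
  using avg_law_sum[of UNIV M "\<lambda>b. if b then D else D'" \<phi> "\<lambda>b. if b then c else c'" w] assms
  by (simp add: UNIV_bool add.commute)

end

section \<open>Laws of ergodic sums on the natural extension\<close>

text \<open>In terms of the time j = N - n the set consists of visits before N with few visits in
  [j, N). The earliest of them belongs to the largest index m; its window [N - m, N) has at most s
  visits and contains all the others.\<close>

lemma card_last_visits:
  fixes P :: "nat \<Rightarrow> bool"
  assumes "0 \<le> s"
  shows "real (card {n\<in>{1..N}. P (N - n) \<and> real (card {k. k < n \<and> P (N - n + k)}) \<le> s}) \<le> s"
proof -
  define I where "I = {n\<in>{1..N}. P (N - n) \<and> real (card {k. k < n \<and> P (N - n + k)}) \<le> s}"
  have fin: "finite I" by (simp add: I_def)
  show ?thesis
  proof (cases "I = {}")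
    case True
    then show ?thesis using assms unfolding I_def[symmetric] by simp
  next
    case False
    define m where "m = Max I"
    have m: "m \<in> I" "\<And>n. n \<in> I \<Longrightarrow> n \<le> m" unfolding m_def using fin False by auto
    have "card I \<le> card {k. k < m \<and> P (N - m + k)}"
    proof (rule card_inj_on_le[where f="\<lambda>n. m - n"])
      show "inj_on (\<lambda>n. m - n) I" using m(2) by (auto intro!: inj_onI) (metis diff_diff_cancel)
      show "(\<lambda>n. m - n) ` I \<subseteq> {k. k < m \<and> P (N - m + k)}"
      proof
        fix k assume "k \<in> (\<lambda>n. m - n) ` I"
        then obtain n where n: "n \<in> I" "k = m - n" by auto
        have "N - m + k = N - n" using n m(2)[OF n(1)] m(1) by (auto simp: I_def)
        then show "k \<in> {k. k < m \<and> P (N - m + k)}" using n m by (auto simp: I_def)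
      qed
    qed simp
    also have "real \<dots> \<le> s" using m(1) unfolding I_def by blast
    finally show ?thesis unfolding I_def by simp
  qed
qed

text \<open>The sum is floor(K h) / K, the layer-cake discretization at K levels, which turns a
  bounded function into a combination of indicators of its level sets.\<close>

lemma discretize_unit_interval:
  fixes h :: real and K :: nat
  assumes "0 \<le> h" "h \<le> 1" "1 \<le> K"
  shows "(\<Sum>k=1..K. 1 / K * of_bool (real k / real K \<le> h)) \<le> h" "h - 1 / K \<le> (\<Sum>k=1..K. 1 / K * of_bool (real k / real K \<le> h))"
proof -
  have eq: "{1..K} \<inter> {k. real k / K \<le> h} = {1..nat \<lfloor>K * h\<rfloor>}"
  proof -
    have "real k / K \<le> h \<longleftrightarrow> k \<le> nat \<lfloor>K * h\<rfloor>" if "1 \<le> k" for k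
    proof -
      have "real k / K \<le> h \<longleftrightarrow> real k \<le> K * h" using assms by (simp add: field_simps)
      also have "\<dots> \<longleftrightarrow> k \<le> nat \<lfloor>K * h\<rfloor>" using assms by (simp add: le_nat_iff le_floor_iff)
      finally show ?thesis .
    qed
    moreover have "nat \<lfloor>K * h\<rfloor> \<le> K"
    proof -
      have "real K * h \<le> K" using assms by (simp add: mult_left_le)
      then have "\<lfloor>K * h\<rfloor> \<le> int K" by (simp add: floor_le_iff)
      then show ?thesis by simp
    qed
    ultimately show ?thesis by auto
  qed
  have "(\<Sum>k=1..K. 1 / K * of_bool (real k / real K \<le> h)) = real (nat \<lfloor>K * h\<rfloor>) / K"
  proof -
    have "(\<Sum>k\<in>{1..K}. of_bool (real k / real K \<le> h) :: real) = of_nat (card ({1..K} \<inter> {k. real k / real K \<le> h}))"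
      by simp
    then show ?thesis unfolding eq sum_distrib_left[symmetric] by simp
  qed
  then have sum_eq: "(\<Sum>k=1..K. 1 / K * of_bool (real k / real K \<le> h)) = of_int \<lfloor>K * h\<rfloor> / K"
    using assms by simp
  have floor_bounds: "of_int \<lfloor>K * h\<rfloor> \<le> K * h" "K * h - 1 \<le> of_int \<lfloor>K * h\<rfloor>" by linarith+
  show "(\<Sum>k=1..K. 1 / K * of_bool (real k / real K \<le> h)) \<le> h"
    unfolding sum_eq using assms(3) floor_bounds(1) by (simp add: field_simps)
  have "h - 1 / K = (K * h - 1) / K" using assms(3) by (simp add: field_simps)
  also have "\<dots> \<le> of_int \<lfloor>K * h\<rfloor> / K" using floor_bounds(2) by (rule divide_right_mono) simp
  finally show "h - 1 / K \<le> (\<Sum>k=1..K. 1 / K * of_bool (real k / real K \<le> h))" unfolding sum_eq .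
qed

section \<open>Lifted sets and correlation weights\<close>

context natural_extension
begin

definition lift :: "'a set \<Rightarrow> (nat \<Rightarrow> 'a) set" where
  "lift A = {x \<in> space M'. x 0 \<in> A}"

lemma lift_sets: "A \<in> sets M \<Longrightarrow> lift A \<in> sets M'"
  unfolding lift_def by (rule coord_vimage_sets)

lemma measure_lift: "A \<in> sets M \<Longrightarrow> measure M' (lift A) = measure M A"
  unfolding lift_def measure_def by (simp add: emeasure_coord_vimage)

lemma lift_fmeasurable: "A \<in> fmeasurable M \<Longrightarrow> lift A \<in> fmeasurable M'"
  using lift_sets emeasure_coord_vimage by (auto simp: fmeasurable_def lift_def)

lemma integral_coord: "f \<in> borel_measurable M \<Longrightarrow> (\<integral>x. f (x k) \<partial>M') = (\<integral>x. f x \<partial>M :: real)"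
  by (metis integral_distr[OF measurable_coord] distr_coord)

lemma integrable_coord: "integrable M f \<Longrightarrow> integrable M' (\<lambda>x. f (x k) :: real)"
  by (metis integrable_distr[OF measurable_coord] distr_coord)

lemma birkhoff_coord:
  "x \<in> space M' \<Longrightarrow> birkhoff_sum T' (\<lambda>x. f (x k)) n x = birkhoff_sum T f n (x k)"
  by (simp add: birkhoff_sum_def ext_funpow_coord)

lemma ext_funpow_space: "x \<in> space M' \<Longrightarrow> (T' ^^ n) x \<in> space M'"
  by (rule mpt_funpow_space[OF ext_mpt])

text \<open>Kept as a product so that the indicator of \<open>B\<close> can be replaced by a
  conditional expectation.\<close>

definition wt :: "(nat \<Rightarrow> 'a) set \<Rightarrow> (nat \<Rightarrow> 'a) set \<Rightarrow> nat \<Rightarrow> (nat \<Rightarrow> 'a) \<Rightarrow> real" where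
  "wt B C n x = indicator B x * indicator C ((T' ^^ n) x)"

lemma wt_nonneg: "0 \<le> wt B C n x"
  by (simp add: wt_def)

lemma wt_eq_indicator: "wt B C n x = indicator (B \<inter> (T' ^^ n) -` C) x"
  by (simp add: wt_def indicator_def)

lemma Int_vimage_sets:
  assumes "B \<in> sets M'" "C \<in> sets M'"
  shows "B \<inter> (T' ^^ n) -` C \<in> sets M'"
proof -
  have "B \<inter> (T' ^^ n) -` C = B \<inter> ((T' ^^ n) -` C \<inter> space M')" using sets.sets_into_space[OF assms(1)] by auto
  then show ?thesis using assms measurable_sets[OF mpt_funpow_measurable[OF ext_mpt]] by auto
qed

lemma Int_vimage_fmeasurable:
  assumes "B \<in> fmeasurable M'" "C \<in> sets M'"
  shows "B \<inter> (T' ^^ n) -` C \<in> fmeasurable M'"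
  by (rule fmeasurableI2[OF assms(1)]) (use assms Int_vimage_sets in auto)

lemma wt_integrable: "B \<in> fmeasurable M' \<Longrightarrow> C \<in> sets M' \<Longrightarrow> integrable M' (wt B C n)"
  using Int_vimage_fmeasurable[of B C n] unfolding wt_eq_indicator[abs_def] by (simp add: fmeasurable_def)

lemma wt_integral:
  assumes "B \<in> sets M'" "C \<in> sets M'"
  shows "(\<integral>x. wt B C n x \<partial>M') = measure M' (B \<inter> (T' ^^ n) -` C)"
  unfolding wt_eq_indicator using sets.sets_into_space[OF Int_vimage_sets[OF assms]] by (simp add: Int_absorb2)

end

text \<open>In the application \<open>a\<close> is asymptotic to an increasing return sequence but
  need not increase itself, which is why \<open>a_quasi_mono\<close> carries a constant.\<close>

locale renewal_extension = natural_extension M T M' + renewal_averages a u W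
  for M :: "'a measure" and T M' a u W +
  fixes G :: "'a set"
  assumes G: "G \<in> fmeasurable M" and G_pos: "0 < measure M G"
    and cons: "conservative M T" and erg: "ergodic M T"
    and a_quasi_mono: "\<exists>K>0. \<forall>n N. 1 \<le> n \<longrightarrow> n \<le> N \<longrightarrow> a n \<le> K * a N"
    and base_law: "\<And>B C f. B \<in> sets M \<Longrightarrow> C \<in> sets M \<Longrightarrow> B \<subseteq> G \<Longrightarrow> C \<subseteq> G \<Longrightarrow>
      integrable M f \<Longrightarrow> (\<And>x. x \<in> space M \<Longrightarrow> 0 \<le> f x) \<Longrightarrow>
      avg_law M (\<lambda>n x. indicator B x * indicator C ((T ^^ n) x)) (\<lambda>n x. birkhoff_sum T f n x / a n)
        (measure M B * measure M C) (\<integral>x. f x \<partial>M)"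
begin

definition ext_law :: "(nat \<Rightarrow> 'a) set \<Rightarrow> (nat \<Rightarrow> 'a) set \<Rightarrow> ((nat \<Rightarrow> 'a) \<Rightarrow> real) \<Rightarrow> bool" where
  "ext_law B C f \<longleftrightarrow> avg_law M' (wt B C) (\<lambda>n x. birkhoff_sum T' f n x / a n)
     (measure M' B * measure M' C) (\<integral>x. f x \<partial>M')"

lemma G_sets: "G \<in> sets M" using G by auto
lemma lift_G: "lift G \<in> fmeasurable M'" by (rule lift_fmeasurable[OF G])
lemma lift_G_sets: "lift G \<in> sets M'" using lift_G by auto

lemma esum_measurable: "f \<in> borel_measurable M' \<Longrightarrow> (\<lambda>x. birkhoff_sum T' f n x / a n) \<in> borel_measurable M'"
  using birkhoff_measurable[OF ext_mpt] by (intro borel_measurable_divide) auto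

text \<open>Weights and sums are functions of the coordinate 0, whose distribution is
  \<open>M\<close>, so the integrals agree for every n.\<close>

lemma ext_law_lift:
  assumes "B \<in> sets M" "C \<in> sets M" "B \<subseteq> G" "C \<subseteq> G" "integrable M f" "\<And>x. x \<in> space M \<Longrightarrow> 0 \<le> f x"
  shows "ext_law (lift B) (lift C) (\<lambda>x. f (x 0))"
proof -
  have "avg_law M' (wt (lift B) (lift C)) (\<lambda>n x. birkhoff_sum T' (\<lambda>x. f (x 0)) n x / a n)
      (measure M B * measure M C) (\<integral>x. f x \<partial>M)"
  proof (rule avg_law_cong[OF base_law[OF assms]])
    fix n and g :: "real \<Rightarrow> real" assume g: "continuous_on UNIV g"
    note [measurable] = borel_measurable_continuous_onI[OF g] birkhoff_measurable[OF base_mpt borel_measurable_integrable[OF assms(5)]]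
      assms(1,2) mpt_funpow_measurable[OF base_mpt]
    have "(\<integral>x. wt (lift B) (lift C) n x * g (birkhoff_sum T' (\<lambda>x. f (x 0)) n x / a n) \<partial>M') =
      (\<integral>x. (\<lambda>y. indicator B y * indicator C ((T ^^ n) y) * g (birkhoff_sum T f n y / a n)) (x 0) \<partial>M')"
      by (rule Bochner_Integration.integral_cong)
        (simp_all add: wt_def lift_def indicator_def birkhoff_coord ext_funpow_coord ext_funpow_space)
    also have "\<dots> = (\<integral>y. indicator B y * indicator C ((T ^^ n) y) * g (birkhoff_sum T f n y / a n) \<partial>M)"
      by (rule integral_coord) measurable
    finally show "(\<integral>x. wt (lift B) (lift C) n x * g (birkhoff_sum T' (\<lambda>x. f (x 0)) n x / a n) \<partial>M') =
      (\<integral>y. indicator B y * indicator C ((T ^^ n) y) * g (birkhoff_sum T f n y / a n) \<partial>M)" .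
  qed
  then show ?thesis unfolding ext_law_def
    using assms by (simp add: measure_lift integral_coord)
qed

lemma lift_G_avg: obtains K where "0 < K" "avg_le K (\<lambda>n. \<integral>x. wt (lift G) (lift G) n x \<partial>M')"
proof -
  obtain K where K: "0 < K" "avg_le K u" by (rule u_avg)
  have "ext_law (lift G) (lift G) (\<lambda>x. 0)"
    using ext_law_lift[OF G_sets G_sets, of "\<lambda>_. 0"] by simp
  then have "avg_null (\<lambda>n. (\<integral>x. wt (lift G) (lift G) n x \<partial>M') - measure M' (lift G) * measure M' (lift G) * u n)"
    unfolding ext_law_def by (rule avg_law_mass)
  then have "avg_le (1 + measure M' (lift G) * measure M' (lift G) * K) (\<lambda>n. \<integral>x. wt (lift G) (lift G) n x \<partial>M')"
    by (rule avg_le_of_null[OF _ K(2)]) (use K in auto)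
  then show thesis by (rule that[rotated]) (use K in \<open>simp add: add_pos_nonneg\<close>)
qed

section \<open>Conditioning on the coordinate 0\<close>

abbreviation "base_algebra \<equiv> vimage_algebra (space M') (\<lambda>x. x 0) M"

lemma coord_funcset: "(\<lambda>x. x 0) \<in> space M' \<rightarrow> space M"
  using coord_space by auto

lemma measurable_base_coord: "(\<lambda>x. x 0) \<in> base_algebra \<rightarrow>\<^sub>M M"
  by (rule measurable_vimage_algebra1[OF coord_funcset])

lemma subalgebra_base: "subalgebra M' base_algebra"
  unfolding subalgebra_def sets_vimage_algebra2[OF coord_funcset]
  using measurable_sets[OF measurable_coord] by auto

text \<open>Conditional expectations in infinite measure require the restricted measure to be
  \<sigma>-finite; the lifted exhaustion of \<open>M\<close> is measurable with respect to the
  coordinate 0.\<close>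

lemma base_algebra_sigma_finite: "sigma_finite_subalgebra M' base_algebra"
proof
  show "subalgebra M' base_algebra" by (rule subalgebra_base)
  interpret sigma_finite_measure M using base_mpt by (simp add: mpt_def)
  obtain F :: "nat \<Rightarrow> 'a set" where F: "range F \<subseteq> sets M" "(\<Union>i. F i) = space M" "\<And>i. emeasure M (F i) \<noteq> \<infinity>"
    using sigma_finite by blast
  have F': "{x \<in> space M'. x 0 \<in> F i} \<in> sets base_algebra" for i
    unfolding sets_vimage_algebra2[OF coord_funcset] using F(1) by (auto intro!: exI[of _ "F i"])
  show "\<exists>A. countable A \<and> A \<subseteq> sets (restr_to_subalg M' base_algebra) \<and>
      \<Union>A = space (restr_to_subalg M' base_algebra) \<and> (\<forall>a\<in>A. emeasure (restr_to_subalg M' base_algebra) a \<noteq> \<infinity>)"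
  proof (intro exI[of _ "range (\<lambda>i. {x \<in> space M'. x 0 \<in> F i})"] conjI)
    show "\<Union>(range (\<lambda>i. {x \<in> space M'. x 0 \<in> F i})) = space (restr_to_subalg M' base_algebra)"
      using F(2) coord_space by (simp add: space_restr_to_subalg) blast
    show "\<forall>a\<in>range (\<lambda>i. {x \<in> space M'. x 0 \<in> F i}). emeasure (restr_to_subalg M' base_algebra) a \<noteq> \<infinity>"
      using F emeasure_coord_vimage[of "F _" 0] F'
      by (auto simp: emeasure_restr_to_subalg[OF subalgebra_base])
  qed (use F' in \<open>auto simp: sets_restr_to_subalg[OF subalgebra_base]\<close>)
qed

text \<open>As the ergodic sums and the set \<open>lift C\<close> depend on the coordinate 0 only, the indicator of
  \<open>B\<close> can be replaced by its conditional expectation, which is a uniform limit of combinations of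
  lifted sets.\<close>

lemma ext_law_any_lift:
  assumes B: "B \<in> sets M'" "B \<subseteq> lift G" and C: "C \<in> sets M" "C \<subseteq> G"
    and f: "integrable M f" "\<And>x. x \<in> space M \<Longrightarrow> 0 \<le> f x"
  shows "ext_law B (lift C) (\<lambda>x. f (x 0))"
proof -
  interpret F: sigma_finite_subalgebra M' base_algebra by (rule base_algebra_sigma_finite)
  define \<phi> where "\<phi> = (\<lambda>n x. birkhoff_sum T' (\<lambda>x. f (x 0)) n x / a n)"
  have \<phi>[measurable]: "\<phi> n \<in> borel_measurable M'" for n
    unfolding \<phi>_def by (rule esum_measurable) (use integrable_coord[OF f(1)] in auto)
  have Bf: "B \<in> fmeasurable M'" using lift_G B fmeasurableI2 by blast
  have Cf: "C \<in> fmeasurable M" using G C fmeasurableI2 by blast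
  note [measurable] = B(1) lift_sets[OF C(1)] lift_G_sets mpt_funpow_measurable[OF ext_mpt]
  define H0 where "H0 = real_cond_exp M' base_algebra (indicator B)"
  \<comment> \<open>Clamped so that the bounds hold at every point; almost everywhere it is still
    the conditional expectation.\<close>
  define H where "H x = max 0 (min (indicator (lift G) x) (H0 x))" for x
  have iB: "integrable M' (indicator B :: _ \<Rightarrow> real)" and iG: "integrable M' (indicator (lift G) :: _ \<Rightarrow> real)"
    using Bf lift_G by (auto simp: fmeasurable_def)
  have GF: "lift G \<in> sets base_algebra"
    unfolding sets_vimage_algebra2[OF coord_funcset] lift_def using G_sets by (auto intro!: exI[of _ G])
  have H0F: "H0 \<in> borel_measurable base_algebra" unfolding H0_def by simp
  have HF: "H \<in> borel_measurable base_algebra" unfolding H_def using H0F GF by measurable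
  have H_meas[measurable]: "H \<in> borel_measurable M'" by (rule measurable_from_subalg[OF subalgebra_base HF])
  have H_bounds: "0 \<le> H x" "H x \<le> indicator (lift G) x" for x unfolding H_def by (auto simp: indicator_def)
  have H_AE: "AE x in M'. H0 x = H x"
  proof -
    have "AE x in M'. 0 \<le> H0 x" unfolding H0_def by (rule F.real_cond_exp_pos) auto
    moreover have "AE x in M'. H0 x \<le> real_cond_exp M' base_algebra (indicator (lift G)) x"
      unfolding H0_def by (rule F.real_cond_exp_mono[OF _ iB iG]) (use B(2) in \<open>auto simp: indicator_def\<close>)
    moreover have "AE x in M'. real_cond_exp M' base_algebra (indicator (lift G)) x = indicator (lift G) x"
      by (rule F.real_cond_exp_F_meas[OF iG]) (use GF in measurable)
    ultimately show ?thesis by eventually_elim (auto simp: H_def)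
  qed
  have intH: "integrable M' H"
    by (rule Bochner_Integration.integrable_bound[OF iG]) (use H_bounds in auto)
  have cond: "(\<integral>x. indicator B x * Y x \<partial>M') = (\<integral>x. H x * Y x \<partial>M')"
    if "Y \<in> borel_measurable base_algebra" "\<And>x. \<bar>Y x\<bar> \<le> K" for Y :: "_ \<Rightarrow> real" and K
  proof -
    have Y[measurable]: "Y \<in> borel_measurable M'" by (rule measurable_from_subalg[OF subalgebra_base that(1)])
    have "integrable M' (\<lambda>x. Y x * indicator B x)"
    proof (rule Bochner_Integration.integrable_bound[where f="\<lambda>x. K * indicator B x"])
      show "integrable M' (\<lambda>x. K * indicator B x)" using iB by (rule integrable_mult_right)
      show "AE x in M'. norm (Y x * indicator B x) \<le> norm (K * indicator B x)"
        using order_trans[OF that(2) abs_ge_self] by (auto simp: indicator_def)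
    qed measurable
    from F.real_cond_exp_intg(2)[OF this that(1)]
    have "(\<integral>x. Y x * H0 x \<partial>M') = (\<integral>x. Y x * indicator B x \<partial>M')" unfolding H0_def by simp
    moreover have "(\<integral>x. Y x * H0 x \<partial>M') = (\<integral>x. Y x * H x \<partial>M')"
      by (rule integral_cong_AE) (use H_AE H0_def in \<open>auto elim!: eventually_mono\<close>)
    ultimately show ?thesis by (simp add: mult.commute)
  qed
  have mH: "(\<integral>x. H x \<partial>M') = measure M' B"
    using cond[of "\<lambda>_. 1" 1] B(1) sets.sets_into_space[OF B(1)] by (simp add: Int_absorb2)
  define D where "D = (\<lambda>n x. H x * indicator (lift C) ((T' ^^ n) x))"
  have D_int: "integrable M' (D n)" for n
    unfolding D_def by (rule Bochner_Integration.integrable_bound[OF intH]) (auto simp: indicator_def)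
  have "avg_law M' D \<phi> (measure M' B * measure M' (lift C)) (\<integral>x. f (x 0) \<partial>M')"
  proof (rule avg_law_approx[OF D_int \<phi>])
    fix e :: real assume e: "0 < e"
    obtain K0 where K0: "0 < K0" "avg_le K0 (\<lambda>n. \<integral>x. wt (lift G) (lift G) n x \<partial>M')" by (rule lift_G_avg)
    \<comment> \<open>The second condition serves the averaged error of the weights, the third the
      error of the total mass.\<close>
    obtain K :: nat where K: "1 \<le> K" "K0 / K \<le> e" "measure M' (lift G) * measure M' (lift C) / K \<le> e"
    proof -
      define R where "R = max 1 (max (K0 / e) (measure M' (lift G) * measure M' (lift C) / e))"
      obtain K :: nat where "R \<le> K" using real_arch_simple by blast
      then have "1 \<le> K" "K0 / e \<le> K" "measure M' (lift G) * measure M' (lift C) / e \<le> K"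
        by (auto simp: R_def)
      then show thesis using that[of K] e by (simp add: field_simps)
    qed
    \<comment> \<open>Level sets of a function of the coordinate 0. For k \<ge> 1 the level is
      positive, so they lie in \<open>lift G\<close>.\<close>
    define A where "A k = {x \<in> space M'. real k / K \<le> H x}" for k
    define h where "h x = (\<Sum>k=1..K. 1 / K * indicator (A k) x :: real)" for x
    have AK: "\<exists>A'\<in>sets M. A' \<subseteq> G \<and> A k = lift A'" if "k \<in> {1..K}" for k
    proof -
      have "A k \<in> sets base_algebra"
        using borel_measurable_le[OF borel_measurable_const[of "real k / K"] HF]
        unfolding A_def space_vimage_algebra .
      then obtain A' where A': "A' \<in> sets M" "A k = (\<lambda>x. x 0) -` A' \<inter> space M'"
        unfolding sets_vimage_algebra2[OF coord_funcset] by auto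
      have "A k \<subseteq> lift G"
      proof
        fix x assume x: "x \<in> A k"
        have "0 < real k / K" using that by simp
        then have "0 < H x" using x unfolding A_def by auto
        then show "x \<in> lift G" using H_bounds[of x] by (cases "x \<in> lift G") auto
      qed
      then have "A k = lift (A' \<inter> G)" unfolding A' by (auto simp: lift_def)
      then show ?thesis using A' G_sets by (intro bexI[of _ "A' \<inter> G"]) auto
    qed
    have A_sets[measurable]: "A k \<in> sets M'" for k unfolding A_def by measurable
    have A_fm: "A k \<in> fmeasurable M'" if "k \<in> {1..K}" for k
    proof -
      obtain A' where A': "A' \<in> sets M" "A' \<subseteq> G" "A k = lift A'" using AK[OF \<open>k \<in> {1..K}\<close>] by blast
      show ?thesis unfolding A'(3) by (rule lift_fmeasurable[OF fmeasurableI2[OF G A'(2,1)]])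
    qed
    have A_law: "avg_law M' (wt (A k) (lift C)) \<phi> (measure M' (A k) * measure M' (lift C)) (\<integral>x. f (x 0) \<partial>M')"
      if "k \<in> {1..K}" for k
    proof -
      obtain A' where A': "A' \<in> sets M" "A' \<subseteq> G" "A k = lift A'" using AK[OF \<open>k \<in> {1..K}\<close>] by blast
      show ?thesis
        using ext_law_lift[OF A'(1) C(1) A'(2) C(2) f] unfolding ext_law_def \<phi>_def A'(3) .
    qed
    define D' where "D' = (\<lambda>n x. \<Sum>k=1..K. 1 / K * wt (A k) (lift C) n x)"
    have D'_eq: "D' n x = h x * indicator (lift C) ((T' ^^ n) x)" for n x
      by (simp add: D'_def h_def wt_def sum_distrib_right mult.assoc)
    have h_eq: "h x = (\<Sum>k=1..K. 1 / K * of_bool (real k / real K \<le> H x))" if "x \<in> space M'" for x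
      using that unfolding h_def A_def by (auto intro!: sum.cong simp: indicator_def)
    have hH: "\<bar>H x - h x\<bar> \<le> 1 / K * indicator (lift G) x" if x: "x \<in> space M'" for x
    proof (cases "x \<in> lift G")
      case True
      have "H x \<le> 1" using H_bounds(2)[of x] True by simp
      then show ?thesis
        using discretize_unit_interval[OF H_bounds(1)[of x] _ K(1)] True x by (auto simp: h_eq abs_le_iff)
    next
      case False
      then have "H x = 0" using H_bounds[of x] by simp
      moreover have "h x = 0" unfolding h_eq[OF x] \<open>H x = 0\<close>
        using K(1) by (intro sum.neutral) (auto simp: divide_le_0_iff)
      ultimately show ?thesis using False by simp
    qed
    have h_int: "integrable M' h"
      unfolding h_def using A_fm by (intro Bochner_Integration.integrable_sum integrable_mult_right) (auto simp: fmeasurable_def)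
    have law': "avg_law M' D' \<phi> (\<Sum>k=1..K. 1 / K * (measure M' (A k) * measure M' (lift C))) (\<integral>x. f (x 0) \<partial>M')"
      unfolding D'_def
      by (rule avg_law_sum[OF finite_atLeastAtMost avg_law_scale[OF A_law]
          integrable_mult_right[OF wt_integrable[OF A_fm lift_sets[OF C(1)]]] \<phi>])
    have c': "\<bar>(\<Sum>k=1..K. 1 / K * (measure M' (A k) * measure M' (lift C))) - measure M' B * measure M' (lift C)\<bar> \<le> e"
    proof -
      have "(\<Sum>k=1..K. 1 / K * (measure M' (A k) * measure M' (lift C))) = (\<integral>x. h x \<partial>M') * measure M' (lift C)"
        unfolding h_def using A_fm sets.sets_into_space[OF A_sets]
        by (subst Bochner_Integration.integral_sum)
          (auto simp: fmeasurable_def sum_distrib_right Int_absorb2 mult.assoc intro!: integrable_mult_right)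
      then have diff: "\<bar>(\<Sum>k=1..K. 1 / K * (measure M' (A k) * measure M' (lift C))) - measure M' B * measure M' (lift C)\<bar> =
          \<bar>\<integral>x. H x - h x \<partial>M'\<bar> * measure M' (lift C)"
        unfolding mH[symmetric] using intH h_int
        by (simp add: left_diff_distrib[symmetric] abs_mult abs_minus_commute)
      have "\<bar>\<integral>x. H x - h x \<partial>M'\<bar> \<le> (\<integral>x. \<bar>H x - h x\<bar> \<partial>M')" by (rule integral_abs_bound)
      also have "\<dots> \<le> (\<integral>x. 1 / K * indicator (lift G) x \<partial>M')"
        by (rule integral_mono) (use hH intH h_int iG in auto)
      also have "\<dots> = measure M' (lift G) / K"
        using sets.sets_into_space[OF lift_G_sets] by (simp add: Int_absorb2)
      finally have "\<bar>\<integral>x. H x - h x \<partial>M'\<bar> * measure M' (lift C) \<le> measure M' (lift G) / K * measure M' (lift C)"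
        by (rule mult_right_mono) simp
      also have "\<dots> \<le> e" using K(3) by simp
      finally show ?thesis unfolding diff .
    qed
    have close: "avg_le e (\<lambda>n. \<integral>x. \<bar>D n x - D' n x\<bar> \<partial>M')"
    proof (rule avg_le_mono[OF avg_le_cmult[OF K0(2), of "1/K"]])
      show "\<bar>1 / real K\<bar> * K0 \<le> e" using K(2) by simp
      fix n
      have D'_int: "integrable M' (D' n)" unfolding D'_def
        using A_fm lift_sets[OF C(1)] by (intro Bochner_Integration.integrable_sum integrable_mult_right wt_integrable) auto
      have "(\<integral>x. \<bar>D n x - D' n x\<bar> \<partial>M') \<le> (\<integral>x. 1 / K * wt (lift G) (lift G) n x \<partial>M')"
      proof (rule integral_mono)
        fix x assume x: "x \<in> space M'"
        have "\<bar>D n x - D' n x\<bar> = \<bar>H x - h x\<bar> * indicator (lift C) ((T' ^^ n) x)"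
          by (simp add: D_def D'_eq left_diff_distrib[symmetric] abs_mult)
        also have "\<dots> \<le> 1 / K * indicator (lift G) x * indicator (lift G) ((T' ^^ n) x)"
          by (rule mult_mono[OF hH[OF x]]) (use C(2) in \<open>auto simp: indicator_def lift_def\<close>)
        finally show "\<bar>D n x - D' n x\<bar> \<le> 1 / K * wt (lift G) (lift G) n x" by (simp add: wt_def)
      qed (use D_int D'_int wt_integrable[OF lift_G lift_G_sets] in auto)
      moreover have "0 \<le> (\<integral>x. wt (lift G) (lift G) n x \<partial>M')" by (simp add: wt_nonneg)
      ultimately show "\<bar>\<integral>x. \<bar>D n x - D' n x\<bar> \<partial>M'\<bar> \<le> \<bar>1 / K * (\<integral>x. wt (lift G) (lift G) n x \<partial>M')\<bar>" by simp
    qed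
    have zero: "avg_le e (\<lambda>n. 0)" using avg_null_zero e by (rule avg_null_le)
    show "\<exists>D' \<phi>' c' w'.
      (\<forall>n. integrable M' (D' n)) \<and> (\<forall>n. \<forall>x\<in>space M'. 0 \<le> D' n x) \<and> (\<forall>n. \<phi>' n \<in> borel_measurable M') \<and>
      avg_law M' D' \<phi>' c' w' \<and> \<bar>c' - (measure M' B * measure M' (lift C))\<bar> \<le> e \<and> \<bar>w' - (\<integral>x. f (x 0) \<partial>M')\<bar> \<le> e \<and>
      avg_le e (\<lambda>n. \<integral>x. \<bar>D n x - D' n x\<bar> \<partial>M') \<and>
      avg_le e (\<lambda>n. \<integral>x. D' n x * indicator {x. e < \<bar>\<phi> n x - \<phi>' n x\<bar>} x \<partial>M')"
    proof (intro exI conjI)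
      show "\<forall>n. integrable M' (D' n)" unfolding D'_def
        using A_fm lift_sets[OF C(1)] by (intro allI Bochner_Integration.integrable_sum integrable_mult_right wt_integrable) auto
      show "\<forall>n. \<forall>x\<in>space M'. 0 \<le> D' n x" unfolding D'_def by (auto intro!: sum_nonneg simp: wt_nonneg)
      show "avg_law M' D' \<phi> (\<Sum>k=1..K. 1 / K * (measure M' (A k) * measure M' (lift C))) (\<integral>x. f (x 0) \<partial>M')" by (rule law')
    qed (use c' close zero e in auto)
  qed
  then have law: "avg_law M' D \<phi> (measure M' B * measure M' (lift C)) (\<integral>x. f (x 0) \<partial>M')" by simp
  show ?thesis unfolding ext_law_def \<phi>_def[symmetric]
  proof (rule avg_law_cong[OF law])
    fix n and g :: "real \<Rightarrow> real" assume g: "continuous_on UNIV g" "bounded (range g)"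
    obtain K where K: "\<And>y. \<bar>g y\<bar> \<le> K" using g(2) by (auto simp: bounded_iff)
    have gm[measurable]: "g \<in> borel_measurable borel" by (rule borel_measurable_continuous_onI[OF g(1)])
    \<comment> \<open>Right set and test function together form a bounded function of the coordinate
      0, so replacing the indicator of \<open>B\<close> by \<open>H\<close> is exact for every
      n.\<close>
    define y where "y z = indicator C ((T ^^ n) z) * g (birkhoff_sum T f n z / a n)" for z
    have y: "y \<in> borel_measurable M" unfolding y_def
      using C(1) mpt_funpow_measurable[OF base_mpt] birkhoff_measurable[OF base_mpt borel_measurable_integrable[OF f(1)]]
      by measurable
    have y_eq: "indicator (lift C) ((T' ^^ n) x) * g (\<phi> n x) = y (x 0)" if "x \<in> space M'" for x
      using that by (simp add: y_def \<phi>_def lift_def indicator_def birkhoff_coord ext_funpow_coord ext_funpow_space)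
    have "(\<integral>x. wt B (lift C) n x * g (\<phi> n x) \<partial>M') = (\<integral>x. indicator B x * y (x 0) \<partial>M')"
      by (rule Bochner_Integration.integral_cong) (auto simp: wt_def mult.assoc y_eq)
    also have "\<dots> = (\<integral>x. H x * y (x 0) \<partial>M')"
    proof (rule cond)
      show "(\<lambda>x. y (x 0)) \<in> borel_measurable base_algebra"
        by (rule measurable_compose[OF measurable_base_coord y])
      have "0 \<le> K" using order_trans[OF abs_ge_zero K] .
      then show "\<bar>y (x 0)\<bar> \<le> K" for x using K by (auto simp: y_def indicator_def)
    qed
    also have "\<dots> = (\<integral>x. D n x * g (\<phi> n x) \<partial>M')"
      by (rule Bochner_Integration.integral_cong) (auto simp: D_def mult.assoc y_eq)
    finally show "(\<integral>x. wt B (lift C) n x * g (\<phi> n x) \<partial>M') = (\<integral>x. D n x * g (\<phi> n x) \<partial>M')" .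
  qed
qed

end

context renewal_extension
begin

subsection \<open>Uniform smallness\<close>

text \<open>By invariance the n-th integrand may be composed with T'^(N-n). All terms then refer to
  the same event T'^N x in E, and along one orbit the indices that count are visits to
  \<open>lift G\<close> among the last s before time N. Of \<open>E\<close> only its measure enters
  the bound.\<close>

lemma sum_early_visits:
  assumes E: "E \<in> fmeasurable M'" and s: "0 \<le> s"
  shows "(\<Sum>n=1..N. \<integral>x. wt (lift G) E n x * indicator {x. birkhoff_sum T' (\<lambda>x. indicator G (x 0)) n x \<le> s} x \<partial>M')
    \<le> s * measure M' E"
proof -
  let ?S = "birkhoff_sum T' (\<lambda>x. indicator G (x 0) :: real)"
  define F where "F n x = wt (lift G) E n x * indicator {x. ?S n x \<le> s} x" for n x
  have Es: "E \<in> sets M'" using E by auto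
  have S: "?S n \<in> borel_measurable M'" for n
    by (rule birkhoff_measurable[OF ext_mpt]) (use measurable_coord[of 0] G_sets in measurable)
  have F_int: "integrable M' (F n)" for n
    using integrable_weight_indicator[OF wt_integrable[OF lift_G Es] S, of "{y. y \<le> s}" n n]
    unfolding F_def by (rule back_subst[of "integrable M'"]) (auto simp: indicator_def)
  have iE: "integrable M' (indicator E :: _ \<Rightarrow> real)" using E by (simp add: fmeasurable_def)
  have "(\<Sum>n=1..N. \<integral>x. F n x \<partial>M') = (\<Sum>n=1..N. \<integral>x. F n ((T' ^^ (N - n)) x) \<partial>M')"
    using F_int by (intro sum.cong refl mpt_integral[OF ext_mpt, symmetric]) auto
  also have "\<dots> = (\<integral>x. (\<Sum>n=1..N. F n ((T' ^^ (N - n)) x)) \<partial>M')"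
    by (rule Bochner_Integration.integral_sum[symmetric]) (rule mpt_integrable[OF ext_mpt F_int])
  also have "\<dots> \<le> (\<integral>x. s * indicator E ((T' ^^ N) x) \<partial>M')"
  proof (rule integral_mono)
    show "integrable M' (\<lambda>x. \<Sum>n=1..N. F n ((T' ^^ (N - n)) x))"
      by (intro Bochner_Integration.integrable_sum mpt_integrable[OF ext_mpt F_int])
    show "integrable M' (\<lambda>x. s * indicator E ((T' ^^ N) x))"
      by (intro integrable_mult_right mpt_integrable[OF ext_mpt iE])
    fix x assume x: "x \<in> space M'"
    define P where "P j \<longleftrightarrow> ((T' ^^ j) x) 0 \<in> G" for j
    let ?Q = "\<lambda>n. P (N - n) \<and> real (card {k. k < n \<and> P (N - n + k)}) \<le> s"
    have "F n ((T' ^^ (N - n)) x) = indicator E ((T' ^^ N) x) * of_bool (?Q n)" if "n \<in> {1..N}" for n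
    proof -
      have 1: "(T' ^^ n) ((T' ^^ (N - n)) x) = (T' ^^ N) x"
        using that funpow_add[of n "N - n" T'] by (simp add: fun_eq_iff)
      have "?S n ((T' ^^ (N - n)) x) = (\<Sum>k<n. of_bool (P (N - n + k)))"
        unfolding birkhoff_sum_def P_def
        by (intro sum.cong) (simp_all add: indicator_def funpow_add[of _ "N - n"] add.commute[of "N - n"])
      also have "\<dots> = real (card {k. k < n \<and> P (N - n + k)})"
        by (simp add: Int_def lessThan_def)
      finally have 2: "?S n ((T' ^^ (N - n)) x) = real (card {k. k < n \<and> P (N - n + k)})" .
      have 3: "(T' ^^ (N - n)) x \<in> lift G \<longleftrightarrow> P (N - n)"
        using ext_funpow_space[OF x] by (simp add: lift_def P_def)
      show ?thesis unfolding F_def wt_def using 1 2 3 by (simp add: indicator_def)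
    qed
    then have "(\<Sum>n=1..N. F n ((T' ^^ (N - n)) x)) = indicator E ((T' ^^ N) x) * (\<Sum>n=1..N. of_bool (?Q n))"
      unfolding sum_distrib_left by (intro sum.cong) auto
    also have "(\<Sum>n=1..N. of_bool (?Q n)) = real (card {n\<in>{1..N}. ?Q n})"
    proof -
      have "{n\<in>{1..N}. ?Q n} = {1..N} \<inter> {n. ?Q n}" by blast
      then show ?thesis by (simp only: sum_of_bool_eq finite_atLeastAtMost)
    qed
    also have "indicator E ((T' ^^ N) x) * \<dots> \<le> indicator E ((T' ^^ N) x) * s"
      by (rule mult_left_mono[OF card_last_visits[OF s]]) simp
    finally show "(\<Sum>n=1..N. F n ((T' ^^ (N - n)) x)) \<le> s * indicator E ((T' ^^ N) x)"
      by (simp add: mult.commute)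
  qed
  also have "\<dots> = s * measure M' E"
    using mpt_integral[OF ext_mpt borel_measurable_integrable[OF iE]] sets.sets_into_space[OF Es] by (simp add: Int_absorb2)
  finally show ?thesis unfolding F_def .
qed

text \<open>Time reversal: on \<open>G \<inter> T\<^sup>-\<^sup>n E\<close> either the number of visits to \<open>G\<close> before time \<open>n\<close> is large,
  which is rare by tightness of the laws, or \<open>n\<close> is one of the last few visits before reaching \<open>E\<close>.\<close>

lemma uniform_smallness:
  assumes e: "0 < e"
  obtains d where "0 < d" "\<And>E. E \<in> sets M' \<Longrightarrow> E \<subseteq> lift G \<Longrightarrow> measure M' E \<le> d \<Longrightarrow>
    avg_le e (\<lambda>n. \<integral>x. wt (lift G) E n x \<partial>M')"
proof -
  let ?p = "\<lambda>x. indicator G (x 0) :: real"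
  let ?S = "birkhoff_sum T' ?p"
  have iG: "integrable M (indicator G :: _ \<Rightarrow> real)" using G by (simp add: fmeasurable_def)
  have law: "ext_law (lift G) (lift G) ?p"
    by (rule ext_law_lift[OF G_sets G_sets _ _ iG]) auto
  have pm: "?p \<in> borel_measurable M'" using integrable_coord[OF iG] by auto
  obtain L where L: "0 < L" "avg_le (e/2) (\<lambda>n. \<integral>x. wt (lift G) (lift G) n x * indicator {x. L \<le> \<bar>?S n x / a n\<bar>} x \<partial>M')"
    using avg_law_tail[OF law[unfolded ext_law_def] wt_integrable[OF lift_G lift_G_sets] wt_nonneg esum_measurable[OF pm], of "e/2"] e
    by auto
  obtain K where K: "0 < K" "\<And>n N. 1 \<le> n \<Longrightarrow> n \<le> N \<Longrightarrow> a n \<le> K * a N" using a_quasi_mono by blast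
  \<comment> \<open>Early visits, at most s = L K a(N) in number, contribute at most s d = (e/2)
    a(N) up to time N; the other e/2 is the tightness bound.\<close>
  define d where "d = e / (2 * L * K)"
  have d: "0 < d" "L * K * d = e / 2" using e L K by (auto simp: d_def)
  have "avg_le e (\<lambda>n. \<integral>x. wt (lift G) E n x \<partial>M')"
    if E: "E \<in> sets M'" "E \<subseteq> lift G" "measure M' E \<le> d" for E
    unfolding avg_le_def
  proof (use L(2)[unfolded avg_le_def] a_pos_eventually in eventually_elim)
    case (elim N)
    have Ef: "E \<in> fmeasurable M'" using lift_G E fmeasurableI2 by blast
    define s where "s = L * K * a N"
    have s: "0 \<le> s" using L K elim by (simp add: s_def)
    let ?t = "\<lambda>n. \<integral>x. wt (lift G) (lift G) n x * indicator {x. L \<le> \<bar>?S n x / a n\<bar>} x \<partial>M'"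
    let ?b = "\<lambda>n. \<integral>x. wt (lift G) E n x * indicator {x. ?S n x \<le> s} x \<partial>M'"
    have "\<bar>\<integral>x. wt (lift G) E n x \<partial>M'\<bar> \<le> ?b n + \<bar>?t n\<bar>" if n: "n \<in> {1..N}" for n
    proof -
      have i1: "integrable M' (\<lambda>x. wt (lift G) E n x * indicator {x. ?S n x \<le> s} x)"
        using integrable_weight_indicator[OF wt_integrable[OF lift_G E(1)] birkhoff_measurable[OF ext_mpt pm], of "{y. y \<le> s}" n n]
        by (rule back_subst[of "integrable M'"]) (auto simp: indicator_def)
      have i2: "integrable M' (\<lambda>x. wt (lift G) (lift G) n x * indicator {x. L \<le> \<bar>?S n x / a n\<bar>} x)"
        using integrable_weight_indicator[OF wt_integrable[OF lift_G lift_G_sets] esum_measurable[OF pm], of "{y. L \<le> \<bar>y\<bar>}" n n]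
        by (rule back_subst[of "integrable M'"]) (auto simp: indicator_def)
      have "(\<integral>x. wt (lift G) E n x \<partial>M') \<le>
          (\<integral>x. wt (lift G) E n x * indicator {x. ?S n x \<le> s} x + wt (lift G) (lift G) n x * indicator {x. L \<le> \<bar>?S n x / a n\<bar>} x \<partial>M')"
      proof (rule integral_mono)
        fix x
        \<comment> \<open>Quasi-monotonicity gives L a(n) \<le> s for all n \<le> N, so more than s
          visits before n force the normalized sum up to \<open>L\<close>.\<close>
        have an: "0 < a n" "a n \<le> K * a N" using a_pos K n by auto
        have "L \<le> \<bar>?S n x / a n\<bar>" if "\<not> ?S n x \<le> s"
        proof -
          have "L * a n \<le> s" using an L unfolding s_def by (simp add: mult.assoc)
          then have "L * a n \<le> ?S n x" using that by simp
          then have "L \<le> ?S n x / a n" using an by (simp add: field_simps)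
          then show ?thesis by (rule order_trans[OF _ abs_ge_self])
        qed
        moreover have "wt (lift G) E n x \<le> wt (lift G) (lift G) n x"
          using E(2) by (auto simp: wt_def indicator_def)
        ultimately show "wt (lift G) E n x \<le>
          wt (lift G) E n x * indicator {x. ?S n x \<le> s} x + wt (lift G) (lift G) n x * indicator {x. L \<le> \<bar>?S n x / a n\<bar>} x"
          using wt_nonneg[of "lift G" "lift G" n x] by (cases "?S n x \<le> s") (auto simp: indicator_def)
      qed (use wt_integrable[OF lift_G E(1)] i1 i2 in auto)
      also have "\<dots> = ?b n + ?t n" using i1 i2 by simp
      finally show ?thesis by (simp add: wt_nonneg)
    qed
    then have "(\<Sum>n=1..N. \<bar>\<integral>x. wt (lift G) E n x \<partial>M'\<bar>) \<le> (\<Sum>n=1..N. ?b n + \<bar>?t n\<bar>)" by (rule sum_mono)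
    also have "\<dots> = (\<Sum>n=1..N. ?b n) + (\<Sum>n=1..N. \<bar>?t n\<bar>)" by (rule sum.distrib)
    also have "\<dots> \<le> s * measure M' E + e/2 * a N" by (intro add_mono sum_early_visits Ef s elim)
    also have "s * measure M' E \<le> s * d" by (rule mult_left_mono[OF E(3) s])
    also have "s * d = e/2 * a N" unfolding s_def d(2)[symmetric] by simp
    finally show ?case by simp
  qed
  then show thesis using that d(1) by blast
qed

subsection \<open>Shift invariance of the laws of bounded functions\<close>

text \<open>The difference splits into the added term t / q and the change of normalization (s / p)
  (p / q - 1). The right side has the shape that \<open>avg_law_perturb\<close> asks for.\<close>

lemma perturb_Suc:
  fixes s t p q K :: real
  assumes "0 < p" "0 < q" "\<bar>t\<bar> \<le> K"
  shows "\<bar>(s + t) / q - s / p\<bar> \<le> (K / q + \<bar>p / q - 1\<bar>) * (1 + \<bar>s / p\<bar>)"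
proof -
  have "(s + t) / q - s / p = t / q + s / p * (p / q - 1)" using assms by (simp add: field_simps)
  then have "\<bar>(s + t) / q - s / p\<bar> \<le> \<bar>t / q\<bar> + \<bar>s / p\<bar> * \<bar>p / q - 1\<bar>"
    by (metis abs_mult abs_triangle_ineq)
  also have "\<bar>t / q\<bar> \<le> K / q" using assms by (simp add: divide_right_mono)
  finally have "\<bar>(s + t) / q - s / p\<bar> \<le> K / q + \<bar>s / p\<bar> * \<bar>p / q - 1\<bar>" by simp
  also have "\<dots> \<le> (K / q + \<bar>p / q - 1\<bar>) * (1 + \<bar>s / p\<bar>)"
    using assms by (simp add: algebra_simps)
  finally show ?thesis .
qed

lemma vimage_sets: "C \<in> sets M' \<Longrightarrow> (T' ^^ i) -` C \<inter> space M' \<in> sets M'"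
  by (rule measurable_sets[OF mpt_funpow_measurable[OF ext_mpt]])

lemma vimage_fmeasurable: "C \<in> fmeasurable M' \<Longrightarrow> (T' ^^ i) -` C \<inter> space M' \<in> fmeasurable M'"
  using mpt_emeasure_vimage[OF ext_mpt, of C i] vimage_sets[of C i] by (auto simp: fmeasurable_def)

lemma measure_vimage: "C \<in> sets M' \<Longrightarrow> measure M' ((T' ^^ i) -` C \<inter> space M') = measure M' C"
  by (rule mpt_measure_vimage[OF ext_mpt])

lemma vimage_Suc: "(T' ^^ Suc i) -` C \<inter> space M' = (T' ^^ i) -` (T' -` C \<inter> space M') \<inter> space M'"
  using ext_funpow_space by auto

text \<open>Passing to the preimage of \<open>C\<close> turns the weight at n into the weight at n +
  1. After this index shift the sums contain one more term, bounded by \<open>K\<close>, and the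
  normalization changes by a factor tending to 1.\<close>

lemma ext_law_vimage_right1:
  assumes B: "B \<in> fmeasurable M'" and C: "C \<in> fmeasurable M'" and f: "f \<in> borel_measurable M'"
    and K: "0 \<le> K" "\<And>x. x \<in> space M' \<Longrightarrow> \<bar>f x\<bar> \<le> K"
  shows "ext_law B (T' -` C \<inter> space M') f \<longleftrightarrow> ext_law B C f"
proof -
  let ?C = "T' -` C \<inter> space M'"
  let ?S = "birkhoff_sum T' f"
  have Cs: "C \<in> sets M'" using C by auto
  have C': "?C \<in> sets M'" "measure M' ?C = measure M' C"
    using vimage_sets[OF Cs, of 1] measure_vimage[OF Cs, of 1] by auto
  have wt_eq: "wt B ?C n x = wt B C (Suc n) x" if "x \<in> space M'" for n x
    using ext_funpow_space[OF that, of n] by (simp add: wt_def indicator_def)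
  let ?c = "measure M' B * measure M' C" and ?w = "\<integral>x. f x \<partial>M'"
  note i = wt_integrable[OF B C'(1)] and m = esum_measurable[OF f]
  have m': "(\<lambda>x. ?S (Suc n) x / a (Suc n)) \<in> borel_measurable M'" for n by (rule m)
  have r: "(\<lambda>n. a n / a (Suc n)) \<longlonglongrightarrow> 1" using tendsto_inverse[OF a_ratio] by simp
  have aK: "(\<lambda>n. K / a n) \<longlonglongrightarrow> 0" by (rule tendsto_divide_0[OF tendsto_const filterlim_at_top_imp_at_infinity[OF a_top]])
  have "ext_law B C f \<longleftrightarrow> avg_law M' (\<lambda>n. wt B C (Suc n)) (\<lambda>n x. ?S (Suc n) x / a (Suc n)) ?c ?w"
    unfolding ext_law_def by (rule avg_law_Suc[symmetric])
  also have "\<dots> \<longleftrightarrow> avg_law M' (wt B ?C) (\<lambda>n x. ?S (Suc n) x / a (Suc n)) ?c ?w"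
    by (rule iffI; erule avg_law_cong) (rule Bochner_Integration.integral_cong, auto simp: wt_eq)+
  also have "\<dots> \<longleftrightarrow> avg_law M' (wt B ?C) (\<lambda>n x. ?S n x / a n) ?c ?w"
  proof
    assume law: "avg_law M' (wt B ?C) (\<lambda>n x. ?S (Suc n) x / a (Suc n)) ?c ?w"
    show "avg_law M' (wt B ?C) (\<lambda>n x. ?S n x / a n) ?c ?w"
    proof (rule avg_law_perturb[OF law i wt_nonneg m' m])
      show "(\<lambda>n. K / a n + \<bar>a (Suc n) / a n - 1\<bar>) \<longlonglongrightarrow> 0"
        using tendsto_add[OF aK tendsto_rabs[OF tendsto_diff[OF a_ratio tendsto_const[of 1]]]] by simp
      fix n x assume n: "1 \<le> (n::nat)" and x: "x \<in> space M'"
      have "\<bar>- f ((T' ^^ n) x)\<bar> \<le> K" using K ext_funpow_space[OF x] by simp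
      from perturb_Suc[OF _ _ this, of "a (Suc n)" "a n" "?S (Suc n) x"]
      show "\<bar>?S n x / a n - ?S (Suc n) x / a (Suc n)\<bar> \<le> (K / a n + \<bar>a (Suc n) / a n - 1\<bar>) * (1 + \<bar>?S (Suc n) x / a (Suc n)\<bar>)"
        using a_pos n by (simp add: birkhoff_Suc_right)
    qed
  next
    assume law: "avg_law M' (wt B ?C) (\<lambda>n x. ?S n x / a n) ?c ?w"
    show "avg_law M' (wt B ?C) (\<lambda>n x. ?S (Suc n) x / a (Suc n)) ?c ?w"
    proof (rule avg_law_perturb[OF law i wt_nonneg m m'])
      show "(\<lambda>n. K / a (Suc n) + \<bar>a n / a (Suc n) - 1\<bar>) \<longlonglongrightarrow> 0"
        using tendsto_add[OF LIMSEQ_Suc[OF aK] tendsto_rabs[OF tendsto_diff[OF r tendsto_const[of 1]]]] by simp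
      fix n x assume n: "1 \<le> (n::nat)" and x: "x \<in> space M'"
      have "\<bar>f ((T' ^^ n) x)\<bar> \<le> K" using K ext_funpow_space[OF x] by simp
      from perturb_Suc[OF _ _ this, of "a n" "a (Suc n)" "?S n x"]
      show "\<bar>?S (Suc n) x / a (Suc n) - ?S n x / a n\<bar> \<le> (K / a (Suc n) + \<bar>a n / a (Suc n) - 1\<bar>) * (1 + \<bar>?S n x / a n\<bar>)"
        using a_pos n by (simp add: birkhoff_Suc_right)
    qed
  qed
  finally show ?thesis unfolding ext_law_def C'(2) by simp
qed

lemma ext_law_vimage_right:
  assumes B: "B \<in> fmeasurable M'" and C: "C \<in> fmeasurable M'" and f: "f \<in> borel_measurable M'"
    and K: "0 \<le> K" "\<And>x. x \<in> space M' \<Longrightarrow> \<bar>f x\<bar> \<le> K"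
  shows "ext_law B ((T' ^^ i) -` C \<inter> space M') f \<longleftrightarrow> ext_law B C f"
  using C
proof (induction i arbitrary: C)
  case 0
  then have "(T' ^^ 0) -` C \<inter> space M' = C" using sets.sets_into_space[of C M'] by auto
  then show ?case by simp
next
  case (Suc i)
  have "T' -` C \<inter> space M' \<in> fmeasurable M'" using vimage_fmeasurable[OF Suc.prems, of 1] by simp
  from Suc.IH[OF this] ext_law_vimage_right1[OF B Suc.prems f K] show ?case
    unfolding vimage_Suc by simp
qed

lemma birkhoff_comp: "birkhoff_sum T' (\<lambda>x. f (T' x)) n x = birkhoff_sum T' f n (T' x)"
  by (simp add: birkhoff_sum_def funpow_swap1)

text \<open>The ergodic sums differ by the telescoped boundary term f(T'^n x) - f(x), which vanishes
  after division by a(n).\<close>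

lemma ext_law_comp:
  assumes B: "B \<in> fmeasurable M'" and C: "C \<in> fmeasurable M'" and f: "f \<in> borel_measurable M'"
    and K: "0 \<le> K" "\<And>x. x \<in> space M' \<Longrightarrow> \<bar>f x\<bar> \<le> K"
  shows "ext_law B C (\<lambda>x. f (T' x)) \<longleftrightarrow> ext_law B C f"
proof -
  have fT: "(\<lambda>x. f (T' x)) \<in> borel_measurable M'" by (rule measurable_compose[OF ext_measurable f])
  have Cs: "C \<in> sets M'" using C by auto
  have w: "(\<integral>x. f (T' x) \<partial>M') = (\<integral>x. f x \<partial>M')" using mpt_integral[OF ext_mpt f, of 1] by simp
  let ?S = "birkhoff_sum T' f" and ?S' = "birkhoff_sum T' (\<lambda>x. f (T' x))"
  let ?c = "measure M' B * measure M' C" and ?w = "\<integral>x. f x \<partial>M'"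
  have diff: "\<bar>?S' n x / a n - ?S n x / a n\<bar> \<le> 2 * K / a n" if "1 \<le> n" "x \<in> space M'" for n x
  proof -
    have "?S' n x - ?S n x = f ((T' ^^ n) x) - f x"
      using birkhoff_Suc_left[of T' f n x] birkhoff_Suc_right[of T' f n x] birkhoff_comp[of f n x] by simp
    then have "\<bar>?S' n x - ?S n x\<bar> \<le> 2 * K"
      using K(2)[OF that(2)] K(2)[OF ext_funpow_space[OF that(2), of n]] by linarith
    then show ?thesis using a_pos[OF that(1)] by (simp add: diff_divide_distrib[symmetric] divide_right_mono)
  qed
  have le: "2 * K / a n \<le> 2 * K / a n * (1 + \<bar>y\<bar>)" if "1 \<le> n" for n y
    using mult_left_mono[of 1 "1 + \<bar>y\<bar>" "2 * K / a n"] a_pos[OF that] K(1) by simp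
  have diff': "\<bar>?S' n x / a n - ?S n x / a n\<bar> \<le> 2 * K / a n * (1 + \<bar>y\<bar>)"
      "\<bar>?S n x / a n - ?S' n x / a n\<bar> \<le> 2 * K / a n * (1 + \<bar>y\<bar>)" if "1 \<le> n" "x \<in> space M'" for n x y
    using order_trans[OF diff[OF that] le[OF that(1), of y]] by (simp_all only: abs_minus_commute)
  have aK: "(\<lambda>n. 2 * K / a n) \<longlonglongrightarrow> 0" by (rule tendsto_divide_0[OF tendsto_const filterlim_at_top_imp_at_infinity[OF a_top]])
  have "avg_law M' (wt B C) (\<lambda>n x. ?S' n x / a n) ?c ?w \<longleftrightarrow> avg_law M' (wt B C) (\<lambda>n x. ?S n x / a n) ?c ?w"
  proof
    assume law: "avg_law M' (wt B C) (\<lambda>n x. ?S' n x / a n) ?c ?w"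
    show "avg_law M' (wt B C) (\<lambda>n x. ?S n x / a n) ?c ?w"
      by (rule avg_law_perturb[OF law wt_integrable[OF B Cs] wt_nonneg esum_measurable[OF fT] esum_measurable[OF f] aK])
        (rule diff'(2))
  next
    assume law: "avg_law M' (wt B C) (\<lambda>n x. ?S n x / a n) ?c ?w"
    show "avg_law M' (wt B C) (\<lambda>n x. ?S' n x / a n) ?c ?w"
      by (rule avg_law_perturb[OF law wt_integrable[OF B Cs] wt_nonneg esum_measurable[OF f] esum_measurable[OF fT] aK])
        (rule diff'(1))
  qed
  then show ?thesis unfolding ext_law_def w .
qed

text \<open>When both sets and the function are shifted together, invariance of the measure gives
  equal integrals for every n, without any limit.\<close>

lemma ext_law_vimage_both:
  assumes B: "B \<in> sets M'" and C: "C \<in> sets M'" and f: "f \<in> borel_measurable M'" and law: "ext_law B C f"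
  shows "ext_law (T' -` B \<inter> space M') (T' -` C \<inter> space M') (\<lambda>x. f (T' x))"
proof -
  let ?B = "T' -` B \<inter> space M'" and ?C = "T' -` C \<inter> space M'"
  have w: "(\<integral>x. f (T' x) \<partial>M') = (\<integral>x. f x \<partial>M')" using mpt_integral[OF ext_mpt f, of 1] by simp
  have mB: "measure M' ?B = measure M' B" "measure M' ?C = measure M' C"
    using measure_vimage[OF B, of 1] measure_vimage[OF C, of 1] by auto
  show ?thesis unfolding ext_law_def w mB
  proof (rule avg_law_cong[OF law[unfolded ext_law_def]])
    fix n and g :: "real \<Rightarrow> real" assume g: "continuous_on UNIV g"
    note [measurable] = borel_measurable_continuous_onI[OF g] birkhoff_measurable[OF ext_mpt f] B C mpt_funpow_measurable[OF ext_mpt]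
    let ?h = "\<lambda>x. wt B C n x * g (birkhoff_sum T' f n x / a n)"
    have h: "?h \<in> borel_measurable M'" unfolding wt_def by measurable
    have "(\<integral>x. wt ?B ?C n x * g (birkhoff_sum T' (\<lambda>x. f (T' x)) n x / a n) \<partial>M') = (\<integral>x. ?h ((T' ^^ 1) x) \<partial>M')"
    proof (rule Bochner_Integration.integral_cong[OF refl])
      fix x assume x: "x \<in> space M'"
      have "wt ?B ?C n x = wt B C n (T' x)"
        using x ext_funpow_space[OF x, of n] by (simp add: wt_def indicator_def funpow_swap1)
      then show "wt ?B ?C n x * g (birkhoff_sum T' (\<lambda>x. f (T' x)) n x / a n) = ?h ((T' ^^ 1) x)"
        by (simp add: birkhoff_comp)
    qed
    also have "\<dots> = (\<integral>x. ?h x \<partial>M')" by (rule mpt_integral[OF ext_mpt h])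
    finally show "(\<integral>x. wt ?B ?C n x * g (birkhoff_sum T' (\<lambda>x. f (T' x)) n x / a n) \<partial>M') = (\<integral>x. ?h x \<partial>M')" .
  qed
qed

text \<open>Shift both sets and the function, which is exact, and then undo the shift of the
  function by \<open>ext_law_comp\<close> and that of the right set by
  \<open>ext_law_vimage_right1\<close>.\<close>

lemma ext_law_vimage_left:
  assumes B: "B \<in> fmeasurable M'" and C: "C \<in> fmeasurable M'" and f: "f \<in> borel_measurable M'"
    and K: "0 \<le> K" "\<And>x. x \<in> space M' \<Longrightarrow> \<bar>f x\<bar> \<le> K" and law: "ext_law B C f"
  shows "ext_law ((T' ^^ i) -` B \<inter> space M') C f"
  using B law
proof (induction i arbitrary: B)
  case 0
  then have "(T' ^^ 0) -` B \<inter> space M' = B" using sets.sets_into_space[of B M'] by auto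
  then show ?case using 0 by simp
next
  case (Suc i)
  have B': "T' -` B \<inter> space M' \<in> fmeasurable M'" using vimage_fmeasurable[OF Suc.prems(1), of 1] by simp
  have C': "T' -` C \<inter> space M' \<in> fmeasurable M'" using vimage_fmeasurable[OF C, of 1] by simp
  have "ext_law (T' -` B \<inter> space M') (T' -` C \<inter> space M') (\<lambda>x. f (T' x))"
    by (rule ext_law_vimage_both) (use Suc.prems C f in auto)
  then have "ext_law (T' -` B \<inter> space M') C f"
    using ext_law_comp[OF B' C' f K] ext_law_vimage_right1[OF B' C f K] by blast
  from Suc.IH[OF B' this] show ?case unfolding vimage_Suc .
qed

subsection \<open>From lifted sets to arbitrary sets\<close>

lemma ext_law_UN_right:
  assumes B: "B \<in> fmeasurable M'" and I: "finite I" "disjoint_family_on Z I" and Z: "\<And>i. i \<in> I \<Longrightarrow> Z i \<in> fmeasurable M'"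
    and f: "f \<in> borel_measurable M'" and law: "\<And>i. i \<in> I \<Longrightarrow> ext_law B (Z i) f"
  shows "ext_law B (\<Union>i\<in>I. Z i) f"
proof -
  have "avg_law M' (\<lambda>n x. \<Sum>i\<in>I. wt B (Z i) n x) (\<lambda>n x. birkhoff_sum T' f n x / a n)
      (\<Sum>i\<in>I. measure M' B * measure M' (Z i)) (\<integral>x. f x \<partial>M')"
    by (rule avg_law_sum[OF I(1)]) (use law Z wt_integrable[OF B] esum_measurable[OF f] in \<open>auto simp: ext_law_def\<close>)
  moreover have "(\<lambda>n x. \<Sum>i\<in>I. wt B (Z i) n x) = wt B (\<Union>i\<in>I. Z i)"
    by (simp add: fun_eq_iff wt_def indicator_UN_disjoint[OF I] sum_distrib_left)
  moreover have "(\<Sum>i\<in>I. measure M' B * measure M' (Z i)) = measure M' B * measure M' (\<Union>i\<in>I. Z i)"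
    using I Z by (subst measure_UNION') (auto simp: sum_distrib_left disjoint_family_on_def pairwise_def disjnt_def)
  ultimately show ?thesis by (simp add: ext_law_def)
qed

lemma ext_law_UN_left:
  assumes I: "finite I" "disjoint_family_on Z I" and Z: "\<And>i. i \<in> I \<Longrightarrow> Z i \<in> fmeasurable M'"
    and C: "C \<in> sets M'" and f: "f \<in> borel_measurable M'" and law: "\<And>i. i \<in> I \<Longrightarrow> ext_law (Z i) C f"
  shows "ext_law (\<Union>i\<in>I. Z i) C f"
proof -
  have "avg_law M' (\<lambda>n x. \<Sum>i\<in>I. wt (Z i) C n x) (\<lambda>n x. birkhoff_sum T' f n x / a n)
      (\<Sum>i\<in>I. measure M' (Z i) * measure M' C) (\<integral>x. f x \<partial>M')"
    by (rule avg_law_sum[OF I(1)]) (use law Z wt_integrable C esum_measurable[OF f] in \<open>auto simp: ext_law_def\<close>)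
  moreover have "(\<lambda>n x. \<Sum>i\<in>I. wt (Z i) C n x) = wt (\<Union>i\<in>I. Z i) C"
    by (simp add: fun_eq_iff wt_def indicator_UN_disjoint[OF I] sum_distrib_right)
  moreover have "(\<Sum>i\<in>I. measure M' (Z i) * measure M' C) = measure M' (\<Union>i\<in>I. Z i) * measure M' C"
    using I Z by (subst measure_UNION') (auto simp: sum_distrib_right disjoint_family_on_def pairwise_def disjnt_def)
  ultimately show ?thesis by (simp add: ext_law_def)
qed

text \<open>Convergence for an inner approximation C1 says nothing about the correlations with C -
  C1. \<open>uniform_smallness\<close> bounds their averages through the measure of C - C1 alone;
  the left set enters only by being contained in \<open>lift G\<close>.\<close>

lemma ext_law_approx_right:
  assumes B: "B \<in> sets M'" "B \<subseteq> lift G" and C: "C \<in> sets M'" "C \<subseteq> lift G" and f: "f \<in> borel_measurable M'"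
    and approx: "\<And>d. 0 < d \<Longrightarrow> \<exists>C1\<in>sets M'. C1 \<subseteq> C \<and> measure M' C - measure M' C1 \<le> d \<and> ext_law B C1 f"
  shows "ext_law B C f"
  unfolding ext_law_def
proof (rule avg_law_approx)
  have Bf: "B \<in> fmeasurable M'" and Cf: "C \<in> fmeasurable M'" using lift_G B C fmeasurableI2 by blast+
  show "integrable M' (wt B C n)" "(\<lambda>x. birkhoff_sum T' f n x / a n) \<in> borel_measurable M'" for n
    by (rule wt_integrable[OF Bf C(1)], rule esum_measurable[OF f])
  fix e :: real assume e: "0 < e"
  obtain d where d: "0 < d" "\<And>E. E \<in> sets M' \<Longrightarrow> E \<subseteq> lift G \<Longrightarrow> measure M' E \<le> d \<Longrightarrow>
      avg_le e (\<lambda>n. \<integral>x. wt (lift G) E n x \<partial>M')" by (rule uniform_smallness[OF e]) blast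
  \<comment> \<open>The first entry controls the correlations with C - C1, the second the change of
    the product of the measures.\<close>
  define d' where "d' = min d (e / (measure M' B + 1))"
  have mB: "0 < measure M' B + 1" by (simp add: add_nonneg_pos)
  then have d': "0 < d'" "d' \<le> d" "measure M' B * d' \<le> e"
  proof -
    have "measure M' B * d' \<le> (measure M' B + 1) * d'" using d e mB by (intro mult_right_mono) (auto simp: d'_def)
    also have "\<dots> \<le> (measure M' B + 1) * (e / (measure M' B + 1))" using mB by (intro mult_left_mono) (auto simp: d'_def)
    also have "\<dots> = e" using mB by simp
    finally show "measure M' B * d' \<le> e" .
  qed (use d e mB in \<open>auto simp: d'_def\<close>)
  obtain C1 where C1: "C1 \<in> sets M'" "C1 \<subseteq> C" "measure M' C - measure M' C1 \<le> d'" "ext_law B C1 f"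
    using approx[OF d'(1)] by blast
  have C1f: "C1 \<in> fmeasurable M'" using Cf C1 fmeasurableI2 by blast
  have mono: "measure M' C1 \<le> measure M' C" by (rule measure_mono_fmeasurable[OF C1(2,1) Cf])
  have "measure M' (C - C1) = measure M' C - measure M' C1"
    by (rule measurable_measure_Diff[OF Cf C1(1,2)])
  then have small: "avg_le e (\<lambda>n. \<integral>x. wt (lift G) (C - C1) n x \<partial>M')"
    using d'(2) C1 C by (intro d(2)) auto
  have "avg_le e (\<lambda>n. \<integral>x. \<bar>wt B C n x - wt B C1 n x\<bar> \<partial>M')"
  proof (rule avg_le_mono[OF small order_refl])
    fix n
    have "(\<integral>x. \<bar>wt B C n x - wt B C1 n x\<bar> \<partial>M') \<le> (\<integral>x. wt (lift G) (C - C1) n x \<partial>M')"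
    proof (rule integral_mono)
      show "integrable M' (wt (lift G) (C - C1) n)" using wt_integrable[OF lift_G] C C1 by auto
      show "\<bar>wt B C n x - wt B C1 n x\<bar> \<le> wt (lift G) (C - C1) n x" for x
        using B(2) C1(2) by (auto simp: wt_def indicator_def)
    qed (use wt_integrable[OF Bf] C C1 in auto)
    then show "\<bar>\<integral>x. \<bar>wt B C n x - wt B C1 n x\<bar> \<partial>M'\<bar> \<le> \<bar>\<integral>x. wt (lift G) (C - C1) n x \<partial>M'\<bar>" by simp
  qed
  moreover have "\<bar>measure M' B * measure M' C1 - measure M' B * measure M' C\<bar> \<le> e"
  proof -
    have "\<bar>measure M' B * measure M' C1 - measure M' B * measure M' C\<bar> = measure M' B * (measure M' C - measure M' C1)"
      using mono by (simp add: right_diff_distrib[symmetric] abs_mult)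
    also have "\<dots> \<le> measure M' B * d'" using C1(3) by (rule mult_left_mono) simp
    finally show ?thesis using d'(3) by simp
  qed
  moreover have "avg_le e (\<lambda>n. 0)" using avg_null_zero e by (rule avg_null_le)
  ultimately show "\<exists>D' \<phi>' c' w'.
      (\<forall>n. integrable M' (D' n)) \<and> (\<forall>n. \<forall>x\<in>space M'. 0 \<le> D' n x) \<and> (\<forall>n. \<phi>' n \<in> borel_measurable M') \<and>
      avg_law M' D' \<phi>' c' w' \<and> \<bar>c' - measure M' B * measure M' C\<bar> \<le> e \<and> \<bar>w' - (\<integral>x. f x \<partial>M')\<bar> \<le> e \<and>
      avg_le e (\<lambda>n. \<integral>x. \<bar>wt B C n x - D' n x\<bar> \<partial>M') \<and>
      avg_le e (\<lambda>n. \<integral>x. D' n x * indicator {x. e < \<bar>birkhoff_sum T' f n x / a n - \<phi>' n x\<bar>} x \<partial>M')"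
    using C1(4)[unfolded ext_law_def] wt_integrable[OF Bf C1(1)] esum_measurable[OF f] e
    by (intro exI[of _ "wt B C1"] exI[of _ "\<lambda>n x. birkhoff_sum T' f n x / a n"]
        exI[of _ "measure M' B * measure M' C1"] exI[of _ "\<integral>x. f x \<partial>M'"]) (auto simp: wt_nonneg)
qed

text \<open>Finite unions follow by additivity, and continuity from below makes the remainder small
  in measure, which is all that \<open>ext_law_approx_right\<close> requires.\<close>

lemma ext_law_countable_UN:
  assumes B: "B \<in> sets M'" "B \<subseteq> lift G" and C: "C \<in> sets M'" "C \<subseteq> lift G" and f: "f \<in> borel_measurable M'"
    and Z: "\<And>i. Z i \<in> sets M'" "\<And>i. Z i \<subseteq> C" "disjoint_family Z" and AE: "AE x in M'. x \<in> C \<longrightarrow> (\<exists>i::nat. x \<in> Z i)"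
    and law: "\<And>i. ext_law B (Z i) f"
  shows "ext_law B C f"
proof (rule ext_law_approx_right[OF B C f])
  have Bf: "B \<in> fmeasurable M'" and Cf: "C \<in> fmeasurable M'" using lift_G B C fmeasurableI2 by blast+
  have Zf: "Z i \<in> fmeasurable M'" for i using Cf Z fmeasurableI2 by blast
  fix d :: real assume d: "0 < d"
  have mC: "measure M' (\<Union>i. Z i) = measure M' C"
    by (rule measure_eq_AE) (use AE Z C in \<open>auto elim!: eventually_mono\<close>)
  have eq: "(\<Union>N. \<Union>i<N. Z i) = (\<Union>i. Z i)" by auto
  have sub: "(\<Union>i. Z i) \<subseteq> C" using Z(2) by auto
  have "(\<Union>i. Z i) \<in> fmeasurable M'" by (rule fmeasurableI2[OF Cf sub]) (use Z in auto)
  then have "(\<lambda>N. measure M' (\<Union>i<N. Z i)) \<longlonglongrightarrow> measure M' (\<Union>N. \<Union>i<N. Z i)"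
    using Z(1) unfolding eq[symmetric]
    by (intro Lim_measure_incseq incseq_SucI UN_mono) (auto simp: fmeasurable_def)
  then have "(\<lambda>N. measure M' (\<Union>i<N. Z i)) \<longlonglongrightarrow> measure M' C" unfolding eq mC .
  then have "\<forall>\<^sub>F N in sequentially. measure M' C - d < measure M' (\<Union>i<N. Z i)"
    using d by (intro order_tendstoD(1)) auto
  then obtain N where N: "measure M' C - d < measure M' (\<Union>i<N. Z i)" by (auto simp: eventually_sequentially)
  have "ext_law B (\<Union>i<N. Z i) f"
    by (rule ext_law_UN_right[OF Bf _ _ Zf f law]) (use Z(3) in \<open>auto simp: disjoint_family_on_def\<close>)
  then show "\<exists>C1\<in>sets M'. C1 \<subseteq> C \<and> measure M' C - measure M' C1 \<le> d \<and> ext_law B C1 f"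
    using N Z by (intro bexI[of _ "\<Union>i<N. Z i"]) auto
qed

lemma past_funpow_coord: "((past ^^ n) x) k = x (n + k)"
proof (induction n arbitrary: x)
  case (Suc n)
  have "((past ^^ Suc n) x) k = ((past ^^ n) (past x)) k" by (simp only: funpow_Suc_right comp_apply)
  also have "\<dots> = x (Suc n + k)" unfolding Suc by (simp add: past_def)
  finally show ?case .
qed simp

text \<open>The coordinates of a point are the base points of its backward orbit, and the inverse
  map is conservative together with T'.\<close>

lemma past_recurrence: "AE x in M'. x 0 \<in> G \<longrightarrow> (\<exists>\<^sub>\<infinity>n. x n \<in> G)"
proof -
  have "emeasure M G < \<infinity>" "emeasure M G > 0"
    using G G_pos by (auto simp: fmeasurable_def measure_def enn2real_positive_iff)
  then have "conservative M' past" by (intro past_conservative ext_conservative[OF cons erg G_sets])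
  from conservative_recurrence[OF past_mpt this lift_G_sets] AE_space show ?thesis
    by eventually_elim (simp add: lift_def past_funpow_coord mpt_funpow_space[OF past_mpt])
qed

end

context natural_extension
begin

subsection \<open>Approximation by functions of one coordinate\<close>

text \<open>Localization to \<open>Z\<close> keeps all differences of finite measure while the
  induction passes through complements and countable unions.\<close>

lemma coord_set_approx:
  assumes Z: "Z \<in> fmeasurable M'" and A: "A \<in> sets M'" and e: "0 < e"
  shows "\<exists>k. \<exists>A0\<in>sets M. measure M' (Z \<inter> sym_diff A {x \<in> space M'. x k \<in> A0}) \<le> e"
  using A e unfolding sets_ext_generated
proof (induction A arbitrary: e rule: sigma_sets.induct)
  case (Basic A)
  then obtain k A0 where "A0 \<in> sets M" "A = {x \<in> space M'. x k \<in> A0}" by (auto simp: coord_sets_def)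
  then show ?case using Basic by (intro exI[of _ k] bexI[of _ A0]) auto
next
  case Empty
  then show ?case by (intro exI[of _ 0] bexI[of _ "{}"]) auto
next
  case (Compl A)
  obtain k A0 where A0: "A0 \<in> sets M" "measure M' (Z \<inter> sym_diff A {x \<in> space M'. x k \<in> A0}) \<le> e"
    using Compl.IH[OF Compl.prems] by blast
  have "A \<subseteq> space M'" using Compl.hyps sets.sets_into_space unfolding sets_ext_generated[symmetric] by auto
  then have "sym_diff (space M' - A) {x \<in> space M'. x k \<in> space M - A0} = sym_diff A {x \<in> space M'. x k \<in> A0}"
    using coord_space by auto
  then show ?case using A0 by (intro exI[of _ k] bexI[of _ "space M - A0"]) auto
next
  case (Union A)
  have A: "A i \<in> sets M'" for i using Union.hyps unfolding sets_ext_generated[symmetric] .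
  have fm: "Z \<inter> E \<in> fmeasurable M'" if "E \<in> sets M'" for E
    by (rule fmeasurableI2[OF Z]) (use Z that in auto)
  have meas: "sym_diff E {x \<in> space M'. x k \<in> A0} \<in> sets M'" if "E \<in> sets M'" "A0 \<in> sets M" for E k A0
    using that coord_vimage_sets by auto
  have fin: "\<exists>k. \<exists>A0\<in>sets M. measure M' (Z \<inter> sym_diff (\<Union>i<N. A i) {x \<in> space M'. x k \<in> A0}) \<le> e" if "0 < e" for N e
    using that
  proof (induction N arbitrary: e)
    case 0
    then show ?case by (intro exI[of _ 0] bexI[of _ "{}"]) auto
  next
    case (Suc N)
    obtain k A0 where A0: "A0 \<in> sets M" "measure M' (Z \<inter> sym_diff (\<Union>i<N. A i) {x \<in> space M'. x k \<in> A0}) \<le> e/2"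
      using Suc.IH[of "e/2"] Suc.prems by auto
    obtain l B0 where B0: "B0 \<in> sets M" "measure M' (Z \<inter> sym_diff (A N) {x \<in> space M'. x l \<in> B0}) \<le> e/2"
      using Union.IH[of "e/2" N] Suc.prems by auto
    \<comment> \<open>Both conditions are read at the common coordinate k + l.\<close>
    define C0 where "C0 = ((T ^^ l) -` A0 \<inter> space M) \<union> ((T ^^ k) -` B0 \<inter> space M)"
    have C0: "C0 \<in> sets M" unfolding C0_def
      using A0 B0 measurable_sets[OF mpt_funpow_measurable[OF base_mpt]] by auto
    have C0_eq: "{x \<in> space M'. x (k + l) \<in> C0} = {x \<in> space M'. x k \<in> A0} \<union> {x \<in> space M'. x l \<in> B0}"
      unfolding coord_set_shift[of k A0 l] coord_set_shift[of l B0 k] C0_def by (auto simp: add.commute)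
    let ?E1 = "Z \<inter> sym_diff (\<Union>i<N. A i) {x \<in> space M'. x k \<in> A0}" and ?E2 = "Z \<inter> sym_diff (A N) {x \<in> space M'. x l \<in> B0}"
    have m1: "?E1 \<in> fmeasurable M'" "?E2 \<in> fmeasurable M'"
      by (rule fm[OF meas], use A A0 B0 in auto)+
    have "measure M' (Z \<inter> sym_diff (\<Union>i<Suc N. A i) {x \<in> space M'. x (k + l) \<in> C0}) \<le> measure M' (?E1 \<union> ?E2)"
    proof (rule measure_mono_fmeasurable)
      show "Z \<inter> sym_diff (\<Union>i<Suc N. A i) {x \<in> space M'. x (k + l) \<in> C0} \<subseteq> ?E1 \<union> ?E2"
        unfolding C0_eq lessThan_Suc by blast
      show "Z \<inter> sym_diff (\<Union>i<Suc N. A i) {x \<in> space M'. x (k + l) \<in> C0} \<in> sets M'"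
        using fm[OF meas[OF _ C0, of "\<Union>i<Suc N. A i"]] A by auto
    qed (use m1 in auto)
    also have "\<dots> \<le> measure M' ?E1 + measure M' ?E2" using m1 by (intro measure_Un_le) auto
    also have "\<dots> \<le> e" using A0(2) B0(2) by simp
    finally show ?case using C0 by blast
  qed
  have "(\<lambda>N. measure M' (Z \<inter> (\<Union>i<N. A i))) \<longlonglongrightarrow> measure M' (\<Union>N. Z \<inter> (\<Union>i<N. A i))"
  proof (rule Lim_measure_incseq)
    have "(\<Union>N. Z \<inter> (\<Union>i<N. A i)) = Z \<inter> (\<Union>i. A i)" by auto
    then show "emeasure M' (\<Union>N. Z \<inter> (\<Union>i<N. A i)) \<noteq> \<infinity>" using fm[of "\<Union>i. A i"] A by (auto simp: fmeasurable_def)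
    show "incseq (\<lambda>N. Z \<inter> (\<Union>i<N. A i))" by (intro incseq_SucI Int_mono UN_mono) auto
    show "range (\<lambda>N. Z \<inter> (\<Union>i<N. A i)) \<subseteq> sets M'"
    proof (rule image_subsetI)
      fix N
      have "(\<Union>i<N. A i) \<in> sets M'" using A by (intro sets.finite_UN) auto
      then show "Z \<inter> (\<Union>i<N. A i) \<in> sets M'" by (rule fmeasurableD[OF fm])
    qed
  qed
  moreover have "(\<Union>N. Z \<inter> (\<Union>i<N. A i)) = Z \<inter> (\<Union>i. A i)" by auto
  ultimately have "(\<lambda>N. measure M' (Z \<inter> (\<Union>i<N. A i))) \<longlonglongrightarrow> measure M' (Z \<inter> (\<Union>i. A i))" by simp
  then have "\<forall>\<^sub>F N in sequentially. measure M' (Z \<inter> (\<Union>i. A i)) - e/2 < measure M' (Z \<inter> (\<Union>i<N. A i))"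
    using Union.prems by (intro order_tendstoD(1)) auto
  then obtain N where N: "measure M' (Z \<inter> (\<Union>i. A i)) - e/2 < measure M' (Z \<inter> (\<Union>i<N. A i))"
    by (auto simp: eventually_sequentially)
  obtain k A0 where A0: "A0 \<in> sets M" "measure M' (Z \<inter> sym_diff (\<Union>i<N. A i) {x \<in> space M'. x k \<in> A0}) \<le> e/2"
    using fin[of "e/2" N] Union.prems by auto
  let ?E1 = "Z \<inter> (\<Union>i. A i) - Z \<inter> (\<Union>i<N. A i)" and ?E2 = "Z \<inter> sym_diff (\<Union>i<N. A i) {x \<in> space M'. x k \<in> A0}"
  have "measure M' ?E1 = measure M' (Z \<inter> (\<Union>i. A i)) - measure M' (Z \<inter> (\<Union>i<N. A i))"
  proof (rule measurable_measure_Diff)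
    show "Z \<inter> (\<Union>i. A i) \<in> fmeasurable M'" using A by (intro fm sets.countable_UN) auto
    show "Z \<inter> (\<Union>i<N. A i) \<in> sets M'" using A by (intro fmeasurableD[OF fm] sets.finite_UN) auto
  qed auto
  then have E1: "measure M' ?E1 \<le> e/2" using N by simp
  have E12: "?E1 \<in> fmeasurable M'" "?E2 \<in> fmeasurable M'"
    using A A0 by (auto intro!: fmeasurable.Diff fm meas)
  have "measure M' (Z \<inter> sym_diff (\<Union>i. A i) {x \<in> space M'. x k \<in> A0}) \<le> measure M' (?E1 \<union> ?E2)"
  proof (rule measure_mono_fmeasurable)
    show "Z \<inter> sym_diff (\<Union>i. A i) {x \<in> space M'. x k \<in> A0} \<subseteq> ?E1 \<union> ?E2" by blast
    show "Z \<inter> sym_diff (\<Union>i. A i) {x \<in> space M'. x k \<in> A0} \<in> sets M'"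
      using fm[OF meas[OF _ A0(1), of "\<Union>i. A i"]] A by auto
  qed (use E12 in auto)
  also have "\<dots> \<le> measure M' ?E1 + measure M' ?E2" using E12 by (intro measure_Un_le) auto
  also have "\<dots> \<le> e" using E1 A0(2) by simp
  finally show ?case using A0(1) by blast
qed

lemma coord_set_approx_finite:
  assumes A: "A \<in> fmeasurable M'" and e: "0 < e"
  shows "\<exists>k. \<exists>A0\<in>fmeasurable M. measure M' (sym_diff A {x \<in> space M'. x k \<in> A0}) \<le> e"
proof -
  interpret sigma_finite_measure M using base_mpt by (simp add: mpt_def)
  obtain F :: "nat \<Rightarrow> 'a set" where F: "range F \<subseteq> sets M" "(\<Union>i. F i) = space M" "\<And>i. emeasure M (F i) \<noteq> \<infinity>" "incseq F"
    using sigma_finite_incseq by blast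
  have F_fm: "F i \<in> fmeasurable M" for i using F by (auto simp: fmeasurable_def less_top)
  have As: "A \<in> sets M'" using A by auto
  have Al: "A \<inter> lift (F i) \<in> fmeasurable M'" for i
    by (rule fmeasurableI2[OF A]) (use As lift_sets F in auto)
  have eq: "(\<Union>i. A \<inter> lift (F i)) = A"
    using sets.sets_into_space[OF As] F(2) coord_space[of _ 0] unfolding lift_def by blast
  have "(\<lambda>i. measure M' (A \<inter> lift (F i))) \<longlonglongrightarrow> measure M' (\<Union>i. A \<inter> lift (F i))"
  proof (rule Lim_measure_incseq)
    show "emeasure M' (\<Union>i. A \<inter> lift (F i)) \<noteq> \<infinity>" unfolding eq using A by (auto simp: fmeasurable_def)
    show "incseq (\<lambda>i. A \<inter> lift (F i))"
      by (rule incseq_SucI) (use incseq_SucD[OF F(4)] in \<open>auto simp: lift_def\<close>)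
  qed (use Al in auto)
  then have "\<forall>\<^sub>F i in sequentially. measure M' A - e/2 < measure M' (A \<inter> lift (F i))"
    unfolding eq using e by (intro order_tendstoD(1)) auto
  then obtain i where i: "measure M' A - e/2 < measure M' (A \<inter> lift (F i))" by (auto simp: eventually_sequentially)
  let ?Z = "lift (F i)"
  have Z: "?Z \<in> fmeasurable M'" by (rule lift_fmeasurable[OF F_fm])
  obtain k A0 where A0: "A0 \<in> sets M" "measure M' (?Z \<inter> sym_diff A {x \<in> space M'. x k \<in> A0}) \<le> e/2"
    using coord_set_approx[OF Z As, of "e/2"] e by auto
  \<comment> \<open>The condition that the coordinate 0 lies in \<open>F i\<close>, read at the
    coordinate k, gives the approximating set finite measure.\<close>
  define B where "B = A0 \<inter> ((T ^^ k) -` F i \<inter> space M)"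
  have "(T ^^ k) -` F i \<inter> space M \<in> fmeasurable M"
    using F_fm mpt_emeasure_vimage[OF base_mpt, of "F i" k] measurable_sets[OF mpt_funpow_measurable[OF base_mpt], of "F i" k]
    by (auto simp: fmeasurable_def)
  then have B: "B \<in> fmeasurable M" unfolding B_def using A0(1) by (metis fmeasurable_Int_fmeasurable inf_commute)
  have B_eq: "{x \<in> space M'. x k \<in> B} = {x \<in> space M'. x k \<in> A0} \<inter> ?Z"
    using coord_funpow[of _ k 0] coord_space by (auto simp: B_def lift_def)
  let ?E1 = "A - A \<inter> ?Z" and ?E2 = "?Z \<inter> sym_diff A {x \<in> space M'. x k \<in> A0}"
  have E12: "?E1 \<in> fmeasurable M'" "?E2 \<in> fmeasurable M'"
    using A Al Z As coord_vimage_sets[OF A0(1), of k] by (auto intro!: fmeasurable.Diff fmeasurable_Int_fmeasurable)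
  have "measure M' ?E1 = measure M' A - measure M' (A \<inter> ?Z)"
    using A Al by (intro measurable_measure_Diff) auto
  then have E1: "measure M' ?E1 \<le> e/2" using i by simp
  have Bs: "{x \<in> space M'. x k \<in> B} \<in> sets M'" using coord_vimage_sets B by auto
  have "measure M' (sym_diff A {x \<in> space M'. x k \<in> B}) \<le> measure M' (?E1 \<union> ?E2)"
  proof (rule measure_mono_fmeasurable)
    show "sym_diff A {x \<in> space M'. x k \<in> B} \<subseteq> ?E1 \<union> ?E2" unfolding B_eq by blast
  qed (use E12 As Bs in auto)
  also have "\<dots> \<le> measure M' ?E1 + measure M' ?E2" using E12 by (intro measure_Un_le) auto
  also have "\<dots> \<le> e" using E1 A0(2) by simp
  finally show ?thesis using B by blast
qed

text \<open>Boundedness is part of the claim because moving a function from one coordinate to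
  another changes its sums by single values, which must vanish after division by a(n).\<close>

lemma coord_L1_approx:
  assumes "integrable M' (f :: _ \<Rightarrow> real)" "0 < e"
  shows "\<exists>k h K. integrable M h \<and> (\<forall>x\<in>space M. \<bar>h x\<bar> \<le> K) \<and> (\<integral>x. \<bar>f x - h (x k)\<bar> \<partial>M') \<le> e"
  using assms
proof (induction f arbitrary: e rule: integrable_induct)
  case (base A c)
  have A: "A \<in> fmeasurable M'" using base by (auto simp: fmeasurable_def)
  have c: "0 < \<bar>c\<bar> + 1" by simp
  obtain k A0 where A0: "A0 \<in> fmeasurable M" "measure M' (sym_diff A {x \<in> space M'. x k \<in> A0}) \<le> e / (\<bar>c\<bar> + 1)"
    using coord_set_approx_finite[OF A, of "e / (\<bar>c\<bar> + 1)"] base c by auto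
  let ?E = "sym_diff A {x \<in> space M'. x k \<in> A0}"
  have "{x \<in> space M'. x k \<in> A0} \<in> fmeasurable M'"
    using A0(1) coord_vimage_sets emeasure_coord_vimage by (auto simp: fmeasurable_def)
  then have E: "?E \<in> fmeasurable M'" using A by auto
  have iA0: "integrable M (\<lambda>x. c * indicator A0 x)" using A0 by (auto simp: fmeasurable_def)
  have iA: "integrable M' (\<lambda>x. indicator A x *\<^sub>R c)" using A by (auto simp: fmeasurable_def)
  have iE: "integrable M' (\<lambda>x. indicator ?E x :: real)" using E by (simp add: fmeasurable_def)
  have "(\<integral>x. \<bar>indicator A x *\<^sub>R c - c * indicator A0 (x k)\<bar> \<partial>M') \<le> (\<integral>x. \<bar>c\<bar> * indicator ?E x \<partial>M')"
  proof (rule integral_mono)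
    show "integrable M' (\<lambda>x. \<bar>indicator A x *\<^sub>R c - c * indicator A0 (x k)\<bar>)"
      using iA integrable_coord[OF iA0, of k] by auto
    show "integrable M' (\<lambda>x. \<bar>c\<bar> * indicator ?E x)" using iE by (rule integrable_mult_right)
    show "\<bar>indicator A x *\<^sub>R c - c * indicator A0 (x k)\<bar> \<le> \<bar>c\<bar> * indicator ?E x" if "x \<in> space M'" for x
      using that by (auto simp: indicator_def)
  qed
  also have "\<dots> = \<bar>c\<bar> * measure M' ?E"
  proof -
    have "?E \<subseteq> space M'" using E sets.sets_into_space by blast
    then show ?thesis by (simp add: Int_absorb2)
  qed
  also have "\<dots> \<le> (\<bar>c\<bar> + 1) * (e / (\<bar>c\<bar> + 1))" using A0(2) by (intro mult_mono) auto
  also have "\<dots> = e" using c by simp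
  finally have "(\<integral>x. \<bar>indicator A x *\<^sub>R c - c * indicator A0 (x k)\<bar> \<partial>M') \<le> e" .
  moreover have "\<forall>x\<in>space M. \<bar>c * indicator A0 x\<bar> \<le> \<bar>c\<bar>" by (auto simp: indicator_def)
  ultimately show ?case using iA0 by (intro exI[of _ k] exI[of _ "\<lambda>x. c * indicator A0 x"] exI[of _ "\<bar>c\<bar>"]) auto
next
  case (add f g)
  obtain k h K where h: "integrable M h" "\<And>x. x \<in> space M \<Longrightarrow> \<bar>h x\<bar> \<le> K" "(\<integral>x. \<bar>f x - h (x k)\<bar> \<partial>M') \<le> e/2"
    using add.IH(1)[of "e/2"] add.prems by auto
  obtain l h' K' where h': "integrable M h'" "\<And>x. x \<in> space M \<Longrightarrow> \<bar>h' x\<bar> \<le> K'" "(\<integral>x. \<bar>g x - h' (x l)\<bar> \<partial>M') \<le> e/2"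
    using add.IH(2)[of "e/2"] add.prems by auto
  \<comment> \<open>The two approximants are read at the common coordinate k + l, so that their sum
    again depends on one coordinate.\<close>
  define H where "H y = h ((T ^^ l) y) + h' ((T ^^ k) y)" for y
  have H: "integrable M H" unfolding H_def using mpt_integrable[OF base_mpt] h h' by auto
  have Hb: "\<bar>H y\<bar> \<le> K + K'" if "y \<in> space M" for y
    using h(2)[OF mpt_funpow_space[OF base_mpt that], of l] h'(2)[OF mpt_funpow_space[OF base_mpt that], of k]
    unfolding H_def by linarith
  have H_eq: "H (x (k + l)) = h (x k) + h' (x l)" if "x \<in> space M'" for x
    using coord_funpow[OF that, of l k] coord_funpow[OF that, of k l] by (simp add: H_def add.commute)
  have "(\<integral>x. \<bar>f x + g x - H (x (k + l))\<bar> \<partial>M') \<le> (\<integral>x. \<bar>f x - h (x k)\<bar> + \<bar>g x - h' (x l)\<bar> \<partial>M')"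
    by (rule integral_mono) (use integrable_coord[OF H] integrable_coord[OF h(1)] integrable_coord[OF h'(1)] add.hyps in \<open>auto simp: H_eq\<close>)
  also have "\<dots> = (\<integral>x. \<bar>f x - h (x k)\<bar> \<partial>M') + (\<integral>x. \<bar>g x - h' (x l)\<bar> \<partial>M')"
    using integrable_coord[OF h(1)] integrable_coord[OF h'(1)] add.hyps by (intro Bochner_Integration.integral_add) auto
  also have "\<dots> \<le> e" using h(3) h'(3) by simp
  finally show ?case using H Hb by blast
next
  case (lim f s)
  have "(\<lambda>i. \<integral>x. \<bar>f x - s i x\<bar> \<partial>M') \<longlonglongrightarrow> (\<integral>x. 0 \<partial>M')"
  \<comment> \<open>The approximating functions satisfy |s i| \<le> 2 |f|, whence the dominating
    function 3 |f|.\<close>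
  proof (rule integral_dominated_convergence[where w="\<lambda>x. 3 * norm (f x)"])
    show "AE x in M'. (\<lambda>i. \<bar>f x - s i x\<bar>) \<longlonglongrightarrow> 0"
    proof (rule AE_I2)
      fix x assume "x \<in> space M'"
      then have "(\<lambda>i. f x - s i x) \<longlonglongrightarrow> f x - f x" using lim by (intro tendsto_intros) auto
      then show "(\<lambda>i. \<bar>f x - s i x\<bar>) \<longlonglongrightarrow> 0" by (simp add: tendsto_rabs_zero)
    qed
    show "AE x in M'. norm \<bar>f x - s i x\<bar> \<le> 3 * norm (f x)" for i
    proof (rule AE_I2)
      fix x assume "x \<in> space M'"
      then have "norm (s i x) \<le> 2 * norm (f x)" using lim by auto
      then show "norm \<bar>f x - s i x\<bar> \<le> 3 * norm (f x)" by simp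
    qed
  qed (use lim in auto)
  then have "\<forall>\<^sub>F i in sequentially. (\<integral>x. \<bar>f x - s i x\<bar> \<partial>M') < e/2"
    using lim.prems by (intro order_tendstoD(2)[where y=0]) auto
  then obtain i where i: "(\<integral>x. \<bar>f x - s i x\<bar> \<partial>M') < e/2" by (auto simp: eventually_sequentially)
  obtain k h K where h: "integrable M h" "\<And>x. x \<in> space M \<Longrightarrow> \<bar>h x\<bar> \<le> K" "(\<integral>x. \<bar>s i x - h (x k)\<bar> \<partial>M') \<le> e/2"
    using lim.IH[of "e/2" i] lim.prems by auto
  have "(\<integral>x. \<bar>f x - h (x k)\<bar> \<partial>M') \<le> (\<integral>x. \<bar>f x - s i x\<bar> + \<bar>s i x - h (x k)\<bar> \<partial>M')"
    by (rule integral_mono) (use integrable_coord[OF h(1)] lim.hyps in auto)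
  also have "\<dots> = (\<integral>x. \<bar>f x - s i x\<bar> \<partial>M') + (\<integral>x. \<bar>s i x - h (x k)\<bar> \<partial>M')"
    using integrable_coord[OF h(1)] lim.hyps by (intro Bochner_Integration.integral_add) auto
  also have "\<dots> \<le> e" using h(3) i by simp
  finally show ?case using h by blast
qed

text \<open>Cutting an approximant off at 0 does not increase its distance to a nonnegative
  function.\<close>

lemma coord_L1_approx_nonneg:
  fixes f :: "(nat \<Rightarrow> 'a) \<Rightarrow> real"
  assumes f: "integrable M' f" "\<And>x. x \<in> space M' \<Longrightarrow> 0 \<le> f x" and e: "0 < e"
  shows "\<exists>k h K. integrable M h \<and> (\<forall>x\<in>space M. 0 \<le> h x) \<and> (\<forall>x\<in>space M. \<bar>h x\<bar> \<le> K) \<and>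
    0 \<le> K \<and> (\<integral>x. \<bar>f x - h (x k)\<bar> \<partial>M') \<le> e"
proof -
  obtain k h K where h: "integrable M h" "\<And>x. x \<in> space M \<Longrightarrow> \<bar>h x\<bar> \<le> K" "(\<integral>x. \<bar>f x - h (x k)\<bar> \<partial>M') \<le> e"
    using coord_L1_approx[OF f(1) e] by blast
  define h' where "h' x = max 0 (h x)" for x
  have h'_int: "integrable M h'" unfolding h'_def using h(1) by (intro integrable_max) auto
  have "(\<integral>x. \<bar>f x - h' (x k)\<bar> \<partial>M') \<le> (\<integral>x. \<bar>f x - h (x k)\<bar> \<partial>M')"
  proof (rule integral_mono)
    show "\<bar>f x - h' (x k)\<bar> \<le> \<bar>f x - h (x k)\<bar>" if "x \<in> space M'" for x
      using f(2)[OF that] by (simp add: h'_def max_def abs_if)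
  qed (use f(1) integrable_coord[OF h(1)] integrable_coord[OF h'_int] in auto)
  then have "(\<integral>x. \<bar>f x - h' (x k)\<bar> \<partial>M') \<le> e" using h(3) by simp
  moreover have "\<bar>h' x\<bar> \<le> max 0 K" if "x \<in> space M" for x
    using h(2)[OF that] by (auto simp: h'_def max_def)
  moreover have "0 \<le> h' x" for x by (simp add: h'_def)
  ultimately show ?thesis using h'_int by (intro exI[of _ k] exI[of _ h'] exI[of _ "max 0 K"]) auto
qed

end

context renewal_extension
begin

subsection \<open>Arbitrary sets\<close>

text \<open>\<open>Z i\<close> collects the points whose last visit to \<open>G\<close> at or before
  time -k happens at time -(k + i). Seen from that visit, that is, after pulling back by T'^(k+i),
  the set depends on the coordinate 0 only and lies over \<open>G\<close>, so the law for lifted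
  right sets applies. Recurrence of the past makes the pieces cover almost everything.\<close>

lemma ext_law_coord_set:
  assumes B: "B \<in> sets M'" "B \<subseteq> lift G" and A: "A \<in> sets M"
    and f: "integrable M f" "\<And>x. x \<in> space M \<Longrightarrow> 0 \<le> f x" and K: "0 \<le> K" "\<And>x. x \<in> space M \<Longrightarrow> \<bar>f x\<bar> \<le> K"
  shows "ext_law B ({x \<in> space M'. x k \<in> A} \<inter> lift G) (\<lambda>x. f (x 0))"
proof -
  note [measurable] = mpt_funpow_measurable[OF base_mpt] measurable_coord A G_sets
  have Bf: "B \<in> fmeasurable M'" using lift_G B fmeasurableI2 by blast
  have fm: "(\<lambda>x. f (x 0)) \<in> borel_measurable M'" using integrable_coord[OF f(1)] by auto
  define Z where "Z i = {x \<in> space M'. x k \<in> A \<and> x 0 \<in> G \<and> x (k + i) \<in> G \<and> (\<forall>l<i. x (k + l) \<notin> G)}" for i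
  \<comment> \<open>\<open>Z i\<close> in terms of the point at time -(k + i), from which the
    coordinate k + l is reached in i - l steps.\<close>
  define C where "C i = {y \<in> space M. (T ^^ i) y \<in> A \<and> (T ^^ (k + i)) y \<in> G \<and> y \<in> G \<and> (\<forall>l<i. (T ^^ (i - l)) y \<notin> G)}" for i
  have Z_sets: "Z i \<in> sets M'" for i unfolding Z_def by measurable
  have C_sets: "C i \<in> sets M" for i unfolding C_def by measurable
  have key: "((T' ^^ m) x) j = (T ^^ (m - j)) (x 0)" if "x \<in> space M'" "j \<le> m" for x j m
  proof -
    have "((T' ^^ m) x) j = (T ^^ ((m - j) + j)) (x j)" using that by (simp add: ext_funpow_coord)
    also have "\<dots> = (T ^^ (m - j)) ((T ^^ j) (x j))" by (simp only: funpow_add comp_apply)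
    also have "(T ^^ j) (x j) = x 0" using coord_funpow[OF that(1), of j 0] by simp
    finally show ?thesis .
  qed
  have pre: "(T' ^^ (k + i)) -` Z i \<inter> space M' = lift (C i)" for i
  proof (rule set_eqI)
    fix x
    show "x \<in> (T' ^^ (k + i)) -` Z i \<inter> space M' \<longleftrightarrow> x \<in> lift (C i)"
    proof (cases "x \<in> space M'")
      case True
      then show ?thesis using ext_funpow_space[OF True, of "k + i"] coord_space[OF True, of 0]
        by (simp add: Z_def C_def lift_def key)
    qed (simp add: lift_def)
  qed
  have K': "\<bar>f (x 0)\<bar> \<le> K" if "x \<in> space M'" for x by (rule K(2)[OF coord_space[OF that]])
  have ZG: "Z i \<subseteq> {x \<in> space M'. x k \<in> A} \<inter> lift G" for i by (auto simp: Z_def lift_def)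
  have Zf: "Z i \<in> fmeasurable M'" for i by (rule fmeasurableI2[OF lift_G _ Z_sets]) (use ZG in auto)
  have law: "ext_law B (Z i) (\<lambda>x. f (x 0))" for i
  proof -
    have "ext_law B (lift (C i)) (\<lambda>x. f (x 0))"
      by (rule ext_law_any_lift[OF B C_sets _ f]) (auto simp: C_def)
    then show ?thesis
      unfolding pre[symmetric]
      by (rule iffD1[OF ext_law_vimage_right[OF Bf Zf fm K(1)], rotated]) (rule K')
  qed
  show ?thesis
  proof (rule ext_law_countable_UN[OF B _ _ fm Z_sets ZG _ _ law])
    show "{x \<in> space M'. x k \<in> A} \<inter> lift G \<in> sets M'" using coord_vimage_sets[OF A] lift_G_sets by auto
    have "x (k + i) \<notin> G" if "x \<in> Z j" "i < j" for x i j using that by (auto simp: Z_def)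
    then have "Z i \<inter> Z j = {}" if "i \<noteq> j" for i j
      using that unfolding neq_iff by (auto simp: Z_def)
    then show "disjoint_family Z" by (auto simp: disjoint_family_on_def)
    show "AE x in M'. x \<in> {x \<in> space M'. x k \<in> A} \<inter> lift G \<longrightarrow> (\<exists>i. x \<in> Z i)"
      using past_recurrence
    proof eventually_elim
      case (elim x)
      show ?case
      proof
        assume x: "x \<in> {x \<in> space M'. x k \<in> A} \<inter> lift G"
        then have "\<exists>\<^sub>\<infinity>n. x n \<in> G" using elim by (simp add: lift_def)
        then obtain n where n: "k < n" "x n \<in> G" unfolding INFM_nat by blast
        then have ex: "x (k + (n - k)) \<in> G" by simp
        define i where "i = (LEAST i. x (k + i) \<in> G)"
        have "x (k + i) \<in> G" unfolding i_def by (rule LeastI[of "\<lambda>i. x (k + i) \<in> G", OF ex])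
        moreover have "\<forall>l<i. x (k + l) \<notin> G" unfolding i_def using not_less_Least by blast
        ultimately have "x \<in> Z i" using x by (auto simp: Z_def lift_def)
        then show "\<exists>i. x \<in> Z i" by blast
      qed
    qed
  qed auto
qed

text \<open>Dynkin's argument with the one-coordinate sets as \<pi>-system. Every set is intersected
  with \<open>lift G\<close>, so that complements become differences from a set with known law and
  disjoint countable unions fall under \<open>ext_law_countable_UN\<close>.\<close>

lemma ext_law_G:
  assumes B: "B \<in> sets M'" "B \<subseteq> lift G" and C: "C \<in> sets M'" "C \<subseteq> lift G"
    and f: "integrable M f" "\<And>x. x \<in> space M \<Longrightarrow> 0 \<le> f x" and K: "0 \<le> K" "\<And>x. x \<in> space M \<Longrightarrow> \<bar>f x\<bar> \<le> K"
  shows "ext_law B C (\<lambda>x. f (x 0))"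
proof -
  have Bf: "B \<in> fmeasurable M'" using lift_G B fmeasurableI2 by blast
  have fm: "(\<lambda>x. f (x 0)) \<in> borel_measurable M'" using integrable_coord[OF f(1)] by auto
  let ?P = "\<lambda>A. ext_law B (A \<inter> lift G) (\<lambda>x. f (x 0))"
  have int_fm: "A \<inter> lift G \<in> fmeasurable M'" if "A \<in> sets M'" for A
    by (rule fmeasurableI2[OF lift_G]) (use that lift_G_sets in auto)
  have whole: "ext_law B (lift G) (\<lambda>x. f (x 0))"
    by (rule ext_law_any_lift[OF B G_sets _ f]) simp
  have coord: "coord_sets \<subseteq> Pow (space M')" by (auto simp: coord_sets_def)
  have "?P C" using Int_stable_coord_sets coord C(1)[unfolded sets_ext_generated]
  proof (induction C rule: sigma_sets_induct_disjoint)
    case (basic A)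
    then show ?case using ext_law_coord_set[OF B _ f K] by (auto simp: coord_sets_def)
  next
    case empty
    have "ext_law B (lift {}) (\<lambda>x. f (x 0))" by (rule ext_law_any_lift[OF B _ _ f]) auto
    then show ?case by (simp add: lift_def)
  next
    case (compl A)
    then have A: "A \<in> sets M'" by (simp add: sets_ext_generated)
    have "avg_law M' (\<lambda>n x. wt B (lift G) n x + (- 1) * wt B (A \<inter> lift G) n x) (\<lambda>n x. birkhoff_sum T' (\<lambda>x. f (x 0)) n x / a n)
        (measure M' B * measure M' (lift G) + (- 1) * (measure M' B * measure M' (A \<inter> lift G))) (\<integral>x. f (x 0) \<partial>M')"
      by (rule avg_law_add[OF whole[unfolded ext_law_def] avg_law_scale[OF compl(2)[unfolded ext_law_def]]])
        (use wt_integrable[OF Bf] lift_G_sets int_fm[OF A] esum_measurable[OF fm] in auto)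
    moreover have "(\<lambda>n x. wt B (lift G) n x + (- 1) * wt B (A \<inter> lift G) n x) = wt B ((space M' - A) \<inter> lift G)"
      by (auto simp: fun_eq_iff wt_def indicator_def lift_def)
    moreover have "measure M' ((space M' - A) \<inter> lift G) = measure M' (lift G) - measure M' (A \<inter> lift G)"
    proof -
      have "(space M' - A) \<inter> lift G = lift G - A \<inter> lift G" by (auto simp: lift_def)
      then show ?thesis using lift_G int_fm[OF A] by (simp add: measurable_measure_Diff)
    qed
    then have "measure M' B * measure M' (lift G) + (- 1) * (measure M' B * measure M' (A \<inter> lift G)) =
        measure M' B * measure M' ((space M' - A) \<inter> lift G)"
      by (simp add: right_diff_distrib)
    ultimately show ?case unfolding ext_law_def by (simp only:)
  next
    case (union A)
    then have A: "A i \<in> sets M'" for i by (auto simp: sets_ext_generated)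
    show ?case
    proof (rule ext_law_countable_UN[OF B _ _ fm, where Z="\<lambda>i. A i \<inter> lift G"])
      show "disjoint_family (\<lambda>i. A i \<inter> lift G)" using union(1) by (auto simp: disjoint_family_on_def)
    qed (use A lift_G_sets union in auto)
  qed
  then show ?thesis using C(2) by (simp add: Int_absorb2)
qed

end

section \<open>Sets whose points visit \<open>G\<close> within a bounded time\<close>

context renewal_extension
begin

text \<open>Defined downstairs so that its indicator is a function of the coordinate 0. The number
  of visits to it will be the yardstick for ergodic sums of arbitrary integrable functions.\<close>

definition visited :: "nat \<Rightarrow> 'a set" where
  "visited r = {y \<in> space M. \<exists>i<r. (T ^^ i) y \<in> G}"

lemma visited_fmeasurable: "visited r \<in> fmeasurable M"
proof -
  have eq: "visited r = (\<Union>i<r. (T ^^ i) -` G \<inter> space M)" by (auto simp: visited_def)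
  have fm: "(T ^^ i) -` G \<inter> space M \<in> fmeasurable M" for i
    using mpt_emeasure_vimage[OF base_mpt G_sets, of i] G measurable_sets[OF mpt_funpow_measurable[OF base_mpt] G_sets]
    by (auto simp: fmeasurable_def)
  show ?thesis unfolding eq by (rule fmeasurable.finite_UN) (auto intro: fm)
qed

lemma lift_visited: "lift (visited r) = {x \<in> space M'. \<exists>i<r. (T' ^^ i) x \<in> lift G}"
  by (auto simp: lift_def visited_def coord_space ext_funpow_coord ext_funpow_space)

text \<open>By invertibility every measurable set is a preimage under T'^i. Its image under T'^i is
  written as a preimage under the inverse map, hence is measurable.\<close>

lemma vimage_of_past:
  assumes B: "B \<in> sets M'" "\<And>x. x \<in> B \<Longrightarrow> (T' ^^ i) x \<in> V"
  obtains B' where "B' \<in> sets M'" "B' \<subseteq> V" "B = (T' ^^ i) -` B' \<inter> space M'"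
proof
  let ?B = "(past ^^ i) -` B \<inter> space M'"
  show "?B \<in> sets M'" by (rule measurable_sets[OF mpt_funpow_measurable[OF past_mpt] B(1)])
  show "?B \<subseteq> V" using B(2) ext_funpow_past by fastforce
  show "B = (T' ^^ i) -` ?B \<inter> space M'"
    using sets.sets_into_space[OF B(1)] by (auto simp: past_funpow_ext ext_funpow_space)
qed

lemma first_visit_partition:
  assumes B: "B \<in> sets M'" "B \<subseteq> lift (visited r)"
  obtains Z where "\<And>i. Z i \<in> sets M'" "\<And>i. Z i \<subseteq> B" "disjoint_family Z" "B = (\<Union>i<r. Z i)"
    "\<And>i x. x \<in> Z i \<Longrightarrow> (T' ^^ i) x \<in> lift G"
proof
  note [measurable] = mpt_funpow_measurable[OF ext_mpt] B(1) lift_G_sets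
  let ?Z = "\<lambda>i. {x \<in> space M'. x \<in> B \<and> (T' ^^ i) x \<in> lift G \<and> (\<forall>l<i. (T' ^^ l) x \<notin> lift G)}"
  show "?Z i \<in> sets M'" for i by measurable
  have "?Z i \<inter> ?Z j = {}" if "i \<noteq> j" for i j using that unfolding neq_iff by auto
  then show "disjoint_family ?Z" by (auto simp: disjoint_family_on_def)
  show "B = (\<Union>i<r. ?Z i)"
  proof
    show "B \<subseteq> (\<Union>i<r. ?Z i)"
    proof
      fix x assume x: "x \<in> B"
      then obtain i where i: "i < r" "(T' ^^ i) x \<in> lift G" using B(2) by (auto simp: lift_visited)
      define j where "j = (LEAST i. (T' ^^ i) x \<in> lift G)"
      have j: "(T' ^^ j) x \<in> lift G" "\<forall>l<j. (T' ^^ l) x \<notin> lift G" "j \<le> i"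
        unfolding j_def using i(2) not_less_Least by (auto intro: LeastI Least_le)
      then show "x \<in> (\<Union>i<r. ?Z i)" using x i(1) sets.sets_into_space[OF B(1)] by (intro UN_I[of j]) auto
    qed
  qed auto
qed auto

text \<open>Cut both sets according to the first visit to \<open>lift G\<close>. A piece with visit
  time i is the preimage under T'^i of a subset of \<open>lift G\<close>, and laws of bounded
  functions survive taking preimages on either side.\<close>

lemma ext_law_visited:
  assumes B: "B \<in> sets M'" "B \<subseteq> lift (visited r)" and C: "C \<in> sets M'" "C \<subseteq> lift (visited r)"
    and f: "integrable M f" "\<And>x. x \<in> space M \<Longrightarrow> 0 \<le> f x" and K: "0 \<le> K" "\<And>x. x \<in> space M \<Longrightarrow> \<bar>f x\<bar> \<le> K"
  shows "ext_law B C (\<lambda>x. f (x 0))"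
proof -
  have fm: "(\<lambda>x. f (x 0)) \<in> borel_measurable M'" using integrable_coord[OF f(1)] by auto
  have K': "\<bar>f (x 0)\<bar> \<le> K" if "x \<in> space M'" for x by (rule K(2)[OF coord_space[OF that]])
  have V: "lift (visited r) \<in> fmeasurable M'" by (rule lift_fmeasurable[OF visited_fmeasurable])
  have Bf: "B \<in> fmeasurable M'" and Cf: "C \<in> fmeasurable M'" using V B C fmeasurableI2 by blast+
  obtain Z where Z: "\<And>i. Z i \<in> sets M'" "\<And>i. Z i \<subseteq> B" "disjoint_family Z" "B = (\<Union>i<r. Z i)"
    "\<And>i x. x \<in> Z i \<Longrightarrow> (T' ^^ i) x \<in> lift G" by (rule first_visit_partition[OF B]) blast
  obtain Y where Y: "\<And>i. Y i \<in> sets M'" "\<And>i. Y i \<subseteq> C" "disjoint_family Y" "C = (\<Union>i<r. Y i)"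
    "\<And>i x. x \<in> Y i \<Longrightarrow> (T' ^^ i) x \<in> lift G" by (rule first_visit_partition[OF C]) blast
  have Zf: "Z i \<in> fmeasurable M'" and Yf: "Y i \<in> fmeasurable M'" for i
    using fmeasurableI2[OF Bf Z(2,1)] fmeasurableI2[OF Cf Y(2,1)] by auto
  have "ext_law (Z i) (Y j) (\<lambda>x. f (x 0))" for i j
  proof -
    obtain B' where B': "B' \<in> sets M'" "B' \<subseteq> lift G" "Z i = (T' ^^ i) -` B' \<inter> space M'"
      by (rule vimage_of_past[OF Z(1,5)]) blast
    obtain C' where C': "C' \<in> sets M'" "C' \<subseteq> lift G" "Y j = (T' ^^ j) -` C' \<inter> space M'"
      by (rule vimage_of_past[OF Y(1,5)]) blast
    have B'f: "B' \<in> fmeasurable M'" and C'f: "C' \<in> fmeasurable M'" using lift_G B' C' fmeasurableI2 by blast+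
    have "ext_law B' C' (\<lambda>x. f (x 0))" by (rule ext_law_G[OF B'(1,2) C'(1,2) f K])
    then have "ext_law (Z i) C' (\<lambda>x. f (x 0))"
      unfolding B'(3) by (rule ext_law_vimage_left[OF B'f C'f fm K(1), rotated]) (rule K')
    then show ?thesis
      unfolding C'(3) by (rule iffD2[OF ext_law_vimage_right[OF Zf C'f fm K(1)], rotated]) (rule K')
  qed
  then have "ext_law (Z i) C (\<lambda>x. f (x 0))" for i
    unfolding Y(4) using Y(3) by (intro ext_law_UN_right Zf Yf fm) (auto simp: disjoint_family_on_def)
  then show ?thesis
    unfolding Z(4) using Z(3) by (intro ext_law_UN_left Zf fm C(1)) (auto simp: disjoint_family_on_def)
qed

lemma ext_law_visited_coord:
  assumes B: "B \<in> sets M'" "B \<subseteq> lift (visited r)" and C: "C \<in> sets M'" "C \<subseteq> lift (visited r)"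
    and f: "integrable M f" "\<And>x. x \<in> space M \<Longrightarrow> 0 \<le> f x" and K: "0 \<le> K" "\<And>x. x \<in> space M \<Longrightarrow> \<bar>f x\<bar> \<le> K"
  shows "ext_law B C (\<lambda>x. f (x k))"
proof (induction k)
  case 0
  show ?case by (rule ext_law_visited[OF assms])
next
  case (Suc k)
  have V: "lift (visited r) \<in> fmeasurable M'" by (rule lift_fmeasurable[OF visited_fmeasurable])
  have Bf: "B \<in> fmeasurable M'" and Cf: "C \<in> fmeasurable M'" using V B C fmeasurableI2 by blast+
  have fm: "(\<lambda>x. f (x (Suc k))) \<in> borel_measurable M'" using integrable_coord[OF f(1)] by auto
  have K': "\<bar>f (x (Suc k))\<bar> \<le> K" if "x \<in> space M'" for x by (rule K(2)[OF coord_space[OF that]])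
  \<comment> \<open>Composition with T' lowers the coordinate by one, so invariance under
    composition carries the law to the next coordinate.\<close>
  have "(\<lambda>x. f (T' x (Suc k))) = (\<lambda>x. f (x k))" by (simp add: nat_ext_map_def)
  then have "ext_law B C (\<lambda>x. f (T' x (Suc k)))" using Suc by simp
  then show ?case by (rule iffD1[OF ext_law_comp[OF Bf Cf fm K(1)], rotated]) (rule K')
qed

subsection \<open>Arbitrary integrable functions\<close>

lemma birkhoff_abs_diff:
  "\<bar>birkhoff_sum T' f n x - birkhoff_sum T' h n x\<bar> \<le> birkhoff_sum T' (\<lambda>x. \<bar>f x - h x\<bar>) n x"
  unfolding birkhoff_sum_def sum_subtractf[symmetric] by (rule sum_abs)

text \<open>Replace \<open>f\<close> by a bounded nonnegative function h of one coordinate. Hopf's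
  inequality for |f - h| relative to V = \<open>lift (visited r)\<close> gives a set of small
  measure outside of which, on V, the ergodic sums of \<open>f\<close> and h differ by at most l
  times the number of visits to V. That number is tight on the scale a(n), and starting points in
  the exceptional set contribute little.\<close>

lemma ext_law_integrable:
  assumes B: "B \<in> sets M'" "B \<subseteq> lift (visited r)" and C: "C \<in> sets M'" "C \<subseteq> lift (visited r)"
    and f: "integrable M' f" "\<And>x. x \<in> space M' \<Longrightarrow> 0 \<le> f x"
  shows "ext_law B C f"
  unfolding ext_law_def
proof (rule avg_law_approx)
  let ?V = "lift (visited r)"
  have Vf: "?V \<in> fmeasurable M'" by (rule lift_fmeasurable[OF visited_fmeasurable])
  then have Vs: "?V \<in> sets M'" by auto
  have Bf: "B \<in> fmeasurable M'" and Cf: "C \<in> fmeasurable M'" using Vf B C fmeasurableI2 by blast+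
  have fm: "f \<in> borel_measurable M'" using f(1) by auto
  show "integrable M' (wt B C n)" "(\<lambda>x. birkhoff_sum T' f n x / a n) \<in> borel_measurable M'" for n
    by (rule wt_integrable[OF Bf C(1)], rule esum_measurable[OF fm])
  fix e :: real assume e: "0 < e"
  let ?p = "\<lambda>x. indicator (visited r) (x 0) :: real"
  have ip: "integrable M (indicator (visited r) :: _ \<Rightarrow> real)" using visited_fmeasurable[of r] by (simp add: fmeasurable_def)
  have pm: "?p \<in> borel_measurable M'" using integrable_coord[OF ip] by auto
  have p_law: "ext_law ?V ?V ?p" by (rule ext_law_visited[OF Vs order_refl Vs order_refl ip, of 1]) auto
  obtain L where L: "0 < L" "avg_le (e/2) (\<lambda>n. \<integral>x. wt ?V ?V n x * indicator {x. L \<le> \<bar>birkhoff_sum T' ?p n x / a n\<bar>} x \<partial>M')"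
    using avg_law_tail[OF p_law[unfolded ext_law_def] wt_integrable[OF Vf Vs] wt_nonneg esum_measurable[OF pm], of "e/2"] e
    by auto
  \<comment> \<open>With fewer than L a(n) visits the normalized difference stays below l L =
    e.\<close>
  define l where "l = e / L"
  have l: "0 < l" using e L by (simp add: l_def)
  obtain K where K: "0 < K" "avg_le K u" by (rule u_avg)
  \<comment> \<open>Hopf's inequality yields l m(E) \<le> \<eta>; the second entry then makes m(E)
    m(V) K at most e/4.\<close>
  define \<eta> where "\<eta> = min e (l * (e / (4 * (measure M' ?V + 1) * K)))"
  have mV: "0 < measure M' ?V + 1" by (simp add: add_nonneg_pos)
  have \<eta>: "0 < \<eta>" using e l K mV by (simp add: \<eta>_def)
  obtain k h Kh where h: "integrable M h" "\<And>x. x \<in> space M \<Longrightarrow> 0 \<le> h x" "\<And>x. x \<in> space M \<Longrightarrow> \<bar>h x\<bar> \<le> Kh" "0 \<le> Kh"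
    "(\<integral>x. \<bar>f x - h (x k)\<bar> \<partial>M') \<le> \<eta>" using coord_L1_approx_nonneg[OF f \<eta>] by blast
  let ?h = "\<lambda>x. h (x k)"
  have hi: "integrable M' ?h" by (rule integrable_coord[OF h(1)])
  then have hm: "?h \<in> borel_measurable M'" by auto
  have h_law: "ext_law B C ?h" by (rule ext_law_visited_coord[OF B C h(1,2) h(4,3)])
  let ?q = "\<lambda>x. \<bar>f x - h (x k)\<bar>"
  have qi: "integrable M' ?q" using f(1) hi by auto
  then have qm: "?q \<in> borel_measurable M'" by auto
  define E where "E = {x \<in> space M'. x \<in> ?V \<and> (\<exists>n. l * birkhoff_sum T' ?p n x < birkhoff_sum T' ?q n x)}"
  note [measurable] = birkhoff_measurable[OF ext_mpt qm] birkhoff_measurable[OF ext_mpt pm] Vs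
  have Es: "E \<in> sets M'" unfolding E_def by measurable
  have EV: "E \<subseteq> ?V" by (auto simp: E_def)
  have Ef: "E \<in> fmeasurable M'" by (rule fmeasurableI2[OF Vf EV Es])
  have "l * measure M' E \<le> (\<integral>x. ?q x \<partial>M')"
  proof (rule hopf_maximal[OF ext_mpt qi _ Vf l Es EV])
    fix x assume x: "x \<in> E"
    then have xs: "x \<in> space M'" by (simp add: E_def)
    have "birkhoff_sum T' (indicator ?V) n x = birkhoff_sum T' ?p n x" for n
      unfolding birkhoff_sum_def using ext_funpow_space[OF xs] by (intro sum.cong) (auto simp: lift_def indicator_def)
    then show "\<exists>n. l * birkhoff_sum T' (indicator ?V) n x < birkhoff_sum T' ?q n x" using x by (simp add: E_def)
  qed auto
  then have "l * measure M' E \<le> l * (e / (4 * (measure M' ?V + 1) * K))" using h(5) by (simp add: \<eta>_def)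
  then have mE: "measure M' E \<le> e / (4 * (measure M' ?V + 1) * K)" using l by (rule mult_left_le_imp_le)
  \<comment> \<open>\<open>E\<close> does not depend on n, so the law with left set
    \<open>E\<close>, tested with g = 1, bounds these averages: e/4 for its error and e/4 for its
    main term.\<close>
  have E_avg: "avg_le (e/4 + e/4) (\<lambda>n. \<integral>x. wt E ?V n x \<partial>M')"
  proof (rule avg_le_of_null[OF avg_law_mass K(2)])
    show "avg_law M' (wt E ?V) (\<lambda>n x. birkhoff_sum T' ?p n x / a n) (measure M' E * measure M' ?V) (\<integral>x. ?p x \<partial>M')"
      using ext_law_visited[OF Es EV Vs order_refl ip, of 1] by (auto simp: ext_law_def)
    have "measure M' E * measure M' ?V \<le> e / (4 * (measure M' ?V + 1) * K) * (measure M' ?V + 1)"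
      using mE e K by (intro mult_mono) auto
    also have "\<dots> = e / (4 * K)"
    proof -
      have "e / (4 * v * K) * v = e / (4 * K)" if "0 < v" for v using that by simp
      then show ?thesis using mV .
    qed
    finally show "\<bar>measure M' E * measure M' ?V\<bar> \<le> e / (4 * K)" by simp
  qed (use e K in auto)
  let ?\<phi> = "\<lambda>n x. birkhoff_sum T' f n x / a n" and ?\<phi>' = "\<lambda>n x. birkhoff_sum T' ?h n x / a n"
  let ?tail = "\<lambda>n x. wt ?V ?V n x * indicator {x. L \<le> \<bar>birkhoff_sum T' ?p n x / a n\<bar>} x"
  have "avg_le (e/4 + e/4 + e/2) (\<lambda>n. \<integral>x. wt B C n x * indicator {x. e < \<bar>?\<phi> n x - ?\<phi>' n x\<bar>} x \<partial>M')"
  proof (rule avg_le_add[OF E_avg L(2)])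
    fix n :: nat assume n: "1 \<le> n"
    have i1: "integrable M' (\<lambda>x. wt B C n x * indicator {x. e < \<bar>?\<phi> n x - ?\<phi>' n x\<bar>} x)"
      using integrable_weight_indicator[OF wt_integrable[OF Bf C(1)] borel_measurable_diff[OF esum_measurable[OF fm] esum_measurable[OF hm]], of "{y. e < \<bar>y\<bar>}" n n n]
      by (rule back_subst[of "integrable M'"]) (auto simp: indicator_def)
    have i2: "integrable M' (?tail n)"
      using integrable_weight_indicator[OF wt_integrable[OF Vf Vs] esum_measurable[OF pm], of "{y. L \<le> \<bar>y\<bar>}" n n]
      by (rule back_subst[of "integrable M'"]) (auto simp: indicator_def)
    have i3: "integrable M' (wt E ?V n)" by (rule wt_integrable[OF Ef Vs])
    have "(\<integral>x. wt B C n x * indicator {x. e < \<bar>?\<phi> n x - ?\<phi>' n x\<bar>} x \<partial>M') \<le> (\<integral>x. wt E ?V n x + ?tail n x \<partial>M')"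
    proof (rule integral_mono)
      fix x assume x: "x \<in> space M'"
      have an: "0 < a n" by (rule a_pos[OF n])
      show "wt B C n x * indicator {x. e < \<bar>?\<phi> n x - ?\<phi>' n x\<bar>} x \<le> wt E ?V n x + ?tail n x"
      proof (cases "x \<in> B \<and> (T' ^^ n) x \<in> C \<and> e < \<bar>?\<phi> n x - ?\<phi>' n x\<bar>")
        case True
        then have xV: "x \<in> ?V" "(T' ^^ n) x \<in> ?V" using B(2) C(2) by auto
        have "x \<in> E \<or> L \<le> \<bar>birkhoff_sum T' ?p n x / a n\<bar>"
        proof (cases "x \<in> E")
          case False
          then have "birkhoff_sum T' ?q n x \<le> l * birkhoff_sum T' ?p n x"
            using x xV by (auto simp: E_def not_less)
          with birkhoff_abs_diff have "\<bar>birkhoff_sum T' f n x - birkhoff_sum T' ?h n x\<bar> \<le> l * birkhoff_sum T' ?p n x"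
            by (rule order_trans)
          then have "\<bar>birkhoff_sum T' f n x - birkhoff_sum T' ?h n x\<bar> / a n \<le> l * birkhoff_sum T' ?p n x / a n"
            using an by (intro divide_right_mono) auto
          moreover have "\<bar>?\<phi> n x - ?\<phi>' n x\<bar> = \<bar>birkhoff_sum T' f n x - birkhoff_sum T' ?h n x\<bar> / a n"
            using an by (simp add: diff_divide_distrib[symmetric])
          ultimately have "e < l * birkhoff_sum T' ?p n x / a n" using True by linarith
          then have "e < l * (birkhoff_sum T' ?p n x / a n)" by simp
          moreover have "L < t" if "e < l * t" for t using that e L(1) unfolding l_def by (simp add: field_simps)
          ultimately have "L < birkhoff_sum T' ?p n x / a n" by blast
          then have "L \<le> \<bar>birkhoff_sum T' ?p n x / a n\<bar>" by linarith
          then show ?thesis by simp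
        qed simp
        moreover have "wt B C n x = 1" "wt ?V ?V n x = 1" using True xV by (simp_all add: wt_def)
        moreover have "wt E ?V n x = indicator E x" using xV by (simp add: wt_def)
        ultimately show ?thesis using wt_nonneg[of E ?V n x] by (auto simp: indicator_def)
      next
        case False
        then have "wt B C n x * indicator {x. e < \<bar>?\<phi> n x - ?\<phi>' n x\<bar>} x = 0" by (auto simp: wt_def indicator_def)
        moreover have "0 \<le> wt E ?V n x + ?tail n x"
          by (intro add_nonneg_nonneg mult_nonneg_nonneg wt_nonneg) simp
        ultimately show ?thesis by (simp only:)
      qed
    qed (use i1 i2 i3 in auto)
    also have "\<dots> = (\<integral>x. wt E ?V n x \<partial>M') + (\<integral>x. ?tail n x \<partial>M')" using i2 i3 by simp
    finally show "\<bar>\<integral>x. wt B C n x * indicator {x. e < \<bar>?\<phi> n x - ?\<phi>' n x\<bar>} x \<partial>M'\<bar> \<le>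
        \<bar>\<integral>x. wt E ?V n x \<partial>M'\<bar> + \<bar>\<integral>x. ?tail n x \<partial>M'\<bar>"
      by (simp add: wt_nonneg)
  qed
  moreover have "\<bar>(\<integral>x. ?h x \<partial>M') - (\<integral>x. f x \<partial>M')\<bar> \<le> e"
  proof -
    have "\<bar>(\<integral>x. ?h x \<partial>M') - (\<integral>x. f x \<partial>M')\<bar> = \<bar>\<integral>x. f x - ?h x \<partial>M'\<bar>" using hi f(1) by (simp add: abs_minus_commute)
    also have "\<dots> \<le> (\<integral>x. \<bar>f x - ?h x\<bar> \<partial>M')" by (rule integral_abs_bound)
    also have "\<dots> \<le> e" using h(5) by (simp add: \<eta>_def)
    finally show ?thesis .
  qed
  moreover have "avg_le e (\<lambda>n. 0)" using avg_null_zero e by (rule avg_null_le)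
  ultimately show "\<exists>D' \<phi>' c' w'.
      (\<forall>n. integrable M' (D' n)) \<and> (\<forall>n. \<forall>x\<in>space M'. 0 \<le> D' n x) \<and> (\<forall>n. \<phi>' n \<in> borel_measurable M') \<and>
      avg_law M' D' \<phi>' c' w' \<and> \<bar>c' - measure M' B * measure M' C\<bar> \<le> e \<and> \<bar>w' - (\<integral>x. f x \<partial>M')\<bar> \<le> e \<and>
      avg_le e (\<lambda>n. \<integral>x. \<bar>wt B C n x - D' n x\<bar> \<partial>M') \<and>
      avg_le e (\<lambda>n. \<integral>x. D' n x * indicator {x. e < \<bar>?\<phi> n x - \<phi>' n x\<bar>} x \<partial>M')"
    using h_law[unfolded ext_law_def] wt_integrable[OF Bf C(1)] esum_measurable[OF hm] e
    by (intro exI[of _ "wt B C"] exI[of _ ?\<phi>'] exI[of _ "measure M' B * measure M' C"] exI[of _ "\<integral>x. ?h x \<partial>M'"])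
      (auto simp: wt_nonneg)
qed

end

section \<open>Return sequences\<close>

lemma tendsto_eventually_eq:
  "(f \<longlongrightarrow> l) F \<Longrightarrow> \<forall>\<^sub>F x in F. f x = g x \<Longrightarrow> l = l' \<Longrightarrow> (g \<longlongrightarrow> l') F"
  using Lim_transform_eventually by blast

context
  fixes M :: "'a measure" and T :: "'a \<Rightarrow> 'a" and F :: "'a set"
  assumes mpt: "mpt M T" and F: "F \<in> sets M" "emeasure M F < \<infinity>"
begin

lemma return_sets: "F \<inter> (T ^^ k) -` F \<in> sets M"
proof -
  have "F \<inter> (T ^^ k) -` F = F \<inter> ((T ^^ k) -` F \<inter> space M)" using sets.sets_into_space[OF F(1)] by auto
  then show ?thesis using measurable_sets[OF mpt_funpow_measurable[OF mpt] F(1)] F by auto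
qed

lemma return_measure_le: "measure M (F \<inter> (T ^^ k) -` F) \<le> measure M F"
  by (rule measure_mono_fmeasurable) (use return_sets F in \<open>auto simp: fmeasurable_def\<close>)

lemma set_return_seq_mono: "n \<le> N \<Longrightarrow> set_return_seq M T F n \<le> set_return_seq M T F N"
  unfolding set_return_seq_def by (intro mult_left_mono sum_mono2) auto

lemma set_return_seq_pos:
  assumes "0 < measure M F" "1 \<le> n"
  shows "0 < set_return_seq M T F n"
proof -
  have "measure M (F \<inter> (T ^^ 0) -` F) \<le> (\<Sum>k<n. measure M (F \<inter> (T ^^ k) -` F))"
    by (rule member_le_sum) (use assms in auto)
  then show ?thesis using assms by (simp add: set_return_seq_def)
qed

lemma set_return_seq_Suc_le:
  "set_return_seq M T F (Suc n) - set_return_seq M T F n \<le> 1 / (measure M F)\<^sup>2 * measure M F"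
proof -
  have "set_return_seq M T F (Suc n) - set_return_seq M T F n = 1 / (measure M F)\<^sup>2 * measure M (F \<inter> (T ^^ n) -` F)"
    by (simp only: set_return_seq_def sum.lessThan_Suc distrib_left add_diff_cancel_left')
  also have "\<dots> \<le> 1 / (measure M F)\<^sup>2 * measure M F" by (intro mult_left_mono return_measure_le) simp
  finally show ?thesis .
qed

end

text \<open>The defining convergence of \<open>F\<close> for B = C = A.\<close>

lemma rat_erg_subset_return:
  assumes mpt: "mpt M T" and F: "F \<in> rat_erg_sets M T" and A: "A \<in> sets M" "A \<subseteq> F" "0 < measure M A"
  shows "(\<lambda>n. set_return_seq M T A n / set_return_seq M T F n) \<longlonglongrightarrow> 1"
proof -
  have "(\<lambda>n. 1 / set_return_seq M T F n * (\<Sum>k<n. measure M (A \<inter> (T ^^ k) -` A))) \<longlonglongrightarrow> measure M A * measure M A"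
    using F A by (auto simp: rat_erg_sets_def)
  then have "(\<lambda>n. 1 / (measure M A)\<^sup>2 * (1 / set_return_seq M T F n * (\<Sum>k<n. measure M (A \<inter> (T ^^ k) -` A))))
      \<longlonglongrightarrow> 1 / (measure M A)\<^sup>2 * (measure M A * measure M A)"
    by (intro tendsto_mult[OF tendsto_const])
  then show ?thesis using A(3) by (simp add: set_return_seq_def[of M T A] power2_eq_square)
qed

lemma rat_erg_sets_subset:
  assumes mpt: "mpt M T" and F: "F \<in> rat_erg_sets M T" and A: "A \<in> sets M" "A \<subseteq> F"
  shows "A \<in> rat_erg_sets M T"
proof -
  have F': "F \<in> sets M" "emeasure M F < \<infinity>" using F by (auto simp: rat_erg_sets_def)
  then have Ff: "F \<in> fmeasurable M" by (auto simp: fmeasurable_def)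
  have Af: "A \<in> fmeasurable M" by (rule fmeasurableI2[OF Ff A(2,1)])
  have "(\<lambda>n. 1 / set_return_seq M T A n * (\<Sum>k<n. measure M (B \<inter> (T ^^ k) -` C))) \<longlonglongrightarrow> measure M B * measure M C"
    if B: "B \<in> sets M" "B \<subseteq> A" and C: "C \<in> sets M" "C \<subseteq> A" for B C
  proof (cases "measure M A = 0")
    \<comment> \<open>For a null set the return sequence is 0 by division by zero, so both sides of
      the convergence are 0.\<close>
    case True
    have "measure M B \<le> measure M A" by (rule measure_mono_fmeasurable[OF B(2,1) Af])
    then have "measure M B = 0" using True measure_nonneg[of M B] by linarith
    then show ?thesis using True by (simp add: set_return_seq_def)
  next
    case False
    then have pos: "0 < measure M A" by (simp add: zero_less_measure_iff)
    have "measure M A \<le> measure M F" by (rule measure_mono_fmeasurable[OF A(2,1) Ff])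
    then have posF: "0 < measure M F" using pos by simp
    have "(\<lambda>n. (1 / set_return_seq M T F n * (\<Sum>k<n. measure M (B \<inter> (T ^^ k) -` C))) /
        (set_return_seq M T A n / set_return_seq M T F n)) \<longlonglongrightarrow> (measure M B * measure M C) / 1"
      using F A B C by (intro tendsto_divide rat_erg_subset_return[OF mpt F A pos]) (auto simp: rat_erg_sets_def)
    moreover have "\<forall>\<^sub>F n in sequentially. (1 / set_return_seq M T F n * (\<Sum>k<n. measure M (B \<inter> (T ^^ k) -` C))) /
        (set_return_seq M T A n / set_return_seq M T F n) = 1 / set_return_seq M T A n * (\<Sum>k<n. measure M (B \<inter> (T ^^ k) -` C))"
      using eventually_ge_at_top[of 1]
    proof eventually_elim
      case (elim n)
      show ?case using set_return_seq_pos[OF mpt F' posF elim] by simp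
    qed
    ultimately show ?thesis by (rule tendsto_eventually_eq) simp
  qed
  then show ?thesis using A Af by (auto simp: rat_erg_sets_def fmeasurable_def)
qed

section \<open>Growth of the versions of the return sequence\<close>

context
  fixes M :: "'a measure" and T :: "'a \<Rightarrow> 'a" and F :: "'a set" and a :: "nat \<Rightarrow> real"
  assumes mpt: "mpt M T" and F: "F \<in> sets M" "emeasure M F < \<infinity>" "0 < measure M F"
    and a_pos: "\<And>n. 1 \<le> n \<Longrightarrow> 0 < a n" and ratio: "(\<lambda>n. set_return_seq M T F n / a n) \<longlonglongrightarrow> 1"
begin

lemma return_inverse_ratio: "(\<lambda>n. a n / set_return_seq M T F n) \<longlonglongrightarrow> 1"
  using tendsto_inverse[OF ratio] by simp

text \<open>An increasing bounded return sequence would make \<open>a\<close> converge to a positive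
  limit, and then a(2 n) / a(n) would tend to 1 instead of 2^\<gamma> > 1.\<close>

lemma return_seq_at_top:
  assumes rv: "regularly_varying \<gamma> a" "0 < \<gamma>"
  shows "filterlim (set_return_seq M T F) at_top sequentially"
proof (rule ccontr)
  let ?s = "set_return_seq M T F"
  assume not: "\<not> filterlim ?s at_top sequentially"
  have inc: "incseq ?s" by (rule incseq_SucI) (rule set_return_seq_mono[OF mpt F(1,2)], simp)
  have "\<exists>B. \<forall>n. ?s n \<le> B"
  proof (rule ccontr)
    assume "\<nexists>B. \<forall>n. ?s n \<le> B"
    then have "\<exists>n. Z < ?s n" for Z by (auto simp: not_le)
    then have "\<forall>\<^sub>F n in sequentially. Z \<le> ?s n" for Z
      unfolding eventually_sequentially using incseqD[OF inc] by (meson less_imp_le order_trans)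
    then show False using not by (simp add: filterlim_at_top)
  qed
  then obtain B where B: "\<And>n. ?s n \<le> B" by blast
  obtain L where L: "?s \<longlonglongrightarrow> L" "\<And>n. ?s n \<le> L" using incseq_convergent[OF inc, of B] B by blast
  have "0 < L" using L(2)[of 1] set_return_seq_pos[OF mpt F(1,2,3), of 1] by simp
  have "(\<lambda>n. ?s n * (a n / ?s n)) \<longlonglongrightarrow> L * 1" by (intro tendsto_mult L return_inverse_ratio)
  moreover have "\<forall>\<^sub>F n in sequentially. ?s n * (a n / ?s n) = a n"
    using eventually_ge_at_top[of 1]
  proof eventually_elim
    case (elim n)
    show ?case using set_return_seq_pos[OF mpt F elim] by simp
  qed
  ultimately have aL: "a \<longlonglongrightarrow> L" by (rule tendsto_eventually_eq) simp
  have "(\<lambda>n. a (nat \<lfloor>2 * real n\<rfloor>) / a n) \<longlonglongrightarrow> 2 powr \<gamma>" using rv(1) by (auto simp: regularly_varying_def)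
  moreover have "nat \<lfloor>2 * real n\<rfloor> = 2 * n" for n
  proof -
    have "\<lfloor>2 * real n\<rfloor> = int (2 * n)" by (rule floor_unique) auto
    then show ?thesis by simp
  qed
  ultimately have "(\<lambda>n. a (2 * n) / a n) \<longlonglongrightarrow> 2 powr \<gamma>" by simp
  moreover have "(\<lambda>n. a (2 * n) / a n) \<longlonglongrightarrow> L / L"
    by (intro tendsto_divide aL LIMSEQ_subseq_LIMSEQ[OF aL, of "\<lambda>n. 2 * n", unfolded comp_def])
      (use \<open>0 < L\<close> in \<open>auto simp: strict_mono_def\<close>)
  ultimately have "2 powr \<gamma> = L / L" by (rule LIMSEQ_unique)
  then show False using \<open>0 < L\<close> rv(2) by simp
qed

text \<open>The return sequence of \<open>F\<close> increases, by at most 1 / m(F) in each step, so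
  it has these properties; they pass to \<open>a\<close> through the ratio, monotonicity only up to
  a constant.\<close>

lemma return_a_props:
  assumes top: "filterlim (set_return_seq M T F) at_top sequentially"
  shows "filterlim a at_top sequentially" "(\<lambda>n. a (Suc n) / a n) \<longlonglongrightarrow> 1"
    "\<exists>K>0. \<forall>n N. 1 \<le> n \<longrightarrow> n \<le> N \<longrightarrow> a n \<le> K * a N"
proof -
  let ?s = "set_return_seq M T F"
  have s_pos: "0 < ?s n" if "1 \<le> n" for n using set_return_seq_pos[OF mpt F(1,2,3) that] .
  have eq: "\<forall>\<^sub>F n in sequentially. a n / ?s n * ?s n = a n"
    using eventually_ge_at_top[of 1]
  proof eventually_elim
    case (elim n)
    show ?case using s_pos[OF elim] by simp
  qed
  have "filterlim (\<lambda>n. a n / ?s n * ?s n) at_top sequentially"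
    by (rule filterlim_tendsto_pos_mult_at_top[OF return_inverse_ratio _ top]) simp
  then show "filterlim a at_top sequentially" using filterlim_cong[OF refl refl eq] by blast
  have ss: "(\<lambda>n. ?s (Suc n) / ?s n) \<longlonglongrightarrow> 1"
  proof -
    define b where "b = 1 / (measure M F)\<^sup>2 * measure M F"
    have "(\<lambda>n. b / ?s n) \<longlonglongrightarrow> 0"
      by (rule tendsto_divide_0[OF tendsto_const filterlim_at_top_imp_at_infinity[OF top]])
    then have "(\<lambda>n. 1 + b / ?s n) \<longlonglongrightarrow> 1 + 0" by (intro tendsto_add tendsto_const)
    then have up: "(\<lambda>n. 1 + b / ?s n) \<longlonglongrightarrow> 1" by simp
    show ?thesis
    proof (rule tendsto_sandwich[OF _ _ tendsto_const up])
      show "\<forall>\<^sub>F n in sequentially. 1 \<le> ?s (Suc n) / ?s n"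
        using eventually_ge_at_top[of 1]
      proof eventually_elim
        case (elim n)
        show ?case using s_pos[OF elim] set_return_seq_mono[OF mpt F(1,2), of n "Suc n"] by (simp add: le_divide_eq)
      qed
      show "\<forall>\<^sub>F n in sequentially. ?s (Suc n) / ?s n \<le> 1 + b / ?s n"
        using eventually_ge_at_top[of 1]
      proof eventually_elim
        case (elim n)
        have "?s (Suc n) \<le> ?s n + b" using set_return_seq_Suc_le[OF mpt F(1,2), of n] unfolding b_def by linarith
        then have "?s (Suc n) / ?s n \<le> (?s n + b) / ?s n" using s_pos[OF elim] by (intro divide_right_mono) auto
        then show ?case using s_pos[OF elim] by (simp add: add_divide_distrib)
      qed
    qed
  qed
  have "(\<lambda>n. (a (Suc n) / ?s (Suc n)) * (?s (Suc n) / ?s n) * (?s n / a n)) \<longlonglongrightarrow> 1 * 1 * 1"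
    by (intro tendsto_mult ss ratio LIMSEQ_Suc[OF return_inverse_ratio])
  moreover have "\<forall>\<^sub>F n in sequentially. (a (Suc n) / ?s (Suc n)) * (?s (Suc n) / ?s n) * (?s n / a n) = a (Suc n) / a n"
    using eventually_ge_at_top[of 1]
  proof eventually_elim
    case (elim n)
    then show ?case using s_pos[of n] s_pos[of "Suc n"] by simp
  qed
  ultimately show "(\<lambda>n. a (Suc n) / a n) \<longlonglongrightarrow> 1" by (rule tendsto_eventually_eq) simp
  obtain K1 where K1: "0 < K1" "\<And>n. \<bar>?s n / a n\<bar> \<le> K1"
    using convergent_imp_Bseq[OF convergentI[OF ratio]] by (auto simp: Bseq_def)
  obtain K2 where K2: "0 < K2" "\<And>n. \<bar>a n / ?s n\<bar> \<le> K2"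
    using convergent_imp_Bseq[OF convergentI[OF return_inverse_ratio]] by (auto simp: Bseq_def)
  have s_le: "?s n \<le> K1 * a n" if "1 \<le> n" for n
    using K1(2)[of n] a_pos[OF that] s_pos[OF that] by (simp add: field_simps)
  have a_le: "a n \<le> K2 * ?s n" if "1 \<le> n" for n
    using K2(2)[of n] a_pos[OF that] s_pos[OF that] by (simp add: field_simps)
  have "a n \<le> (K2 * K1) * a N" if "1 \<le> n" "n \<le> N" for n N
  proof -
    have "a n \<le> K2 * ?s n" by (rule a_le[OF that(1)])
    also have "\<dots> \<le> K2 * ?s N" using set_return_seq_mono[OF mpt F(1,2) that(2)] K2(1) by simp
    also have "\<dots> \<le> K2 * (K1 * a N)" using s_le[of N] that K2(1) by (intro mult_left_mono) auto
    finally show ?thesis by simp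
  qed
  then show "\<exists>K>0. \<forall>n N. 1 \<le> n \<longrightarrow> n \<le> N \<longrightarrow> a n \<le> K * a N"
    using K1(1) K2(1) by (intro exI[of _ "K2 * K1"]) auto
qed

end

section \<open>The natural extension is weakly rationally ergodic\<close>

context renewal_averages
begin

text \<open>Return sequences sum over k < n, the averages over 1..n; the difference is the bounded
  quantity x 0 - x n.\<close>

lemma sum_lessThan_tendsto_iff:
  assumes "\<And>k. \<bar>x k\<bar> \<le> (K::real)"
  shows "(\<lambda>n. (\<Sum>k<n. x k) / a n) \<longlonglongrightarrow> l \<longleftrightarrow> (\<lambda>n. (\<Sum>k=1..n. x k) / a n) \<longlonglongrightarrow> l"
proof -
  have "(\<lambda>n. 2 * K / a n) \<longlonglongrightarrow> 0"
    by (rule tendsto_divide_0[OF tendsto_const filterlim_at_top_imp_at_infinity[OF a_top]])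
  then have "(\<lambda>n. (\<Sum>k<n. x k) / a n - (\<Sum>k=1..n. x k) / a n) \<longlonglongrightarrow> 0"
  proof (rule Lim_null_comparison[rotated])
    show "\<forall>\<^sub>F n in sequentially. norm ((\<Sum>k<n. x k) / a n - (\<Sum>k=1..n. x k) / a n) \<le> 2 * K / a n"
      using a_pos_eventually
    proof eventually_elim
      case (elim n)
      have "(\<Sum>k<n. x k) - (\<Sum>k=1..n. x k) = x 0 - x n" by (induction n) auto
      then have "\<bar>(\<Sum>k<n. x k) - (\<Sum>k=1..n. x k)\<bar> \<le> 2 * K" using assms[of 0] assms[of n] by linarith
      then show ?case using elim by (simp add: diff_divide_distrib[symmetric] divide_right_mono)
    qed
  qed
  then show ?thesis by (rule Lim_transform_eq)
qed

lemma avg_null_sum_tendsto_iff: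
  assumes "avg_null (\<lambda>n. x n - c * u n)"
  shows "(\<lambda>n. (\<Sum>k=1..n. x k) / a n) \<longlonglongrightarrow> l \<longleftrightarrow> (\<lambda>n. c * ((\<Sum>k=1..n. u k) / a n)) \<longlonglongrightarrow> l"
proof (rule Lim_transform_eq)
  show "(\<lambda>n. (\<Sum>k=1..n. x k) / a n - c * ((\<Sum>k=1..n. u k) / a n)) \<longlonglongrightarrow> 0"
  proof (rule Lim_null_comparison[OF _ assms[unfolded avg_null_iff]])
    show "\<forall>\<^sub>F n in sequentially. norm ((\<Sum>k=1..n. x k) / a n - c * ((\<Sum>k=1..n. u k) / a n)) \<le> 1 / a n * (\<Sum>k=1..n. \<bar>x k - c * u k\<bar>)"
      using a_pos_eventually
    proof eventually_elim
      case (elim n)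
      have "(\<Sum>k=1..n. x k) / a n - c * ((\<Sum>k=1..n. u k) / a n) = 1 / a n * (\<Sum>k=1..n. x k - c * u k)"
        by (simp add: sum_subtractf sum_distrib_left[symmetric] diff_divide_distrib)
      then have "norm ((\<Sum>k=1..n. x k) / a n - c * ((\<Sum>k=1..n. u k) / a n)) = 1 / a n * \<bar>\<Sum>k=1..n. x k - c * u k\<bar>"
        using elim by (simp add: abs_mult)
      also have "\<dots> \<le> 1 / a n * (\<Sum>k=1..n. \<bar>x k - c * u k\<bar>)"
        using elim by (intro mult_left_mono sum_abs) auto
      finally show ?case .
    qed
  qed
qed

end

context renewal_extension
begin

lemma measure_lift_G_pos: "0 < measure M' (lift G)" "0 < emeasure M G" "emeasure M G < \<infinity>"
  "0 < emeasure M' (lift G)"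
  using G G_pos measure_lift[OF G_sets]
  by (auto simp: fmeasurable_def measure_def enn2real_positive_iff)

text \<open>The accumulated correlations of \<open>G\<close> with itself behave like m(G)^2 times
  the sums of \<open>u\<close> by the law with g = 1, and like m(G)^2 a(n) by the choice of
  \<open>a\<close>. For u(n) = \<gamma> a(n) / n this is the asymptotics known from Karamata's
  theorem.\<close>

lemma u_sum_tendsto:
  assumes base: "(\<lambda>n. set_return_seq M T G n / a n) \<longlonglongrightarrow> 1"
  shows "(\<lambda>n. (\<Sum>k=1..n. u k) / a n) \<longlonglongrightarrow> 1"
proof -
  let ?x = "\<lambda>k. measure M (G \<inter> (T ^^ k) -` G)"
  have Gs: "G \<in> sets M" "emeasure M G < \<infinity>" using G_sets measure_lift_G_pos by auto
  have "avg_null (\<lambda>n. (\<integral>x. indicator G x * indicator G ((T ^^ n) x) \<partial>M) - measure M G * measure M G * u n)"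
    by (rule avg_law_mass[OF base_law[OF G_sets G_sets, of "\<lambda>_. 0"]]) auto
  moreover have "(\<integral>x. indicator G x * indicator G ((T ^^ n) x) \<partial>M) = ?x n" for n
  proof -
    have "(\<integral>x. indicator G x * indicator G ((T ^^ n) x) \<partial>M) = (\<integral>x. indicator (G \<inter> (T ^^ n) -` G) x \<partial>M :: real)"
      by (rule Bochner_Integration.integral_cong) (auto simp: indicator_def)
    also have "\<dots> = ?x n"
      using sets.sets_into_space[OF return_sets[OF base_mpt Gs]] by (simp add: Int_absorb2)
    finally show ?thesis .
  qed
  ultimately have null: "avg_null (\<lambda>n. ?x n - measure M G * measure M G * u n)" by simp
  have "(\<lambda>n. (measure M G)\<^sup>2 * (set_return_seq M T G n / a n)) \<longlonglongrightarrow> (measure M G)\<^sup>2 * 1"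
    by (intro tendsto_intros base)
  then have "(\<lambda>n. (\<Sum>k<n. ?x k) / a n) \<longlonglongrightarrow> (measure M G)\<^sup>2"
    using G_pos by (simp add: set_return_seq_def)
  then have "(\<lambda>n. (\<Sum>k=1..n. ?x k) / a n) \<longlonglongrightarrow> (measure M G)\<^sup>2"
    by (subst (asm) sum_lessThan_tendsto_iff[where K="measure M G"]) (use return_measure_le[OF base_mpt Gs] in auto)
  then have "(\<lambda>n. measure M G * measure M G * ((\<Sum>k=1..n. u k) / a n)) \<longlonglongrightarrow> (measure M G)\<^sup>2"
    unfolding avg_null_sum_tendsto_iff[OF null] .
  then have "(\<lambda>n. 1 / (measure M G)\<^sup>2 * (measure M G * measure M G * ((\<Sum>k=1..n. u k) / a n))) \<longlonglongrightarrow> 1 / (measure M G)\<^sup>2 * (measure M G)\<^sup>2"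
    by (intro tendsto_mult tendsto_const)
  then show ?thesis using G_pos by (simp add: power2_eq_square)
qed

text \<open>Weak rational ergodicity is the law with f = 0 and g = 1, once the sums of
  \<open>u\<close> are identified with \<open>a\<close>.\<close>

lemma correlation_tendsto:
  assumes base: "(\<lambda>n. set_return_seq M T G n / a n) \<longlonglongrightarrow> 1"
    and B: "B \<in> sets M'" "B \<subseteq> lift G" and C: "C \<in> sets M'" "C \<subseteq> lift G"
  shows "(\<lambda>n. (\<Sum>k<n. measure M' (B \<inter> (T' ^^ k) -` C)) / a n) \<longlonglongrightarrow> measure M' B * measure M' C"
proof -
  have Bf: "B \<in> fmeasurable M'" using lift_G B fmeasurableI2 by blast
  have "ext_law B C (\<lambda>x. (\<lambda>_. 0) (x 0))" by (rule ext_law_G[OF B C, of "\<lambda>_. 0" 0]) auto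
  then have "avg_null (\<lambda>n. (\<integral>x. wt B C n x \<partial>M') - measure M' B * measure M' C * u n)"
    unfolding ext_law_def by (rule avg_law_mass)
  then have null: "avg_null (\<lambda>n. measure M' (B \<inter> (T' ^^ n) -` C) - measure M' B * measure M' C * u n)"
    unfolding wt_integral[OF B(1) C(1)] .
  have le: "\<bar>measure M' (B \<inter> (T' ^^ k) -` C)\<bar> \<le> measure M' B" for k
    using measure_mono_fmeasurable[OF Int_lower1 Int_vimage_sets[OF B(1) C(1)] Bf] by simp
  have "(\<lambda>n. measure M' B * measure M' C * ((\<Sum>k=1..n. u k) / a n)) \<longlonglongrightarrow> measure M' B * measure M' C * 1"
    by (intro tendsto_mult tendsto_const u_sum_tendsto base)
  then show ?thesis
    unfolding sum_lessThan_tendsto_iff[where K="measure M' B", OF le] avg_null_sum_tendsto_iff[OF null] by simp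
qed

lemma lift_G_return:
  assumes base: "(\<lambda>n. set_return_seq M T G n / a n) \<longlonglongrightarrow> 1"
  shows "(\<lambda>n. set_return_seq M' T' (lift G) n / a n) \<longlonglongrightarrow> 1"
proof -
  have "(\<lambda>n. 1 / (measure M' (lift G))\<^sup>2 * ((\<Sum>k<n. measure M' (lift G \<inter> (T' ^^ k) -` lift G)) / a n))
      \<longlonglongrightarrow> 1 / (measure M' (lift G))\<^sup>2 * (measure M' (lift G) * measure M' (lift G))"
    by (intro tendsto_mult tendsto_const correlation_tendsto[OF base] lift_G_sets order_refl)
  then show ?thesis using measure_lift_G_pos(1) by (simp add: set_return_seq_def power2_eq_square)
qed

lemma lift_G_rat_erg:
  assumes base: "(\<lambda>n. set_return_seq M T G n / a n) \<longlonglongrightarrow> 1"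
  shows "lift G \<in> rat_erg_sets M' T'"
  unfolding rat_erg_sets_def mem_Collect_eq
proof (intro conjI ballI impI)
  show "lift G \<in> sets M'" "emeasure M' (lift G) < \<infinity>" using lift_G by (auto simp: fmeasurable_def)
  fix B C assume BC: "B \<in> sets M'" "C \<in> sets M'" "B \<subseteq> lift G" "C \<subseteq> lift G"
  have "(\<lambda>n. ((\<Sum>k<n. measure M' (B \<inter> (T' ^^ k) -` C)) / a n) / (set_return_seq M' T' (lift G) n / a n))
      \<longlonglongrightarrow> (measure M' B * measure M' C) / 1"
    by (intro tendsto_divide correlation_tendsto[OF base] lift_G_return[OF base] BC) simp
  moreover have "\<forall>\<^sub>F n in sequentially.
      ((\<Sum>k<n. measure M' (B \<inter> (T' ^^ k) -` C)) / a n) / (set_return_seq M' T' (lift G) n / a n) =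
      1 / set_return_seq M' T' (lift G) n * (\<Sum>k<n. measure M' (B \<inter> (T' ^^ k) -` C))"
    using a_pos_eventually by eventually_elim simp
  ultimately show "(\<lambda>n. 1 / set_return_seq M' T' (lift G) n * (\<Sum>k<n. measure M' (B \<inter> (T' ^^ k) -` C)))
      \<longlonglongrightarrow> measure M' B * measure M' C" by (rule tendsto_eventually_eq) simp
qed

lemma ext_cons: "conservative M' T'"
  by (rule ext_conservative[OF cons erg G_sets measure_lift_G_pos(2,3)])

lemma ext_sweep_G: "AE x in M'. \<exists>\<^sub>\<infinity>n. (T' ^^ n) x \<in> lift G"
  using ext_sweep_out[OF cons erg G_sets measure_lift_G_pos(2)] AE_space
  by eventually_elim (simp add: lift_def ext_funpow_space)

lemma invariant_funpow:
  assumes "T' -` A \<inter> space M' = A" "x \<in> space M'"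
  shows "(T' ^^ n) x \<in> A \<longleftrightarrow> x \<in> A"
proof (induction n)
  case (Suc n)
  have "(T' ^^ Suc n) x \<in> A \<longleftrightarrow> (T' ^^ n) x \<in> T' -` A \<inter> space M'" using ext_funpow_space[OF assms(2)] by simp
  then show ?case using Suc assms(1) by simp
qed simp

text \<open>Almost every orbit meets \<open>lift G\<close>, so an invariant set is covered, up to a
  null set, by the preimages of its part in \<open>lift G\<close>.\<close>

lemma invariant_null:
  assumes A: "A \<in> sets M'" "T' -` A \<inter> space M' = A" and null: "measure M' (A \<inter> lift G) = 0"
  shows "emeasure M' A = 0"
proof -
  have "A \<inter> lift G \<in> fmeasurable M'" by (rule fmeasurableI2[OF lift_G]) (use A lift_G_sets in auto)
  from emeasure_eq_measure2[OF this] have "emeasure M' (A \<inter> lift G) = 0" using null by simp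
  then have "(T' ^^ n) -` (A \<inter> lift G) \<inter> space M' \<in> null_sets M'" for n
    using mpt_emeasure_vimage[OF ext_mpt, of "A \<inter> lift G" n] vimage_sets[of "A \<inter> lift G" n] A lift_G_sets by auto
  then have "(\<Union>n. (T' ^^ n) -` (A \<inter> lift G) \<inter> space M') \<in> null_sets M'" by (intro null_sets_UN)
  then have "AE x in M'. x \<notin> (\<Union>n. (T' ^^ n) -` (A \<inter> lift G) \<inter> space M')" by (rule AE_not_in)
  with ext_sweep_G AE_space have "AE x in M'. x \<notin> A"
  proof eventually_elim
    case (elim x)
    show ?case
    proof
      assume x: "x \<in> A"
      obtain n where "(T' ^^ n) x \<in> lift G" using elim(1) by (auto dest: INFM_EX)
      then show False using elim(2,3) invariant_funpow[OF A(2) elim(2)] x by auto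
    qed
  qed
  then show ?thesis using A(1) AE_iff_measurable[of A M' "\<lambda>x. x \<notin> A"] sets.sets_into_space[OF A(1)] by auto
qed

text \<open>Inside \<open>lift G\<close>, the parts of an invariant set and of its complement have
  correlation 0 at all times, whereas the averaged correlations tend to the product of the two
  measures.\<close>

lemma ext_ergodic:
  assumes base: "(\<lambda>n. set_return_seq M T G n / a n) \<longlonglongrightarrow> 1"
  shows "ergodic M' T'"
  unfolding ergodic_def
proof (intro ballI impI)
  fix A assume A: "A \<in> sets M'" "T' -` A \<inter> space M' = A"
  have As: "A \<subseteq> space M'" by (rule sets.sets_into_space[OF A(1)])
  let ?A = "space M' - A"
  have A': "?A \<in> sets M'" "T' -` ?A \<inter> space M' = ?A"
    using A measurable_space[OF ext_measurable] by auto
  have "(A \<inter> lift G) \<inter> (T' ^^ k) -` (?A \<inter> lift G) = {}" for k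
    using invariant_funpow[OF A(2)] As by auto
  then have "(\<lambda>n. (\<Sum>k<n. measure M' {}) / a n) \<longlonglongrightarrow> measure M' (A \<inter> lift G) * measure M' (?A \<inter> lift G)"
    using correlation_tendsto[OF base, of "A \<inter> lift G" "?A \<inter> lift G"] A(1) A'(1) lift_G_sets by auto
  then have "measure M' (A \<inter> lift G) * measure M' (?A \<inter> lift G) = 0"
    by (simp add: LIMSEQ_const_iff)
  then show "emeasure M' A = 0 \<or> emeasure M' (space M' - A) = 0"
    using invariant_null[OF A] invariant_null[OF A'] by auto
qed

lemma ext_weakly_rationally_ergodic:
  assumes base: "(\<lambda>n. set_return_seq M T G n / a n) \<longlonglongrightarrow> 1"
  shows "weakly_rationally_ergodic M' T'"
  unfolding weakly_rationally_ergodic_def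
  using ext_mpt ext_cons ext_ergodic[OF base] lift_G_rat_erg[OF base] measure_lift_G_pos(4) by blast

text \<open>As \<open>T'\<close> is invertible, any two sets of positive measure in \<open>R(T')\<close> have isomorphic subsets of
  positive measure.\<close>

lemma ext_return_sequence:
  assumes base: "(\<lambda>n. set_return_seq M T G n / a n) \<longlonglongrightarrow> 1"
  shows "return_sequence M' T' a"
  unfolding return_sequence_def
proof (intro conjI ballI impI allI)
  show "0 < a n" if "1 \<le> n" for n by (rule a_pos[OF that])
  fix A assume A: "A \<in> rat_erg_sets M' T'" "0 < emeasure M' A"
  have As: "A \<in> sets M'" "emeasure M' A < \<infinity>" using A(1) by (auto simp: rat_erg_sets_def)
  \<comment> \<open>Otherwise almost no point of \<open>lift G\<close> would ever reach
    \<open>A\<close>, although a set of positive measure is swept out by almost every orbit.\<close>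
  have "\<exists>k. measure M' (lift G \<inter> (T' ^^ k) -` A) \<noteq> 0"
  proof (rule ccontr)
    assume "\<not> ?thesis"
    then have "emeasure M' (lift G \<inter> (T' ^^ k) -` A) = 0" for k
      using emeasure_eq_measure2[OF Int_vimage_fmeasurable[OF lift_G As(1), of k]] by simp
    then have "lift G \<inter> (T' ^^ k) -` A \<in> null_sets M'" for k
      using Int_vimage_sets[OF lift_G_sets As(1)] by (intro null_setsI) auto
    then have "(\<Union>k. lift G \<inter> (T' ^^ k) -` A) \<in> null_sets M'" by (intro null_sets_UN)
    then have "AE x in M'. x \<notin> (\<Union>k. lift G \<inter> (T' ^^ k) -` A)" by (rule AE_not_in)
    with conservative_ergodic_sweep_out[OF ext_mpt ext_cons ext_ergodic[OF base] As(1) A(2)]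
    have "AE x in M'. x \<notin> lift G" by eventually_elim (auto dest: INFM_EX)
    then have "emeasure M' (lift G) = 0"
      using lift_G_sets AE_iff_measurable[of "lift G" M' "\<lambda>x. x \<notin> lift G"] sets.sets_into_space[OF lift_G_sets] by auto
    then show False using measure_lift_G_pos(4) by simp
  qed
  then obtain k where k: "measure M' (lift G \<inter> (T' ^^ k) -` A) \<noteq> 0" by blast
  \<comment> \<open>\<open>E\<close> lies in \<open>lift G\<close> and its image under T'^k in
    \<open>A\<close>. Conjugation by T'^k preserves correlations, so both have the same return
    sequence, which links \<open>lift G\<close> with \<open>A\<close>.\<close>
  define E where "E = lift G \<inter> (T' ^^ k) -` A"
  have E: "E \<in> sets M'" "E \<subseteq> lift G" "0 < measure M' E"
    using Int_vimage_sets[OF lift_G_sets As(1)] k by (auto simp: E_def zero_less_measure_iff)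
  obtain A' where A': "A' \<in> sets M'" "A' \<subseteq> A" "E = (T' ^^ k) -` A' \<inter> space M'"
    by (rule vimage_of_past[OF E(1), of k A]) (auto simp: E_def)
  have mA': "measure M' E = measure M' A'" unfolding A'(3) by (rule measure_vimage[OF A'(1)])
  have "measure M' (E \<inter> (T' ^^ j) -` E) = measure M' (A' \<inter> (T' ^^ j) -` A')" for j
  proof -
    have "(T' ^^ k) ((T' ^^ j) x) = (T' ^^ j) ((T' ^^ k) x)" for x
      by (metis add.commute comp_apply funpow_add)
    then have "E \<inter> (T' ^^ j) -` E = (T' ^^ k) -` (A' \<inter> (T' ^^ j) -` A') \<inter> space M'"
      unfolding A'(3) using ext_funpow_space by auto
    then show ?thesis using measure_vimage[OF Int_vimage_sets[OF A'(1) A'(1)]] by simp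
  qed
  then have same: "set_return_seq M' T' E = set_return_seq M' T' A'"
    by (simp add: set_return_seq_def fun_eq_iff mA')
  have 1: "(\<lambda>n. set_return_seq M' T' E n / set_return_seq M' T' (lift G) n) \<longlonglongrightarrow> 1"
    by (rule rat_erg_subset_return[OF ext_mpt lift_G_rat_erg[OF base] E])
  have 2: "(\<lambda>n. set_return_seq M' T' E n / set_return_seq M' T' A n) \<longlonglongrightarrow> 1"
    unfolding same by (rule rat_erg_subset_return[OF ext_mpt A(1) A'(1,2)]) (use E mA' in simp)
  have "(\<lambda>n. (set_return_seq M' T' E n / set_return_seq M' T' (lift G) n) *
      (set_return_seq M' T' (lift G) n / a n) / (set_return_seq M' T' E n / set_return_seq M' T' A n)) \<longlonglongrightarrow> 1 * 1 / 1"
    by (intro tendsto_divide tendsto_mult 1 2 lift_G_return[OF base]) simp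
  moreover have "\<forall>\<^sub>F n in sequentially. (set_return_seq M' T' E n / set_return_seq M' T' (lift G) n) *
      (set_return_seq M' T' (lift G) n / a n) / (set_return_seq M' T' E n / set_return_seq M' T' A n) = set_return_seq M' T' A n / a n"
    using eventually_ge_at_top[of 1]
  proof eventually_elim
    case (elim n)
    have Ef: "emeasure M' E < \<infinity>" using fmeasurableI2[OF lift_G E(2,1)] by (simp add: fmeasurable_def)
    have "0 < set_return_seq M' T' E n" by (rule set_return_seq_pos[OF ext_mpt E(1) Ef E(3) elim])
    moreover have "0 < set_return_seq M' T' (lift G) n"
      by (rule set_return_seq_pos[OF ext_mpt lift_G_sets _ measure_lift_G_pos(1) elim])
        (use lift_G in \<open>auto simp: fmeasurable_def\<close>)
    ultimately show ?case by simp
  qed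
  ultimately show "(\<lambda>n. set_return_seq M' T' A n / a n) \<longlonglongrightarrow> 1" by (rule tendsto_eventually_eq) simp
qed

section \<open>The dense hereditary ring upstairs\<close>

definition visited_ring :: "(nat \<Rightarrow> 'a) set set" where
  "visited_ring = {A \<in> sets M'. \<exists>r. A \<subseteq> lift (visited r)}"

lemma visited_mono: "r \<le> s \<Longrightarrow> lift (visited r) \<subseteq> lift (visited s)"
  unfolding lift_visited by (auto intro: less_le_trans)

text \<open>Density comes from sweeping out: almost every orbit enters \<open>lift G\<close>, so the
  traces of a set on \<open>lift (visited r)\<close> increase to almost all of it.\<close>

lemma dense_hereditary_visited_ring: "dense_hereditary_ring M' visited_ring"
  unfolding dense_hereditary_ring_def
proof (intro conjI ballI impI allI)
  show "ring_of_sets (space M') visited_ring"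
    unfolding ring_of_sets_iff
  proof (intro conjI ballI)
    show "visited_ring \<subseteq> Pow (space M')" using sets.sets_into_space by (auto simp: visited_ring_def)
    show "{} \<in> visited_ring" by (auto simp: visited_ring_def)
    fix A B assume "A \<in> visited_ring" "B \<in> visited_ring"
    then obtain r s where A: "A \<in> sets M'" "A \<subseteq> lift (visited r)" and B: "B \<in> sets M'" "B \<subseteq> lift (visited s)"
      by (auto simp: visited_ring_def)
    have "A \<union> B \<subseteq> lift (visited (max r s))"
      using A B visited_mono[of r "max r s"] visited_mono[of s "max r s"] by auto
    then show "A \<union> B \<in> visited_ring" using A B by (auto simp: visited_ring_def)
    show "A - B \<in> visited_ring" using A B by (auto simp: visited_ring_def)
  qed
  fix A assume "A \<in> visited_ring"
  then obtain r where A: "A \<in> sets M'" "A \<subseteq> lift (visited r)" by (auto simp: visited_ring_def)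
  then show "A \<in> sets M'" by simp
  show "emeasure M' A < \<infinity>"
    using fmeasurableI2[OF lift_fmeasurable[OF visited_fmeasurable] A(2,1)] by (auto simp: fmeasurable_def)
  show "B \<in> visited_ring" if "B \<in> sets M'" "B \<subseteq> A" for B using that A by (auto simp: visited_ring_def)
next
  fix A and e :: real assume A: "A \<in> sets M'" "emeasure M' A < \<infinity>" and e: "0 < e"
  have Af: "A \<in> fmeasurable M'" using A by (auto simp: fmeasurable_def)
  have V: "lift (visited r) \<in> sets M'" for r using lift_fmeasurable[OF visited_fmeasurable] by auto
  have AV: "A \<inter> lift (visited r) \<in> fmeasurable M'" for r by (rule fmeasurableI2[OF Af]) (use A V in auto)
  have "AE x in M'. x \<in> A \<longrightarrow> (\<exists>r. x \<in> lift (visited r))"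
    using ext_sweep_G AE_space
  proof eventually_elim
    case (elim x)
    obtain n where "(T' ^^ n) x \<in> lift G" using elim(1) by (auto dest: INFM_EX)
    then have "x \<in> lift (visited (Suc n))" using elim(2) by (auto simp: lift_visited)
    then show ?case by blast
  qed
  then have "measure M' (\<Union>r. A \<inter> lift (visited r)) = measure M' A"
    by (intro measure_eq_AE) (use A V in \<open>auto elim!: eventually_mono\<close>)
  moreover have "(\<lambda>r. measure M' (A \<inter> lift (visited r))) \<longlonglongrightarrow> measure M' (\<Union>r. A \<inter> lift (visited r))"
  proof (rule Lim_measure_incseq)
    show "incseq (\<lambda>r. A \<inter> lift (visited r))" using visited_mono by (intro incseq_SucI Int_mono) auto
    have "(\<Union>r. A \<inter> lift (visited r)) \<in> fmeasurable M'" by (rule fmeasurableI2[OF Af]) (use A V in auto)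
    then show "emeasure M' (\<Union>r. A \<inter> lift (visited r)) \<noteq> \<infinity>" by (auto simp: fmeasurable_def)
  qed (use A V in auto)
  ultimately have "(\<lambda>r. measure M' (A \<inter> lift (visited r))) \<longlonglongrightarrow> measure M' A" by simp
  then have "\<forall>\<^sub>F r in sequentially. measure M' A - e < measure M' (A \<inter> lift (visited r))"
    using e by (intro order_tendstoD(1)) auto
  then obtain r where r: "measure M' A - e < measure M' (A \<inter> lift (visited r))" by (auto simp: eventually_sequentially)
  have "sym_diff A (A \<inter> lift (visited r)) = A - A \<inter> lift (visited r)" by auto
  then have "measure M' (sym_diff A (A \<inter> lift (visited r))) = measure M' A - measure M' (A \<inter> lift (visited r))"
    using measurable_measure_Diff[OF Af fmeasurableD[OF AV]] by simp
  then show "\<exists>B\<in>visited_ring. measure M' (sym_diff A B) < e"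
    using r A V by (intro bexI[of _ "A \<inter> lift (visited r)"]) (auto simp: visited_ring_def)
qed

lemma mixing_visited_ring:
  assumes B: "B \<in> visited_ring" and C: "C \<in> visited_ring" and g: "g \<in> C_B" and f: "f \<in> L1_nonneg M'"
    and W: "space W = {0..}"
  shows "(\<lambda>N. 1 / a N * (\<Sum>n=1..N.
      \<bar>(LINT x:(B \<inter> (T' ^^ n) -` C)|M'. g (birkhoff_sum T' f n x / a n))
        - measure M' B * measure M' C * (\<integral>w. g ((\<integral>x. f x \<partial>M') * w) \<partial>W) * u n\<bar>)) \<longlonglongrightarrow> 0"
proof -
  obtain r s where r: "B \<in> sets M'" "B \<subseteq> lift (visited r)" and s: "C \<in> sets M'" "C \<subseteq> lift (visited s)"
    using B C by (auto simp: visited_ring_def)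
  have f': "integrable M' f" "\<And>x. x \<in> space M' \<Longrightarrow> 0 \<le> f x" using f by (auto simp: L1_nonneg_def)
  have law: "ext_law B C f"
    by (rule ext_law_integrable[of _ "max r s"])
      (use r s f' visited_mono[of r "max r s"] visited_mono[of s "max r s"] in auto)
  \<comment> \<open>Members of \<open>C_B\<close> are continuous on the half-line only; this extends
    them continuously to the line, and all arguments that occur are nonnegative.\<close>
  define g' where "g' y = g (max 0 y)" for y
  have g': "continuous_on UNIV g'" "bounded (range g')"
  proof -
    have gc: "continuous_on {0..} g" and "bounded (g ` {0..})" using g by (auto simp: C_B_def)
    show "continuous_on UNIV g'" unfolding g'_def
      by (rule continuous_on_compose2[OF gc, of UNIV "\<lambda>y. max 0 y"])
        (auto intro!: continuous_on_max continuous_on_const continuous_on_id)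
    show "bounded (range g')" by (rule bounded_subset[OF \<open>bounded (g ` {0..})\<close>]) (auto simp: g'_def)
  qed
  have null: "avg_null (\<lambda>n. (\<integral>x. wt B C n x * g' (birkhoff_sum T' f n x / a n) \<partial>M') -
      measure M' B * measure M' C * W_mean g' (\<integral>x. f x \<partial>M') * u n)"
    using avg_lawD[OF law[unfolded ext_law_def] g'] .
  have "W_mean g' (\<integral>x. f x \<partial>M') = (\<integral>w. g ((\<integral>x. f x \<partial>M') * w) \<partial>W)"
    unfolding W_mean_def
  proof (rule Bochner_Integration.integral_cong[OF refl])
    fix w assume "w \<in> space W"
    moreover have "0 \<le> (\<integral>x. f x \<partial>M')" using f'(2) by (intro integral_nonneg_AE) (auto intro: AE_I2)
    ultimately have "0 \<le> (\<integral>x. f x \<partial>M') * w" using W by simp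
    then show "g' ((\<integral>x. f x \<partial>M') * w) = g ((\<integral>x. f x \<partial>M') * w)" by (simp add: g'_def)
  qed
  moreover have "(\<integral>x. wt B C n x * g' (birkhoff_sum T' f n x / a n) \<partial>M') =
      (LINT x:(B \<inter> (T' ^^ n) -` C)|M'. g (birkhoff_sum T' f n x / a n))" if "1 \<le> n" for n
    unfolding set_lebesgue_integral_def
  proof (rule Bochner_Integration.integral_cong[OF refl])
    fix x assume x: "x \<in> space M'"
    have "0 \<le> birkhoff_sum T' f n x / a n"
      using f'(2) ext_funpow_space[OF x] a_pos[OF that] by (auto simp: birkhoff_sum_def intro!: divide_nonneg_pos sum_nonneg)
    then have "g' (birkhoff_sum T' f n x / a n) = g (birkhoff_sum T' f n x / a n)" by (simp add: g'_def)
    then show "wt B C n x * g' (birkhoff_sum T' f n x / a n) = indicat_real (B \<inter> (T' ^^ n) -` C) x *\<^sub>R g (birkhoff_sum T' f n x / a n)"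
      by (simp add: wt_eq_indicator)
  qed
  ultimately have "avg_null (\<lambda>n. (LINT x:(B \<inter> (T' ^^ n) -` C)|M'. g (birkhoff_sum T' f n x / a n))
        - measure M' B * measure M' C * (\<integral>w. g ((\<integral>x. f x \<partial>M') * w) \<partial>W) * u n)"
    by (intro avg_null_mono[OF null]) simp
  then show ?thesis unfolding avg_null_iff .
qed

end

section \<open>Mixing of the natural extension\<close>

text \<open>Regular variation is given for the version \<open>b\<close>, whereas the mixing property
  is exploited for an arbitrary version \<open>a\<close> with its \<open>u\<close>. The divergence
  of the return sequence of \<open>G\<close> refers to neither version and transports the growth
  from \<open>b\<close> to \<open>a\<close>.\<close>

lemma renewal_extension_exists:
  fixes M :: "'a measure" and u :: "nat \<Rightarrow> real"
  assumes \<gamma>: "0 < \<gamma>" and wre: "weakly_rationally_ergodic M T" and ext: "natural_extension_measure M T M'"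
    and b: "return_sequence M T b" "regularly_varying \<gamma> b"
    and a: "return_sequence M T a" and u: "u \<sim>[sequentially] (\<lambda>n. \<gamma> * a n / real n)"
    and mix: "integrated_tied_down_renewal_mixing \<gamma> W M T"
    and W: "prob_space W" "(\<lambda>y. y) \<in> borel_measurable W"
  obtains G where "renewal_extension M T M' a u W G" "(\<lambda>n. set_return_seq M T G n / a n) \<longlonglongrightarrow> 1"
proof -
  have mpt: "mpt M T" and cons: "conservative M T" and erg: "ergodic M T"
    using wre by (auto simp: weakly_rationally_ergodic_def)
  obtain F where F: "F \<in> rat_erg_sets M T" "0 < emeasure M F" using wre by (auto simp: weakly_rationally_ergodic_def)
  then have Fs: "F \<in> sets M" "emeasure M F < \<infinity>" by (auto simp: rat_erg_sets_def)
  then have Ff: "F \<in> fmeasurable M" by (auto simp: fmeasurable_def)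
  have mF: "0 < measure M F" using F(2) Fs(2) by (simp add: measure_def enn2real_positive_iff)
  obtain R where R: "dense_hereditary_ring M R" and
    mixR: "\<And>B C g f. B \<in> R \<inter> rat_erg_sets M T \<Longrightarrow> C \<in> R \<inter> rat_erg_sets M T \<Longrightarrow> g \<in> C_B \<Longrightarrow> f \<in> L1_nonneg M \<Longrightarrow>
           (\<lambda>N. 1 / a N * (\<Sum>n=1..N.
               \<bar>(LINT x:(B \<inter> (T ^^ n) -` C)|M. g (birkhoff_sum T f n x / a n))
                 - measure M B * measure M C * (\<integral>w. g ((\<integral>x. f x \<partial>M) * w) \<partial>W) * u n\<bar>)) \<longlonglongrightarrow> 0"
    using mix a u unfolding integrated_tied_down_renewal_mixing_def by blast
  note R' = R[unfolded dense_hereditary_ring_def, THEN conjunct2]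
  note R_fin = R'[THEN conjunct1] and R_sub = R'[THEN conjunct2, THEN conjunct1]
    and R_dense = R'[THEN conjunct2, THEN conjunct2]
  have R_props: "A \<in> sets M \<and> emeasure M A < \<infinity>" "B \<in> sets M \<Longrightarrow> B \<subseteq> A \<Longrightarrow> B \<in> R" if "A \<in> R" for A B
    using bspec[OF R_fin that] bspec[OF R_sub that] by blast+
  \<comment> \<open>An element of the ring closer to \<open>F\<close> than m(F) meets
    \<open>F\<close> in positive measure. The intersection lies in the ring and in R(T), together
    with all its measurable subsets.\<close>
  obtain B where B: "B \<in> R" "measure M (sym_diff F B) < measure M F"
    using R_dense[rule_format, OF Fs mF] by (elim bexE)
  have Bf: "B \<in> fmeasurable M" using R_props(1)[OF B(1)] by (simp add: fmeasurable_def)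
  define G where "G = F \<inter> B"
  have Gf: "G \<in> fmeasurable M" unfolding G_def using Ff Bf by auto
  then have Gs: "G \<in> sets M" "emeasure M G < \<infinity>" by (auto simp: fmeasurable_def)
  have GR: "G \<in> R" using R_props(2)[OF B(1) Gs(1)] by (auto simp: G_def)
  have G_rat: "G \<in> rat_erg_sets M T" by (rule rat_erg_sets_subset[OF mpt F(1) Gs(1)]) (auto simp: G_def)
  have mG: "0 < measure M G"
  proof -
    have "measure M (F - G) \<le> measure M (sym_diff F B)"
      by (rule measure_mono_fmeasurable) (use Ff Bf Gs in \<open>auto simp: G_def\<close>)
    moreover have "measure M (F - G) = measure M F - measure M G"
      by (rule measurable_measure_Diff[OF Ff Gs(1)]) (auto simp: G_def)
    ultimately show ?thesis using B(2) by linarith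
  qed
  then have eG: "0 < emeasure M G" using Gf by (simp add: emeasure_eq_measure2)
  have a_pos: "\<And>n. 1 \<le> n \<Longrightarrow> 0 < a n" and b_pos: "\<And>n. 1 \<le> n \<Longrightarrow> 0 < b n"
    using a b(1) by (auto simp: return_sequence_def)
  have ratio: "(\<lambda>n. set_return_seq M T G n / a n) \<longlonglongrightarrow> 1" and ratio_b: "(\<lambda>n. set_return_seq M T G n / b n) \<longlonglongrightarrow> 1"
    using a b(1) G_rat eG by (auto simp: return_sequence_def)
  have top: "filterlim (set_return_seq M T G) at_top sequentially"
    by (rule return_seq_at_top[OF mpt Gs mG b_pos ratio_b b(2) \<gamma>])
  have a_props: "filterlim a at_top sequentially" "(\<lambda>n. a (Suc n) / a n) \<longlonglongrightarrow> 1"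
      "\<exists>K>0. \<forall>n N. 1 \<le> n \<longrightarrow> n \<le> N \<longrightarrow> a n \<le> K * a N"
    using return_a_props[OF mpt Gs mG _ ratio top] a_pos by blast+
  \<comment> \<open>The one-step ratio is computed for the explicit sequence and passed to
    \<open>u\<close> by asymptotic equivalence.\<close>
  let ?v = "\<lambda>n. \<gamma> * a n / real n"
  have v: "(\<lambda>n. ?v (Suc n)) \<sim>[sequentially] ?v"
  proof (rule asymp_equivI')
    have "(\<lambda>n. real n / real (Suc n)) \<longlonglongrightarrow> 1" by real_asymp
    then have "(\<lambda>n. (a (Suc n) / a n) * (real n / real (Suc n))) \<longlonglongrightarrow> 1 * 1" by (intro tendsto_mult a_props(2))
    moreover have "\<forall>\<^sub>F n in sequentially. (a (Suc n) / a n) * (real n / real (Suc n)) = ?v (Suc n) / ?v n"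
      using eventually_ge_at_top[of 1]
    proof eventually_elim
      case (elim n)
      show ?case using \<gamma> by simp
    qed
    ultimately show "(\<lambda>n. ?v (Suc n) / ?v n) \<longlonglongrightarrow> 1" by (rule tendsto_eventually_eq) simp
  qed
  have u_ratio: "(\<lambda>n. u (Suc n)) \<sim>[sequentially] u"
    using asymp_equiv_trans[OF asymp_equiv_trans[OF asymp_equiv_compose'[OF u filterlim_Suc] v] asymp_equiv_symI[OF u]] .
  let ?x = "\<lambda>n. measure M (G \<inter> (T ^^ n) -` G)"
  \<comment> \<open>With g = 1 the mixing property compares m(G)^2 u with the correlations of
    \<open>G\<close>, up to a total error below a(N). The correlations up to N sum to at most m(G)^2
    times the return sequence at N + 1, which is below 2 a(N + 1), hence below 4 a(N).\<close>
  have u_bound: "\<forall>\<^sub>F N in sequentially. (\<Sum>n=1..N. \<bar>u n\<bar>) \<le> (4 + 1 / (measure M G)\<^sup>2) * a N"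
  proof -
    interpret prob_space W by (rule W(1))
    have "(\<lambda>_. 1) \<in> C_B" "(\<lambda>_. 0) \<in> L1_nonneg M" by (auto simp: C_B_def L1_nonneg_def bounded_iff)
    from mixR[OF _ _ this, of G G] GR G_rat
    have "(\<lambda>N. 1 / a N * (\<Sum>n=1..N. \<bar>(LINT x:(G \<inter> (T ^^ n) -` G)|M. (1::real)) - measure M G * measure M G * u n\<bar>)) \<longlonglongrightarrow> 0"
      by (simp add: prob_space)
    moreover have "(LINT x:(G \<inter> (T ^^ n) -` G)|M. (1::real)) = ?x n" for n
      unfolding set_lebesgue_integral_def
      using sets.sets_into_space[OF return_sets[OF mpt Gs]] by (simp add: Int_absorb2)
    ultimately have "(\<lambda>N. 1 / a N * (\<Sum>n=1..N. \<bar>?x n - measure M G * measure M G * u n\<bar>)) \<longlonglongrightarrow> 0" by simp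
    then have "\<forall>\<^sub>F N in sequentially. 1 / a N * (\<Sum>n=1..N. \<bar>?x n - measure M G * measure M G * u n\<bar>) < 1"
      by (rule order_tendstoD(2)) simp
    moreover have "\<forall>\<^sub>F N in sequentially. a (Suc N) / a N < 2"
      using order_tendstoD(2)[OF a_props(2), of 2] by simp
    moreover have "\<forall>\<^sub>F N in sequentially. set_return_seq M T G (Suc N) / a (Suc N) < 2"
      by (rule order_tendstoD(2)[OF LIMSEQ_Suc[OF ratio]]) simp
    ultimately show ?thesis using eventually_ge_at_top[of 1]
    proof eventually_elim
      case (elim N)
      have aN: "0 < a N" "0 < a (Suc N)" using a_pos elim by auto
      have "set_return_seq M T G (Suc N) \<le> 2 * a (Suc N)" using elim(3) aN by (simp add: divide_less_eq)
      also have "\<dots> \<le> 4 * a N" using elim(2) aN by (simp add: divide_less_eq)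
      finally have "(measure M G)\<^sup>2 * set_return_seq M T G (Suc N) \<le> (measure M G)\<^sup>2 * (4 * a N)"
        by (rule mult_left_mono) simp
      then have "(\<Sum>k<Suc N. ?x k) \<le> (measure M G)\<^sup>2 * (4 * a N)" using mG by (simp add: set_return_seq_def)
      moreover have "(\<Sum>k=1..N. ?x k) \<le> (\<Sum>k<Suc N. ?x k)" by (rule sum_mono2) auto
      ultimately have x: "(\<Sum>k=1..N. ?x k) \<le> (measure M G)\<^sup>2 * (4 * a N)" by linarith
      have "(measure M G)\<^sup>2 * (\<Sum>n=1..N. \<bar>u n\<bar>) = (\<Sum>n=1..N. \<bar>measure M G * measure M G * u n\<bar>)"
        by (simp add: sum_distrib_left abs_mult power2_eq_square)
      also have "\<dots> \<le> (\<Sum>n=1..N. \<bar>?x n - measure M G * measure M G * u n\<bar> + ?x n)"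
      proof (rule sum_mono)
        fix n
        show "\<bar>measure M G * measure M G * u n\<bar> \<le> \<bar>?x n - measure M G * measure M G * u n\<bar> + ?x n"
          using measure_nonneg[of M "G \<inter> (T ^^ n) -` G"] by linarith
      qed
      also have "\<dots> = (\<Sum>n=1..N. \<bar>?x n - measure M G * measure M G * u n\<bar>) + (\<Sum>n=1..N. ?x n)"
        by (rule sum.distrib)
      also have "\<dots> \<le> a N + (measure M G)\<^sup>2 * (4 * a N)"
        using elim(1) aN x by (intro add_mono) (simp_all add: divide_less_eq)
      finally have "1 / (measure M G)\<^sup>2 * ((measure M G)\<^sup>2 * (\<Sum>n=1..N. \<bar>u n\<bar>)) \<le>
          1 / (measure M G)\<^sup>2 * (a N + (measure M G)\<^sup>2 * (4 * a N))"
        by (rule mult_left_mono) simp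
      then show ?case using mG by (simp add: algebra_simps)
    qed
  qed
  interpret A: renewal_averages a u W
  proof (rule renewal_averages.intro)
    show "\<exists>K. \<forall>\<^sub>F N in sequentially. (\<Sum>n=1..N. \<bar>u n\<bar>) \<le> K * a N" using u_bound by blast
  qed (fact a_pos a_props u_ratio W)+
  have "renewal_extension M T M' a u W G"
  proof (intro renewal_extension.intro natural_extension.intro renewal_extension_axioms.intro)
    fix B C and f :: "'a \<Rightarrow> real" assume BC: "B \<in> sets M" "C \<in> sets M" "B \<subseteq> G" "C \<subseteq> G"
      and f: "integrable M f" "\<And>x. x \<in> space M \<Longrightarrow> 0 \<le> f x"
    have B: "B \<in> R \<inter> rat_erg_sets M T" and C: "C \<in> R \<inter> rat_erg_sets M T"
      using R_props(2)[OF GR] rat_erg_sets_subset[OF mpt G_rat] BC by auto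
    show "A.avg_law M (\<lambda>n x. indicator B x * indicator C ((T ^^ n) x)) (\<lambda>n x. birkhoff_sum T f n x / a n)
        (measure M B * measure M C) (\<integral>x. f x \<partial>M)"
      unfolding A.avg_law_def
    proof (intro allI impI)
      fix g :: "real \<Rightarrow> real" assume g: "continuous_on UNIV g" "bounded (range g)"
      have "g ` {0..} \<subseteq> range g" by auto
      then have "g \<in> C_B" using continuous_on_subset[OF g(1)] bounded_subset[OF g(2)] by (simp add: C_B_def)
      from mixR[OF B C this, of f] f have
        "A.avg_null (\<lambda>n. (LINT x:(B \<inter> (T ^^ n) -` C)|M. g (birkhoff_sum T f n x / a n))
          - measure M B * measure M C * (\<integral>w. g ((\<integral>x. f x \<partial>M) * w) \<partial>W) * u n)"
        unfolding A.avg_null_iff by (simp add: L1_nonneg_def)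
      moreover have "(LINT x:(B \<inter> (T ^^ n) -` C)|M. g (birkhoff_sum T f n x / a n)) =
          (\<integral>x. indicator B x * indicator C ((T ^^ n) x) * g (birkhoff_sum T f n x / a n) \<partial>M)" for n
        unfolding set_lebesgue_integral_def
        by (rule Bochner_Integration.integral_cong) (auto simp: indicator_def)
      ultimately show "A.avg_null (\<lambda>n. (\<integral>x. indicator B x * indicator C ((T ^^ n) x) * g (birkhoff_sum T f n x / a n) \<partial>M)
          - measure M B * measure M C * A.W_mean g (\<integral>x. f x \<partial>M) * u n)"
        by (simp add: A.W_mean_def)
    qed
  qed (fact mpt ext A.renewal_averages_axioms Gf mG cons erg a_props(3))+
  then show thesis using that ratio by blast
qed

theorem theorem6p4:
  fixes \<gamma> :: real and M :: "'a measure" and T :: "'a \<Rightarrow> 'a" and a :: "nat \<Rightarrow> real"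
    and M' :: "(nat \<Rightarrow> 'a) measure" and Y W :: "real measure"
  assumes "0 < \<gamma>" and "\<gamma> < 1"
    and "mittag_leffler_law \<gamma> Y" and "size_biased_law Y W"
    and "standard_space M"
    and "weakly_rationally_ergodic M T"
    and "return_sequence M T a" and "regularly_varying \<gamma> a"
    and "integrated_tied_down_renewal_mixing \<gamma> W M T"
    and "natural_extension_measure M T M'"
  shows "weakly_rationally_ergodic M' (nat_ext_map T) \<and>
    (\<exists>a'. return_sequence M' (nat_ext_map T) a' \<and> regularly_varying \<gamma> a') \<and>
    integrated_tied_down_renewal_mixing \<gamma> W M' (nat_ext_map T)"
proof -
  have W: "prob_space W" "sets W = sets (restrict_space borel {0..})"
    using assms(4) by (auto simp: size_biased_law_def nonneg_law_def)
  have W_borel: "(\<lambda>y. y) \<in> borel_measurable W"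
    unfolding measurable_cong_sets[OF W(2) refl] by (rule measurable_restrict_space1) simp
  have W_space: "space W = {0..}"
    using sets_eq_imp_space_eq[OF W(2)] by (simp add: space_restrict_space)
  \<comment> \<open>Used twice: with \<open>a\<close> for ergodicity and the return sequence, and
    with each version given upstairs for the mixing property.\<close>
  note ex = renewal_extension_exists[OF assms(1,6,10,7,8) _ _ assms(9) W(1) W_borel]
  obtain G where G: "renewal_extension M T M' a (\<lambda>n. \<gamma> * a n / real n) W G" and
    base: "(\<lambda>n. set_return_seq M T G n / a n) \<longlonglongrightarrow> 1"
    by (rule ex[OF assms(7) asymp_equiv_refl])
  interpret G: renewal_extension M T M' a "\<lambda>n. \<gamma> * a n / real n" W G by (rule G)
  note wre = G.ext_weakly_rationally_ergodic[OF base] and ret = G.ext_return_sequence[OF base]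
  have "integrated_tied_down_renewal_mixing \<gamma> W M' (nat_ext_map T)"
    unfolding integrated_tied_down_renewal_mixing_def
  proof (intro allI impI)
    \<comment> \<open>All versions upstairs have to be treated. The set \<open>lift G\<close>
      compares such a version with \<open>a\<close>, so it is also a version of the return sequence
      of \<open>T\<close>, and the mixing property of \<open>T\<close> may be invoked with
      it.\<close>
    fix a' u' assume a': "return_sequence M' (nat_ext_map T) a'" and u': "u' \<sim>[sequentially] (\<lambda>n. \<gamma> * a' n / real n)"
    have a'_pos: "0 < a' n" if "1 \<le> n" for n using a' that by (auto simp: return_sequence_def)
    have "(\<lambda>n. set_return_seq M' (nat_ext_map T) (G.lift G) n / a' n) \<longlonglongrightarrow> 1"
      using a' G.lift_G_rat_erg[OF base] G.measure_lift_G_pos(4) by (auto simp: return_sequence_def)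
    from tendsto_divide[OF this G.lift_G_return[OF base]]
    have "(\<lambda>n. (set_return_seq M' (nat_ext_map T) (G.lift G) n / a' n) / (set_return_seq M' (nat_ext_map T) (G.lift G) n / a n)) \<longlonglongrightarrow> 1"
      by simp
    moreover have "\<forall>\<^sub>F n in sequentially. (set_return_seq M' (nat_ext_map T) (G.lift G) n / a' n) /
        (set_return_seq M' (nat_ext_map T) (G.lift G) n / a n) = a n / a' n"
      using eventually_ge_at_top[of 1]
    proof eventually_elim
      case (elim n)
      have "0 < set_return_seq M' (nat_ext_map T) (G.lift G) n"
        by (rule set_return_seq_pos[OF G.ext_mpt G.lift_G_sets _ G.measure_lift_G_pos(1) elim])
          (use G.lift_G in \<open>auto simp: fmeasurable_def\<close>)
      then show ?case by simp
    qed
    ultimately have aa': "(\<lambda>n. a n / a' n) \<longlonglongrightarrow> 1" by (rule tendsto_eventually_eq) simp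
    have "return_sequence M T a'"
      unfolding return_sequence_def
    proof (intro conjI allI impI ballI a'_pos)
      fix A assume "A \<in> rat_erg_sets M T" "0 < emeasure M A"
      then have "(\<lambda>n. set_return_seq M T A n / a n) \<longlonglongrightarrow> 1" using assms(7) by (auto simp: return_sequence_def)
      from tendsto_mult[OF this aa']
      have "(\<lambda>n. set_return_seq M T A n / a n * (a n / a' n)) \<longlonglongrightarrow> 1" by simp
      moreover have "\<forall>\<^sub>F n in sequentially. set_return_seq M T A n / a n * (a n / a' n) = set_return_seq M T A n / a' n"
        using eventually_ge_at_top[of 1]
      proof eventually_elim
        case (elim n)
        show ?case using G.a_pos[OF elim] by simp
      qed
      ultimately show "(\<lambda>n. set_return_seq M T A n / a' n) \<longlonglongrightarrow> 1" by (rule tendsto_eventually_eq) simp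
    qed
    \<comment> \<open>The set \<open>H\<close> belongs to this version and need not be
      \<open>G\<close>, so the ring is built from \<open>H\<close>.\<close>
    then obtain H where "renewal_extension M T M' a' u' W H" by (rule ex[OF _ u'])
    then interpret H: renewal_extension M T M' a' u' W H .
    show "\<exists>R. dense_hereditary_ring M' R \<and>
        (\<forall>B\<in>R \<inter> rat_erg_sets M' (nat_ext_map T). \<forall>C\<in>R \<inter> rat_erg_sets M' (nat_ext_map T). \<forall>g\<in>C_B. \<forall>f\<in>L1_nonneg M'.
          (\<lambda>N. 1 / a' N * (\<Sum>n=1..N.
            \<bar>(LINT x:(B \<inter> (nat_ext_map T ^^ n) -` C)|M'. g (birkhoff_sum (nat_ext_map T) f n x / a' n))
              - measure M' B * measure M' C * (\<integral>w. g ((\<integral>x. f x \<partial>M') * w) \<partial>W) * u' n\<bar>)) \<longlonglongrightarrow> 0)"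
      using H.dense_hereditary_visited_ring H.mixing_visited_ring W_space
      by (intro exI[of _ H.visited_ring]) blast
  qed
  then show ?thesis using wre ret assms(8) by blast
qed

end
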